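(* For every given integer $m \geq 2$ and every given finite monoid $M$, it is decidable whether $M$ is in $\mathbf{R}_m \vee \mathbf{L}_m$.
   Context: A variety is a class of finite monoids closed under submonoids, homomorphic images and finite direct products. The join $\mathbf{V} \vee \mathbf{W}$ of two varieties is the smallest variety containing both. A finite monoid is given as input, e.g., by its multiplication table. For a finite monoid $M$ and $x,y\in M$: $x \mathrel{\mathcal{R}} y$ iff $xM = yM$, and $x \mathrel{\mathcal{L}} y$ iff $Mx = My$. Define congruences on $M$: $x \sim_K y$ iff for all idempotents $e$ of $M$, if $ex \mathrel{\mathcal{R}} e$ or $ey \mathrel{\mathcal{R}} e$, then $ex = ey$; and $x \sim_D y$ iff for all idempotents $e$ of $M$, if $xe \mathrel{\mathcal{L}} e$ or $ye \mathrel{\mathcal{L}} e$, then $xe = ye$. For a variety $\mathbf{V}$, let $\mathbf{K} ⓜ \mathbf{V}$ be the class of all finite monoids $M$ with $M/{\sim_K} \in \mathbf{V}$, and $\mathbf{D} ⓜ \mathbf{V}$ the class of all finite monoids $M$ with $M/{\sim_D} \in \mathbf{V}$. The Trotter-Weil hierarchy: $\mathbf{R}_2$ is the variety of $\mathcal{R}$-trivial finite monoids (those in which $\mathcal{R}$ is equality), $\mathbf{L}_2$ is the variety of $\mathcal{L}$-trivial finite monoids, and for $m \geq 2$, $\mathbf{R}_{m+1} = \mathbf{K} ⓜ \mathbf{L}_m$ and $\mathbf{L}_{m+1} = \mathbf{D} ⓜ \mathbf{R}_m$. Each of these is a variety. *)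

theory Defs
  imports "HOL-Algebra.Product_Groups" "HOL-Library.Nat_Bijection"
begin

section \<open>Finite monoids and varieties\<close>

text \<open>
  Classes of finite monoids are represented by sets of monoids whose carrier is a finite set of
  natural numbers; every finite monoid is isomorphic to one of these. A construction that leaves
  the type \<open>nat\<close> (products, quotients) is replaced by its isomorphic copies.
\<close>

definition finite_monoids :: "nat monoid set" where
  "finite_monoids = {M. monoid M \<and> finite (carrier M)}"

text \<open>
  \<^const>\<open>epi\<close> does not mention the neutral element, but a surjective multiplicative map between
  monoids maps the neutral element to the neutral element. Despite its name,
  \<^const>\<open>product_group\<close> is the componentwise product of arbitrary monoids. The case \<open>k = 0\<close>, the
  empty product, is the trivial monoid.
\<close>

definition variety :: "nat monoid set \<Rightarrow> bool" where
  "variety V \<longleftrightarrow>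
     V \<subseteq> finite_monoids \<and>
     (\<forall>M\<in>V. \<forall>H. submonoid H M \<longrightarrow> M\<lparr>carrier := H\<rparr> \<in> V) \<and>
     (\<forall>M\<in>V. \<forall>N\<in>finite_monoids. epi M N \<noteq> {} \<longrightarrow> N \<in> V) \<and>
     (\<forall>(k::nat) F. (\<forall>i<k. F i \<in> V) \<longrightarrow>
        (\<forall>P\<in>finite_monoids. P \<cong> product_group {..<k} F \<longrightarrow> P \<in> V))"

definition variety_join :: "nat monoid set \<Rightarrow> nat monoid set \<Rightarrow> nat monoid set" where
  "variety_join V W = \<Inter>{U. variety U \<and> V \<subseteq> U \<and> W \<subseteq> U}"


section \<open>The Trotter-Weil hierarchy\<close>

definition green_R :: "('a, 'b) monoid_scheme \<Rightarrow> 'a \<Rightarrow> 'a \<Rightarrow> bool" where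
  "green_R M x y \<longleftrightarrow> x <#\<^bsub>M\<^esub> carrier M = y <#\<^bsub>M\<^esub> carrier M"

definition green_L :: "('a, 'b) monoid_scheme \<Rightarrow> 'a \<Rightarrow> 'a \<Rightarrow> bool" where
  "green_L M x y \<longleftrightarrow> carrier M #>\<^bsub>M\<^esub> x = carrier M #>\<^bsub>M\<^esub> y"

definition idempotents :: "('a, 'b) monoid_scheme \<Rightarrow> 'a set" where
  "idempotents M = {e \<in> carrier M. e \<otimes>\<^bsub>M\<^esub> e = e}"

definition sim_K :: "('a, 'b) monoid_scheme \<Rightarrow> ('a \<times> 'a) set" where
  "sim_K M = {(x, y). x \<in> carrier M \<and> y \<in> carrier M \<and>
     (\<forall>e\<in>idempotents M.
        green_R M (e \<otimes>\<^bsub>M\<^esub> x) e \<or> green_R M (e \<otimes>\<^bsub>M\<^esub> y) e \<longrightarrow> e \<otimes>\<^bsub>M\<^esub> x = e \<otimes>\<^bsub>M\<^esub> y)}"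

definition sim_D :: "('a, 'b) monoid_scheme \<Rightarrow> ('a \<times> 'a) set" where
  "sim_D M = {(x, y). x \<in> carrier M \<and> y \<in> carrier M \<and>
     (\<forall>e\<in>idempotents M.
        green_L M (x \<otimes>\<^bsub>M\<^esub> e) e \<or> green_L M (y \<otimes>\<^bsub>M\<^esub> e) e \<longrightarrow> x \<otimes>\<^bsub>M\<^esub> e = y \<otimes>\<^bsub>M\<^esub> e)}"

text \<open>
  For a congruence \<open>r\<close>, the product set \<open>A <#> B\<close> of two classes lies in a single class, which is
  therefore its image under \<open>r\<close>.
\<close>

definition quotient_monoid :: "('a, 'b) monoid_scheme \<Rightarrow> ('a \<times> 'a) set \<Rightarrow> 'a set monoid" where
  "quotient_monoid M r =
     \<lparr>carrier = carrier M // r,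
      monoid.mult = (\<lambda>A B. r `` (A <#>\<^bsub>M\<^esub> B)),
      one = r `` {\<one>\<^bsub>M\<^esub>}\<rparr>"

definition malcev_K :: "nat monoid set \<Rightarrow> nat monoid set" where
  "malcev_K V = {M \<in> finite_monoids. \<exists>N\<in>V. quotient_monoid M (sim_K M) \<cong> N}"

definition malcev_D :: "nat monoid set \<Rightarrow> nat monoid set" where
  "malcev_D V = {M \<in> finite_monoids. \<exists>N\<in>V. quotient_monoid M (sim_D M) \<cong> N}"

definition R_trivial_monoids :: "nat monoid set" where
  "R_trivial_monoids =
     {M \<in> finite_monoids. \<forall>x\<in>carrier M. \<forall>y\<in>carrier M. green_R M x y \<longrightarrow> x = y}"

definition L_trivial_monoids :: "nat monoid set" where
  "L_trivial_monoids =
     {M \<in> finite_monoids. \<forall>x\<in>carrier M. \<forall>y\<in>carrier M. green_L M x y \<longrightarrow> x = y}"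

text \<open>The hierarchy starts at index 2; the values at 0 and 1 are without significance.\<close>

fun TW_R :: "nat \<Rightarrow> nat monoid set" and TW_L :: "nat \<Rightarrow> nat monoid set" where
  "TW_R m = (if m \<le> 2 then R_trivial_monoids else malcev_K (TW_L (m - 1)))"
| "TW_L m = (if m \<le> 2 then L_trivial_monoids else malcev_D (TW_R (m - 1)))"

declare TW_R.simps [simp del] TW_L.simps [simp del]


section \<open>Computable functions\<close>

text \<open>
  \<open>recursive n f\<close>: on argument lists of length \<open>n\<close>, the function \<open>f\<close> is a total recursive function
  in \<open>n\<close> variables. Minimization is only applied to regular functions, so no partial functions
  are needed. The values of \<open>f\<close> on lists of any other length are irrelevant.
\<close>

inductive recursive :: "nat \<Rightarrow> (nat list \<Rightarrow> nat) \<Rightarrow> bool" where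
  zero: "recursive n (\<lambda>xs. 0)"
| succ: "recursive 1 (\<lambda>xs. Suc (xs ! 0))"
| proj: "i < n \<Longrightarrow> recursive n (\<lambda>xs. xs ! i)"
| comp: "recursive (length gs) f \<Longrightarrow> (\<And>g. g \<in> set gs \<Longrightarrow> recursive n g) \<Longrightarrow>
    recursive n (\<lambda>xs. f (map (\<lambda>g. g xs) gs))"
| prim: "recursive n f \<Longrightarrow> recursive (Suc (Suc n)) g \<Longrightarrow>
    recursive (Suc n) (\<lambda>xs. rec_nat (f (tl xs)) (\<lambda>k r. g (k # r # tl xs)) (hd xs))"
| mini: "recursive (Suc n) f \<Longrightarrow> (\<And>xs. length xs = n \<Longrightarrow> \<exists>k. f (k # xs) = 0) \<Longrightarrow>
    recursive n (\<lambda>xs. LEAST k. f (k # xs) = 0)"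

text \<open>
  A finite monoid is given as input by its multiplication table, for which its elements are
  numbered \<open>0, \<dots>, n - 1\<close>. The table determines the neutral element.
\<close>

definition table_code :: "nat monoid \<Rightarrow> nat" where
  "table_code M =
     (let n = card (carrier M)
      in list_encode (map (\<lambda>i. list_encode (map (\<lambda>j. i \<otimes>\<^bsub>M\<^esub> j) [0..<n])) [0..<n]))"

end

theory Submission
  imports Defs "HOL-Library.Sublist"
begin

text \<open>
  Call \<open>(p w t, p w' t)\<close> a pair of level \<open>n + 1\<close> if \<open>(w, w')\<close> is a pair of level \<open>n\<close>, right
  multiplication by \<open>w\<close> and by \<open>w'\<close> stays in the \<open>\<R>\<close>-class of \<open>p\<close>, and left multiplication by them
  stays in the \<open>\<L>\<close>-class of \<open>t\<close>; all pairs have level 0. A finite monoid belongs to \<open>R\<^sub>m \<or> L\<^sub>m\<close> iff it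
  is in DA and its pairs of level \<open>m - 1\<close> are trivial, and this is visible in the multiplication table.

  The condition defines a variety, because elements of a quotient have \<open>\<R>\<close>-minimal preimages, and
  induction along the hierarchy shows that it holds in \<open>R\<^sub>m\<close> and \<open>L\<^sub>m\<close>. Conversely, cut a word \<open>u\<close> by
  greedy searches for short words from the left and from the right. If \<open>u\<close> and \<open>v\<close> have the same
  image in suitable finite quotients of the free monoid, one in \<open>R\<^sub>m\<close> and one in \<open>L\<^sub>m\<close>, then their cuts
  correspond in the same order, and the factors between consecutive cuts agree one level lower. All
  \<open>\<R>\<close>-descents of prefixes and \<open>\<L>\<close>-descents of suffixes occur at cuts, so replacing the factors of
  \<open>u\<close> by those of \<open>v\<close> one after the other yields a chain of pairs of level \<open>m - 1\<close> from the value of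
  \<open>u\<close> to that of \<open>v\<close>. Hence the monoid divides a product of these two quotients.
\<close>

section \<open>Stable pairs\<close>

text \<open>DA is what makes words tractable: there, a word keeps the \<open>\<R>\<close>-class of
  an element as soon as each of its letters does (\<open>rstab_letter\<close>,
  \<open>rstab_word\<close>). So all words over the letters found between two neighbouring cuts are
  stable on both sides at once, as pairs of the next level demand.

  The obstacle is that cuts found from the left and cuts found from the right interleave. A
  congruence of the hierarchy survives a cut at full level only for the reading direction that found
  it; having both directions afterwards costs one level. Hence the induction on levels. Isolating a
  factor removes a cut on either side of it, and each removal spends up to
  \<open>K = card (carrier M)\<close> greedy jumps, because right ideals can shrink fewer than
  \<open>K\<close> times. This explains the parameter \<open>2 * (m - 1) * K\<close>.

  Stability is stated by an equation with one witness, so that homomorphisms preserve it and a table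
  can test it. Pairs of level \<open>m - 1\<close> arise by iteration from level 0, so
  \<open>m\<close> can be an input of the decision procedure.\<close>

definition rstab :: "('a, 'b) monoid_scheme \<Rightarrow> 'a \<Rightarrow> 'a \<Rightarrow> bool" where
  "rstab M p w \<longleftrightarrow> (\<exists>z\<in>carrier M. p \<otimes>\<^bsub>M\<^esub> w \<otimes>\<^bsub>M\<^esub> z = p)"

definition lstab :: "('a, 'b) monoid_scheme \<Rightarrow> 'a \<Rightarrow> 'a \<Rightarrow> bool" where
  "lstab M w t \<longleftrightarrow> (\<exists>z\<in>carrier M. z \<otimes>\<^bsub>M\<^esub> (w \<otimes>\<^bsub>M\<^esub> t) = t)"

fun stable_pairs :: "('a, 'b) monoid_scheme \<Rightarrow> nat \<Rightarrow> ('a \<times> 'a) set" where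
  "stable_pairs M 0 = carrier M \<times> carrier M"
| "stable_pairs M (Suc n) =
     {(p \<otimes>\<^bsub>M\<^esub> w \<otimes>\<^bsub>M\<^esub> t, p \<otimes>\<^bsub>M\<^esub> w' \<otimes>\<^bsub>M\<^esub> t) | p w w' t.
        p \<in> carrier M \<and> t \<in> carrier M \<and> (w, w') \<in> stable_pairs M n \<and>
        rstab M p w \<and> rstab M p w' \<and> lstab M w t \<and> lstab M w' t}"

text \<open>The usual class DA: an idempotent \<open>e\<close> satisfies \<open>e x e = e\<close>
  for each of its factors \<open>x\<close>.\<close>

definition is_DA :: "('a, 'b) monoid_scheme \<Rightarrow> bool" where
  "is_DA M \<longleftrightarrow>
     (\<forall>e\<in>carrier M. \<forall>a\<in>carrier M. \<forall>x\<in>carrier M. \<forall>b\<in>carrier M.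
        e \<otimes>\<^bsub>M\<^esub> e = e \<longrightarrow> a \<otimes>\<^bsub>M\<^esub> x \<otimes>\<^bsub>M\<^esub> b = e \<longrightarrow> e \<otimes>\<^bsub>M\<^esub> x \<otimes>\<^bsub>M\<^esub> e = e)"

definition join_cond :: "nat \<Rightarrow> ('a, 'b) monoid_scheme \<Rightarrow> bool" where
  "join_cond n M \<longleftrightarrow> is_DA M \<and> stable_pairs M n \<subseteq> Id"

lemma is_DAD:
  assumes "is_DA M" "e \<in> carrier M" "a \<in> carrier M" "x \<in> carrier M" "b \<in> carrier M"
    "e \<otimes>\<^bsub>M\<^esub> e = e" "a \<otimes>\<^bsub>M\<^esub> x \<otimes>\<^bsub>M\<^esub> b = e"
  shows "e \<otimes>\<^bsub>M\<^esub> x \<otimes>\<^bsub>M\<^esub> e = e"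
  using assms unfolding is_DA_def by blast

locale finite_monoid = monoid M for M (structure) +
  assumes fin: "finite (carrier M)"

lemma finite_monoids_iff: "M \<in> finite_monoids \<longleftrightarrow> finite_monoid M"
  by (simp add: finite_monoids_def finite_monoid_def finite_monoid_axioms_def)

lemma stable_pairs_closed:
  assumes "monoid M" "(x, y) \<in> stable_pairs M n"
  shows "x \<in> carrier M \<and> y \<in> carrier M"
  using assms(2)
proof (induction n arbitrary: x y)
  case (Suc n)
  then show ?case using assms(1) by (auto intro!: monoid.m_closed)
qed auto

context finite_monoid
begin

lemma idempotent_power:
  assumes x: "x \<in> carrier M"
  obtains n :: nat where "n > 0" "x [^] n \<otimes> x [^] n = x [^] n"
proof -
  have "\<not> inj_on (\<lambda>n::nat. x [^] n) UNIV"
  proof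
    assume "inj_on (\<lambda>n::nat. x [^] n) UNIV"
    moreover have "range (\<lambda>n::nat. x [^] n) \<subseteq> carrier M"
      using x by auto
    ultimately show False
      using fin by (meson finite_subset finite_imageD infinite_UNIV_nat)
  qed
  then obtain i j :: nat where "i < j" "x [^] i = x [^] j"
    by (metis injI linorder_neqE_nat)
  then obtain d where d: "d > 0" "x [^] i = x [^] (i + d)"
    by (metis less_imp_add_positive)
  have shift: "x [^] k = x [^] (k + d)" if "k \<ge> i" for k
  proof -
    have "x [^] k = x [^] i \<otimes> x [^] (k - i)"
      using that x by (simp add: nat_pow_mult)
    also have "\<dots> = x [^] (i + d) \<otimes> x [^] (k - i)"
      using d by simp
    also have "\<dots> = x [^] (k + d)"
      using that x by (simp add: nat_pow_mult add.commute)
    finally show ?thesis .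
  qed
  have mult: "x [^] k = x [^] (k + l * d)" if "k \<ge> i" for k l
  proof (induction l)
    case (Suc l)
    then show ?case
      using shift[of "k + l * d"] that by (simp add: ac_simps)
  qed simp
  define n where "n = Suc i * d"
  have "Suc i * 1 \<le> Suc i * d"
    using d(1) by (intro mult_le_mono2) simp
  then have "n > 0" "n \<ge> i"
    using d(1) by (auto simp: n_def)
  moreover have "x [^] n = x [^] (n + n)"
    using mult[OF \<open>n \<ge> i\<close>, of "Suc i"] by (simp only: n_def)
  ultimately show thesis
    using that[of n] nat_pow_mult[OF x, of n n] by simp
qed

text \<open>\<open>e\<close> is an idempotent power of \<open>x\<close>. It turns stability of an
  arbitrary element into a statement about idempotents, which are what \<open>sim_K\<close> and
  \<open>is_DA\<close> test.\<close>

lemma idempotent_fixing: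
  assumes q: "q \<in> carrier M" and x: "x \<in> carrier M" and qx: "q \<otimes> x = q"
  obtains e y where "e \<in> carrier M" "e \<otimes> e = e" "q \<otimes> e = q" "y \<in> carrier M" "e = x \<otimes> y" "e = y \<otimes> x"
proof -
  obtain n :: nat where n: "n > 0" "x [^] n \<otimes> x [^] n = x [^] n"
    using idempotent_power[OF x] by blast
  have *: "q \<otimes> x [^] k = q" for k :: nat
    by (induction k) (use q x qx in \<open>auto simp flip: m_assoc\<close>)
  obtain k where "n = Suc k" using n(1) gr0_conv_Suc by blast
  then have "x [^] n = x \<otimes> x [^] k" "x [^] n = x [^] k \<otimes> x"
    using x nat_pow_Suc2[OF x, of k] by simp_all
  then show thesis
    using that[of "x [^] n" "x [^] k"] n(2) *[of n] x nat_pow_closed[OF x] by blast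
qed

text \<open>In a preimage of a single point one can choose an element as low as possible for the
  \<open>\<R>\<close>-preorder; every factor that stabilises the image of such an element stabilises the element.\<close>

lemma minimal_lift:
  assumes epi: "h \<in> epi M N" and N: "monoid N" and e: "e \<in> carrier N"
  obtains q where "q \<in> carrier M" "h q = e"
    "\<And>w. w \<in> carrier M \<Longrightarrow> rstab N e (h w) \<Longrightarrow> rstab M q w"
proof -
  have h: "h \<in> hom M N" and surj: "h ` carrier M = carrier N" using epi by (auto simp: epi_def)
  obtain q0 where q0: "q0 \<in> carrier M" "h q0 = e" using e surj by (metis imageE)
  define F where "F = {q \<in> carrier M. h q = e}"
  define I where "I q = (\<lambda>z. q \<otimes> z) ` carrier M" for q
  have "q0 \<in> F" using q0 by (simp add: F_def)
  \<comment> \<open>The size of the right ideal stands in for the \<open>\<R>\<close>-preorder: for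
    nested finite ideals, equal size means equality.\<close>
  then obtain q where q: "q \<in> F" and min: "\<And>q'. q' \<in> F \<Longrightarrow> card (I q) \<le> card (I q')"
    using ex_has_least_nat[of "\<lambda>q. q \<in> F" q0 "\<lambda>q. card (I q)"] by blast
  have qc: "q \<in> carrier M" "h q = e" using q by (auto simp: F_def)
  show thesis
  proof
    fix w assume w: "w \<in> carrier M" and st: "rstab N e (h w)"
    obtain z where z: "z \<in> carrier M" "e \<otimes>\<^bsub>N\<^esub> h w \<otimes>\<^bsub>N\<^esub> h z = e"
      using st surj unfolding rstab_def by (metis imageE)
    then have "h (q \<otimes> w \<otimes> z) = e"
      using h qc w by (simp add: hom_mult)
    then have F': "q \<otimes> w \<otimes> z \<in> F"
      using qc w z by (simp add: F_def)
    have sub: "I (q \<otimes> w \<otimes> z) \<subseteq> I q"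
      unfolding I_def
    proof
      fix y assume "y \<in> (\<lambda>u. q \<otimes> w \<otimes> z \<otimes> u) ` carrier M"
      then obtain u where "u \<in> carrier M" "y = q \<otimes> (w \<otimes> z \<otimes> u)"
        using qc w z by (auto simp: m_assoc)
      then show "y \<in> (\<lambda>z. q \<otimes> z) ` carrier M"
        using w z by blast
    qed
    have "finite (I q)" using fin by (simp add: I_def)
    then have "I (q \<otimes> w \<otimes> z) = I q"
      using sub min[OF F'] card_seteq by blast
    moreover have "q \<in> I q"
      unfolding I_def using qc by (intro image_eqI[of _ _ "\<one>"]) auto
    ultimately obtain u where "u \<in> carrier M" "q = q \<otimes> w \<otimes> z \<otimes> u"
      by (auto simp: I_def)
    then show "rstab M q w"
      unfolding rstab_def using qc w z
      by (intro bexI[of _ "z \<otimes> u"]) (auto simp: m_assoc)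
  qed (use qc in auto)
qed

end

section \<open>Duality\<close>

text \<open>The result is a plain \<open>monoid\<close> record, so that
  \<open>opp (opp M) = M\<close> is an equation for plain \<open>M\<close> and dual statements
  follow by rewriting.\<close>

definition opp :: "('a, 'b) monoid_scheme \<Rightarrow> 'a monoid" where
  "opp M = \<lparr>carrier = carrier M, monoid.mult = (\<lambda>x y. y \<otimes>\<^bsub>M\<^esub> x), one = \<one>\<^bsub>M\<^esub>\<rparr>"

lemma opp_simps [simp]:
  "carrier (opp M) = carrier M" "x \<otimes>\<^bsub>opp M\<^esub> y = y \<otimes>\<^bsub>M\<^esub> x" "\<one>\<^bsub>opp M\<^esub> = \<one>\<^bsub>M\<^esub>"
  by (simp_all add: opp_def)

lemma opp_opp [simp]: "opp (opp M) = (M :: 'a monoid)"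
  by (simp add: opp_def)

lemma monoid_opp: "monoid M \<Longrightarrow> monoid (opp M)"
  by (rule monoidI) (auto simp: monoid.m_assoc monoid.m_closed)

lemma finite_monoid_opp: "finite_monoid M \<Longrightarrow> finite_monoid (opp M)"
  unfolding finite_monoid_def finite_monoid_axioms_def by (simp add: monoid_opp)

lemma opp_mem_finite_monoids [simp]: "opp M \<in> finite_monoids \<longleftrightarrow> M \<in> finite_monoids"
  using finite_monoid_opp[of M] finite_monoid_opp[of "opp M"] by (auto simp: finite_monoids_iff)

lemma hom_opp [simp]: "hom (opp M) (opp N) = hom M N"
  by (auto simp: hom_def)

lemma epi_opp [simp]: "epi (opp M) (opp N) = epi M N"
  by (simp add: epi_def)

lemma rstab_opp [simp]: "rstab (opp M) p w = lstab M w p"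
  by (simp add: rstab_def lstab_def)

lemma lstab_opp [simp]: "lstab (opp M) w p = rstab M p w"
  by (simp add: rstab_def lstab_def)

lemma stable_pairs_opp_subset:
  assumes "monoid M"
  shows "stable_pairs M n \<subseteq> stable_pairs (opp M) n"
proof (induction n)
  case (Suc n)
  interpret monoid M by fact
  show ?case
  proof
    fix xy assume "xy \<in> stable_pairs M (Suc n)"
    then obtain p w w' t where *: "xy = (p \<otimes>\<^bsub>M\<^esub> w \<otimes>\<^bsub>M\<^esub> t, p \<otimes>\<^bsub>M\<^esub> w' \<otimes>\<^bsub>M\<^esub> t)"
      "p \<in> carrier M" "t \<in> carrier M" "(w, w') \<in> stable_pairs M n"
      "rstab M p w" "rstab M p w'" "lstab M w t" "lstab M w' t"
      by auto
    then have "xy = (t \<otimes>\<^bsub>opp M\<^esub> w \<otimes>\<^bsub>opp M\<^esub> p, t \<otimes>\<^bsub>opp M\<^esub> w' \<otimes>\<^bsub>opp M\<^esub> p)"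
      using stable_pairs_closed[OF assms *(4)] by (simp add: m_assoc)
    moreover have "(w, w') \<in> stable_pairs (opp M) n" using *(4) Suc.IH by blast
    ultimately show "xy \<in> stable_pairs (opp M) (Suc n)"
      using *(2,3,5-8) unfolding stable_pairs.simps mem_Collect_eq
      by (intro exI[of _ t] exI[of _ w] exI[of _ w'] exI[of _ p]) (simp only: rstab_opp lstab_opp opp_simps simp_thms)
  qed
qed simp

lemma stable_pairs_opp:
  fixes M :: "'a monoid"
  assumes "monoid M"
  shows "stable_pairs (opp M) n = stable_pairs M n"
  using stable_pairs_opp_subset[OF assms, of n] stable_pairs_opp_subset[OF monoid_opp[OF assms], of n]
  by auto

lemma is_DA_opp:
  assumes "monoid M" "is_DA M"
  shows "is_DA (opp M)"
proof -
  interpret monoid M by fact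
  show ?thesis
    unfolding is_DA_def
  proof (intro ballI impI)
    fix e a x b
    assume c: "e \<in> carrier (opp M)" "a \<in> carrier (opp M)" "x \<in> carrier (opp M)" "b \<in> carrier (opp M)"
      and "e \<otimes>\<^bsub>opp M\<^esub> e = e" "a \<otimes>\<^bsub>opp M\<^esub> x \<otimes>\<^bsub>opp M\<^esub> b = e"
    then have "e \<otimes>\<^bsub>M\<^esub> e = e" "b \<otimes>\<^bsub>M\<^esub> x \<otimes>\<^bsub>M\<^esub> a = e"
      by (auto simp: m_assoc)
    then have "e \<otimes>\<^bsub>M\<^esub> x \<otimes>\<^bsub>M\<^esub> e = e"
      using assms(2) c unfolding is_DA_def by auto
    then show "e \<otimes>\<^bsub>opp M\<^esub> x \<otimes>\<^bsub>opp M\<^esub> e = e"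
      using c by (simp add: m_assoc)
  qed
qed

lemma join_cond_opp: "monoid (M :: 'a monoid) \<Longrightarrow> join_cond n M \<Longrightarrow> join_cond n (opp M)"
  by (simp add: join_cond_def is_DA_opp stable_pairs_opp)

section \<open>The identities define a variety\<close>

lemma rstab_hom:
  "h \<in> hom M N \<Longrightarrow> monoid M \<Longrightarrow> p \<in> carrier M \<Longrightarrow> w \<in> carrier M \<Longrightarrow> rstab M p w \<Longrightarrow> rstab N (h p) (h w)"
  unfolding rstab_def by (metis hom_in_carrier hom_mult monoid.m_closed)

lemma stable_pairs_hom:
  assumes "monoid M" "monoid N" "h \<in> hom M N" "(x, y) \<in> stable_pairs M n"
  shows "(h x, h y) \<in> stable_pairs N n"
  using assms(4)
proof (induction n arbitrary: x y)
  case 0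
  then show ?case using assms(3) by (auto simp: hom_in_carrier)
next
  case (Suc n)
  interpret M: monoid M by fact
  obtain p w w' t where *: "x = p \<otimes>\<^bsub>M\<^esub> w \<otimes>\<^bsub>M\<^esub> t" "y = p \<otimes>\<^bsub>M\<^esub> w' \<otimes>\<^bsub>M\<^esub> t"
    "p \<in> carrier M" "t \<in> carrier M" "(w, w') \<in> stable_pairs M n"
    "rstab M p w" "rstab M p w'" "lstab M w t" "lstab M w' t"
    using Suc.prems by auto
  have w: "w \<in> carrier M" "w' \<in> carrier M"
    using stable_pairs_closed[OF assms(1) *(5)] by auto
  have "lstab N (h v) (h t)" if "v \<in> carrier M" "lstab M v t" for v
    using that rstab_hom[of h "opp M" "opp N" t v] assms *(4) by (simp add: monoid_opp)
  moreover have "h x = h p \<otimes>\<^bsub>N\<^esub> h w \<otimes>\<^bsub>N\<^esub> h t" "h y = h p \<otimes>\<^bsub>N\<^esub> h w' \<otimes>\<^bsub>N\<^esub> h t"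
    using * w assms(3) by (auto simp: hom_mult)
  moreover have "rstab N (h p) (h v)" if "v \<in> carrier M" "rstab M p v" for v
    using that rstab_hom[OF assms(3,1)] *(3) by blast
  ultimately show ?case
    using * w Suc.IH[OF *(5)] hom_in_carrier[OF assms(3)]
    unfolding stable_pairs.simps mem_Collect_eq
    by (intro exI[of _ "h p"] exI[of _ "h w"] exI[of _ "h w'"] exI[of _ "h t"]) (simp only: simp_thms)
qed

text \<open>Handles submonoids and products together, since both have homomorphisms into members
  that separate points. The hypotheses in both conditions are existence statements about equations
  and survive homomorphisms; the conclusions are equations and can be checked in every
  image.\<close>

lemma join_cond_separating:
  assumes M: "monoid M"
    and N: "\<And>i. i \<in> I \<Longrightarrow> monoid (N i) \<and> join_cond n (N i) \<and> h i \<in> hom M (N i)"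
    and sep: "\<And>x y. x \<in> carrier M \<Longrightarrow> y \<in> carrier M \<Longrightarrow> (\<And>i. i \<in> I \<Longrightarrow> h i x = h i y) \<Longrightarrow> x = y"
  shows "join_cond n M"
proof -
  interpret monoid M by fact
  have "is_DA M"
    unfolding is_DA_def
  proof (intro ballI impI)
    fix e a x b
    assume c: "e \<in> carrier M" "a \<in> carrier M" "x \<in> carrier M" "b \<in> carrier M"
      and e: "e \<otimes>\<^bsub>M\<^esub> e = e" "a \<otimes>\<^bsub>M\<^esub> x \<otimes>\<^bsub>M\<^esub> b = e"
    show "e \<otimes>\<^bsub>M\<^esub> x \<otimes>\<^bsub>M\<^esub> e = e"
    proof (rule sep)
      fix i assume "i \<in> I"
      then have i: "is_DA (N i)" "h i \<in> hom M (N i)"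
        using N by (auto simp: join_cond_def)
      have "h i e \<otimes>\<^bsub>N i\<^esub> h i e = h i e"
        using e(1) c i(2) by (metis hom_mult)
      moreover have "h i a \<otimes>\<^bsub>N i\<^esub> h i x \<otimes>\<^bsub>N i\<^esub> h i b = h i e"
        using c i(2) by (subst e(2)[symmetric]) (simp add: hom_mult)
      ultimately have "h i e \<otimes>\<^bsub>N i\<^esub> h i x \<otimes>\<^bsub>N i\<^esub> h i e = h i e"
        using i c hom_in_carrier[OF i(2)] unfolding is_DA_def by blast
      then show "h i (e \<otimes>\<^bsub>M\<^esub> x \<otimes>\<^bsub>M\<^esub> e) = h i e"
        using i(2) c by (simp add: hom_mult)
    qed (use c in auto)
  qed
  moreover have "x = y" if xy: "(x, y) \<in> stable_pairs M n" for x y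
  proof (rule sep)
    show "h i x = h i y" if "i \<in> I" for i
      using stable_pairs_hom[OF M _ _ xy, of "N i" "h i"] N[OF that] by (auto simp: join_cond_def)
  qed (use stable_pairs_closed[OF M xy] in auto)
  ultimately show ?thesis
    by (auto simp: join_cond_def)
qed

text \<open>\<open>p\<close> is lifted to a low preimage for the \<open>\<R>\<close>-preorder and
  \<open>t\<close>, by duality, to one for the \<open>\<L>\<close>-preorder. Stability then lifts
  for whatever lifts of \<open>w\<close> and \<open>w'\<close> the induction provides.\<close>

lemma stable_pairs_lift:
  assumes M: "finite_monoid M" and N: "monoid N" and h: "h \<in> epi M N"
    and xy: "(x, y) \<in> stable_pairs N n"
  shows "\<exists>x' y'. (x', y') \<in> stable_pairs M n \<and> h x' = x \<and> h y' = y"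
  using xy
proof (induction n arbitrary: x y)
  case 0
  then have "x \<in> h ` carrier M" "y \<in> h ` carrier M" using h by (auto simp: epi_def)
  then show ?case by auto
next
  case (Suc n)
  interpret M: finite_monoid M by fact
  interpret Mop: finite_monoid "opp M" by (rule finite_monoid_opp[OF M])
  have hh: "h \<in> hom M N" "h ` carrier M = carrier N" using h by (auto simp: epi_def)
  obtain p w w' t where *: "x = p \<otimes>\<^bsub>N\<^esub> w \<otimes>\<^bsub>N\<^esub> t" "y = p \<otimes>\<^bsub>N\<^esub> w' \<otimes>\<^bsub>N\<^esub> t"
    "p \<in> carrier N" "t \<in> carrier N" "(w, w') \<in> stable_pairs N n"
    "rstab N p w" "rstab N p w'" "lstab N w t" "lstab N w' t"
    using Suc.prems by auto
  obtain v v' where v: "(v, v') \<in> stable_pairs M n" "h v = w" "h v' = w'"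
    using Suc.IH[OF *(5)] by blast
  have vc: "v \<in> carrier M" "v' \<in> carrier M"
    using stable_pairs_closed[OF M.monoid_axioms v(1)] by auto
  obtain q where q: "q \<in> carrier M" "h q = p"
    and st: "\<And>w. w \<in> carrier M \<Longrightarrow> rstab N p (h w) \<Longrightarrow> rstab M q w"
    using M.minimal_lift[OF h N *(3)] by blast
  have "h \<in> epi (opp M) (opp N)" "t \<in> carrier (opp N)" using h *(4) by simp_all
  then obtain s where s: "s \<in> carrier (opp M)" "h s = t"
    and st': "\<And>w. w \<in> carrier (opp M) \<Longrightarrow> rstab (opp N) t (h w) \<Longrightarrow> rstab (opp M) s w"
    using Mop.minimal_lift[OF _ monoid_opp[OF N]] by blast
  note s = s[simplified] and st' = st'[simplified]
  have "rstab M q v" "rstab M q v'" "lstab M v s" "lstab M v' s"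
    using st[OF vc(1)] st[OF vc(2)] st'[OF vc(1)] st'[OF vc(2)] *(6-9) v(2,3) by simp_all
  note q = q this(1,2) and s = s this(3,4)
  have "(q \<otimes>\<^bsub>M\<^esub> v \<otimes>\<^bsub>M\<^esub> s, q \<otimes>\<^bsub>M\<^esub> v' \<otimes>\<^bsub>M\<^esub> s) \<in> stable_pairs M (Suc n)"
    using q s v(1) by auto
  moreover have "h (q \<otimes>\<^bsub>M\<^esub> v \<otimes>\<^bsub>M\<^esub> s) = x" "h (q \<otimes>\<^bsub>M\<^esub> v' \<otimes>\<^bsub>M\<^esub> s) = y"
    using hh(1) q s v vc * by (auto simp: hom_mult)
  ultimately show ?case by blast
qed

lemma is_DA_epi:
  assumes M: "finite_monoid M" and N: "monoid N" and h: "h \<in> epi M N" and DA: "is_DA M"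
  shows "is_DA N"
  unfolding is_DA_def
proof (intro ballI impI)
  interpret M: finite_monoid M by fact
  have hh: "h \<in> hom M N" "h ` carrier M = carrier N" using h by (auto simp: epi_def)
  fix e a x b
  assume c: "e \<in> carrier N" "a \<in> carrier N" "x \<in> carrier N" "b \<in> carrier N"
    and e: "e \<otimes>\<^bsub>N\<^esub> e = e" "a \<otimes>\<^bsub>N\<^esub> x \<otimes>\<^bsub>N\<^esub> b = e"
  have "a \<in> h ` carrier M" "x \<in> h ` carrier M" "b \<in> h ` carrier M"
    using c hh(2) by simp_all
  then obtain a' x' b' where l: "a' \<in> carrier M" "x' \<in> carrier M" "b' \<in> carrier M"
    "h a' = a" "h x' = x" "h b' = b"
    by (elim imageE) simp
  \<comment> \<open>The lift of \<open>e\<close> has to be idempotent and still have the lift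
    \<open>x'\<close> of \<open>x\<close> as a factor; the idempotent power of
    \<open>a' x' b'\<close> is both.\<close>
  define g where "g = a' \<otimes>\<^bsub>M\<^esub> x' \<otimes>\<^bsub>M\<^esub> b'"
  have g: "g \<in> carrier M" "h g = e"
    using l e(2) hh(1) by (auto simp: g_def hom_mult)
  obtain n :: nat where n: "n > 0" "g [^]\<^bsub>M\<^esub> n \<otimes>\<^bsub>M\<^esub> g [^]\<^bsub>M\<^esub> n = g [^]\<^bsub>M\<^esub> n"
    using M.idempotent_power[OF g(1)] by blast
  then obtain k where k: "n = Suc k" using gr0_conv_Suc by blast
  have hg: "h (g [^]\<^bsub>M\<^esub> Suc k) = e" for k :: nat
  proof (induction k)
    case 0 then show ?case using g by simp
  next
    case (Suc k)
    then show ?case using g e(1) hh(1) by (simp add: hom_mult)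
  qed
  have "g [^]\<^bsub>M\<^esub> n = (g [^]\<^bsub>M\<^esub> k \<otimes>\<^bsub>M\<^esub> a') \<otimes>\<^bsub>M\<^esub> x' \<otimes>\<^bsub>M\<^esub> b'"
  proof -
    have "g [^]\<^bsub>M\<^esub> n = g [^]\<^bsub>M\<^esub> k \<otimes>\<^bsub>M\<^esub> (a' \<otimes>\<^bsub>M\<^esub> x' \<otimes>\<^bsub>M\<^esub> b')"
      by (simp add: k flip: g_def)
    then show ?thesis using l g(1) by (simp add: M.m_assoc)
  qed
  then have "g [^]\<^bsub>M\<^esub> n \<otimes>\<^bsub>M\<^esub> x' \<otimes>\<^bsub>M\<^esub> g [^]\<^bsub>M\<^esub> n = g [^]\<^bsub>M\<^esub> n"
    by (intro is_DAD[OF DA _ _ _ _ n(2), of "g [^]\<^bsub>M\<^esub> k \<otimes>\<^bsub>M\<^esub> a'" x' b'] M.m_closed M.nat_pow_closed l g(1))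
      (rule sym)
  moreover have gn: "h (g [^]\<^bsub>M\<^esub> n) = e" "g [^]\<^bsub>M\<^esub> n \<in> carrier M"
    using hg[of k] g(1) by (simp_all only: k M.nat_pow_closed)
  then have "h (g [^]\<^bsub>M\<^esub> n \<otimes>\<^bsub>M\<^esub> x' \<otimes>\<^bsub>M\<^esub> g [^]\<^bsub>M\<^esub> n) = e \<otimes>\<^bsub>N\<^esub> x \<otimes>\<^bsub>N\<^esub> e"
    using hh(1) l(2,5) by (simp add: hom_mult del: nat_pow_Suc)
  ultimately show "e \<otimes>\<^bsub>N\<^esub> x \<otimes>\<^bsub>N\<^esub> e = e"
    using gn(1) by simp
qed

lemma join_cond_epi:
  assumes "finite_monoid M" "monoid N" "h \<in> epi M N" "join_cond n M"
  shows "join_cond n N"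
  unfolding join_cond_def
proof
  show "is_DA N" using is_DA_epi[OF assms(1-3)] assms(4) by (simp add: join_cond_def)
  show "stable_pairs N n \<subseteq> Id"
  proof safe
    fix x y assume "(x, y) \<in> stable_pairs N n"
    then show "x = y"
      using stable_pairs_lift[OF assms(1-3)] assms(4) by (force simp: join_cond_def)
  qed
qed

lemma variety_join_cond: "variety {M \<in> finite_monoids. join_cond n M}"
  unfolding variety_def
proof (intro conjI ballI allI impI)
  fix M :: "nat monoid" and H
  assume M: "M \<in> {M \<in> finite_monoids. join_cond n M}" and H: "submonoid H M"
  then have fm: "monoid M" "finite (carrier M)" and sub: "H \<subseteq> carrier M" and cond: "join_cond n M"
    by (auto simp: finite_monoids_def submonoid.subset)
  have m: "monoid (M\<lparr>carrier := H\<rparr>)"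
    using submonoid.submonoid_is_monoid[OF H fm(1)] .
  have "join_cond n (M\<lparr>carrier := H\<rparr>)"
    by (rule join_cond_separating[where I = "{()}" and N = "\<lambda>_. M" and h = "\<lambda>_ x. x"])
      (use m fm cond sub in \<open>auto simp: hom_def\<close>)
  then show "M\<lparr>carrier := H\<rparr> \<in> {M \<in> finite_monoids. join_cond n M}"
    using m fm sub by (auto simp: finite_monoids_def intro: finite_subset)
next
  fix M N :: "nat monoid"
  assume "M \<in> {M \<in> finite_monoids. join_cond n M}" "N \<in> finite_monoids" "epi M N \<noteq> {}"
  then show "N \<in> {M \<in> finite_monoids. join_cond n M}"
    using join_cond_epi[of M N] by (auto simp: finite_monoids_iff finite_monoid_def)
next
  fix k :: nat and F :: "nat \<Rightarrow> nat monoid" and P :: "nat monoid"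
  assume F: "\<forall>i<k. F i \<in> {M \<in> finite_monoids. join_cond n M}" and P: "P \<in> finite_monoids"
    and "P \<cong> product_group {..<k} F"
  then obtain g where g: "g \<in> hom P (product_group {..<k} F)"
    "bij_betw g (carrier P) (carrier (product_group {..<k} F))"
    by (auto simp: is_iso_def iso_def)
  have gc: "g x \<in> (\<Pi>\<^sub>E i\<in>{..<k}. carrier (F i))" if "x \<in> carrier P" for x
    using g(1) that by (auto simp: hom_def)
  have "join_cond n P"
  proof (rule join_cond_separating[where I = "{..<k}" and N = F and h = "\<lambda>i x. g x i"])
    show "monoid P" using P by (simp add: finite_monoids_def)
  next
    fix i assume i: "i \<in> {..<k}"
    then have "(\<lambda>x. g x i) \<in> hom P (F i)"
      using g(1) gc by (force simp: hom_def PiE_iff)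
    then show "monoid (F i) \<and> join_cond n (F i) \<and> (\<lambda>x. g x i) \<in> hom P (F i)"
      using F i by (auto simp: finite_monoids_def)
  next
    fix x y assume xy: "x \<in> carrier P" "y \<in> carrier P" "\<And>i. i \<in> {..<k} \<Longrightarrow> g x i = g y i"
    then have "g x = g y"
      using PiE_ext[OF gc gc] by blast
    then show "x = y" using g(2) xy by (auto simp: bij_betw_def inj_on_def)
  qed
  then show "P \<in> {M \<in> finite_monoids. join_cond n M}" using P by simp
qed auto

section \<open>The congruence of the Malcev product\<close>

lemma green_R_iff:
  assumes "monoid M" "x \<in> carrier M" "y \<in> carrier M"
  shows "green_R M x y \<longleftrightarrow> (\<exists>a\<in>carrier M. x \<otimes>\<^bsub>M\<^esub> a = y) \<and> (\<exists>b\<in>carrier M. y \<otimes>\<^bsub>M\<^esub> b = x)"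
proof -
  interpret monoid M by fact
  have sub: "a <#\<^bsub>M\<^esub> carrier M \<subseteq> b <#\<^bsub>M\<^esub> carrier M \<longleftrightarrow> (\<exists>c\<in>carrier M. b \<otimes>\<^bsub>M\<^esub> c = a)"
    if a: "a \<in> carrier M" and b: "b \<in> carrier M" for a b
  proof
    assume "a <#\<^bsub>M\<^esub> carrier M \<subseteq> b <#\<^bsub>M\<^esub> carrier M"
    moreover have "a \<otimes>\<^bsub>M\<^esub> \<one>\<^bsub>M\<^esub> \<in> a <#\<^bsub>M\<^esub> carrier M"
      unfolding l_coset_def by blast
    ultimately show "\<exists>c\<in>carrier M. b \<otimes>\<^bsub>M\<^esub> c = a"
      using a by (auto simp: l_coset_def)
  next
    assume "\<exists>c\<in>carrier M. b \<otimes>\<^bsub>M\<^esub> c = a"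
    then obtain c where c: "c \<in> carrier M" "b \<otimes>\<^bsub>M\<^esub> c = a" by blast
    show "a <#\<^bsub>M\<^esub> carrier M \<subseteq> b <#\<^bsub>M\<^esub> carrier M"
    proof
      fix u assume "u \<in> a <#\<^bsub>M\<^esub> carrier M"
      then obtain z where z: "z \<in> carrier M" "u = b \<otimes>\<^bsub>M\<^esub> (c \<otimes>\<^bsub>M\<^esub> z)"
        using b c by (auto simp: l_coset_def m_assoc)
      then show "u \<in> b <#\<^bsub>M\<^esub> carrier M" using c by (auto simp: l_coset_def)
    qed
  qed
  show ?thesis
    unfolding green_R_def set_eq_subset using sub assms(2,3) by blast
qed

lemma green_R_rstab:
  assumes "monoid M" "p \<in> carrier M" "w \<in> carrier M"
  shows "green_R M (p \<otimes>\<^bsub>M\<^esub> w) p \<longleftrightarrow> rstab M p w"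
  using assms by (auto simp: green_R_iff rstab_def monoid.m_closed)

lemma green_L_opp: "green_L M x y \<longleftrightarrow> green_R (opp M) x y"
  by (simp add: green_L_def green_R_def l_coset_def r_coset_def)

lemma R_trivial_iff:
  "M \<in> R_trivial_monoids \<longleftrightarrow>
     M \<in> finite_monoids \<and> (\<forall>p\<in>carrier M. \<forall>w\<in>carrier M. rstab M p w \<longrightarrow> p \<otimes>\<^bsub>M\<^esub> w = p)"
proof (cases "M \<in> finite_monoids")
  case True
  then have M: "monoid M" by (simp add: finite_monoids_def)
  show ?thesis
  proof
    assume "M \<in> R_trivial_monoids"
    then show "M \<in> finite_monoids \<and> (\<forall>p\<in>carrier M. \<forall>w\<in>carrier M. rstab M p w \<longrightarrow> p \<otimes>\<^bsub>M\<^esub> w = p)"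
      using green_R_rstab[OF M] monoid.m_closed[OF M] by (auto simp: R_trivial_monoids_def)
  next
    assume *: "M \<in> finite_monoids \<and> (\<forall>p\<in>carrier M. \<forall>w\<in>carrier M. rstab M p w \<longrightarrow> p \<otimes>\<^bsub>M\<^esub> w = p)"
    have "x = y" if xy: "x \<in> carrier M" "y \<in> carrier M" "green_R M x y" for x y
    proof -
      obtain a b where "a \<in> carrier M" "x \<otimes>\<^bsub>M\<^esub> a = y" "b \<in> carrier M" "y \<otimes>\<^bsub>M\<^esub> b = x"
        using xy green_R_iff[OF M xy(1,2)] by blast
      then have "rstab M x a" "x \<otimes>\<^bsub>M\<^esub> a = y" "a \<in> carrier M" by (auto simp: rstab_def)
      then show ?thesis using * xy by metis
    qed
    then show "M \<in> R_trivial_monoids" using True by (auto simp: R_trivial_monoids_def)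
  qed
qed (auto simp: R_trivial_monoids_def)

lemma sim_K_iff:
  assumes "monoid M"
  shows "(x, y) \<in> sim_K M \<longleftrightarrow> x \<in> carrier M \<and> y \<in> carrier M \<and>
    (\<forall>e\<in>carrier M. e \<otimes>\<^bsub>M\<^esub> e = e \<longrightarrow> rstab M e x \<or> rstab M e y \<longrightarrow> e \<otimes>\<^bsub>M\<^esub> x = e \<otimes>\<^bsub>M\<^esub> y)"
  using green_R_rstab[OF assms] by (auto simp: sim_K_def idempotents_def)

lemma rstab_cong: "p \<otimes>\<^bsub>M\<^esub> x = p \<otimes>\<^bsub>M\<^esub> y \<Longrightarrow> rstab M p x \<longleftrightarrow> rstab M p y"
  by (simp add: rstab_def)

lemma sim_K_closed: "(x, y) \<in> sim_K M \<Longrightarrow> x \<in> carrier M \<and> y \<in> carrier M"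
  by (simp add: sim_K_def)

lemma sim_KD:
  assumes "(x, y) \<in> sim_K M" "monoid M" "e \<in> carrier M" "e \<otimes>\<^bsub>M\<^esub> e = e" "rstab M e x \<or> rstab M e y"
  shows "e \<otimes>\<^bsub>M\<^esub> x = e \<otimes>\<^bsub>M\<^esub> y"
  using assms by (simp only: sim_K_iff)

lemma equiv_sim_K: "monoid M \<Longrightarrow> equiv (carrier M) (sim_K M)"
proof (rule equivI)
  assume M: "monoid M"
  show "sim_K M \<subseteq> carrier M \<times> carrier M" by (auto simp: sim_K_def)
  show "refl_on (carrier M) (sim_K M)" by (auto simp: refl_on_def sim_K_def)
  show "sym (sim_K M)"
  proof (rule symI)
    fix x y assume xy: "(x, y) \<in> sim_K M"
    show "(y, x) \<in> sim_K M"
      unfolding sim_K_iff[OF M]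
      by (intro conjI ballI impI sim_KD[OF xy M, symmetric]) (use sim_K_closed[OF xy] in auto)
  qed
  show "trans (sim_K M)"
  proof (rule transI)
    fix x y z assume xy: "(x, y) \<in> sim_K M" and yz: "(y, z) \<in> sim_K M"
    have "e \<otimes>\<^bsub>M\<^esub> x = e \<otimes>\<^bsub>M\<^esub> z"
      if e: "e \<in> carrier M" "e \<otimes>\<^bsub>M\<^esub> e = e" and st: "rstab M e x \<or> rstab M e z" for e
      using st
    proof
      assume "rstab M e x"
      then have "e \<otimes>\<^bsub>M\<^esub> x = e \<otimes>\<^bsub>M\<^esub> y" using sim_KD[OF xy M e] by blast
      then show ?thesis using \<open>rstab M e x\<close> rstab_cong[of M e x y] sim_KD[OF yz M e] by simp
    next
      assume "rstab M e z"
      then have "e \<otimes>\<^bsub>M\<^esub> y = e \<otimes>\<^bsub>M\<^esub> z" using sim_KD[OF yz M e] by blast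
      then show ?thesis using \<open>rstab M e z\<close> rstab_cong[of M e y z] sim_KD[OF xy M e] by simp
    qed
    then show "(x, z) \<in> sim_K M"
      unfolding sim_K_iff[OF M] using sim_K_closed[OF xy] sim_K_closed[OF yz] by blast
  qed
qed

lemma (in finite_monoid) sim_K_mult:
  assumes "(x, x') \<in> sim_K M" "(y, y') \<in> sim_K M"
  shows "(x \<otimes> y, x' \<otimes> y') \<in> sim_K M"
proof -
  have right: "(x \<otimes> z, y \<otimes> z) \<in> sim_K M" if xy: "(x, y) \<in> sim_K M" and z: "z \<in> carrier M" for x y z
    unfolding sim_K_iff[OF monoid_axioms]
  proof (intro conjI ballI impI)
    have c: "x \<in> carrier M" "y \<in> carrier M" using sim_K_closed[OF xy] by auto
    then show "x \<otimes> z \<in> carrier M" "y \<otimes> z \<in> carrier M" using z by auto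
    fix e assume e: "e \<in> carrier M" "e \<otimes> e = e" "rstab M e (x \<otimes> z) \<or> rstab M e (y \<otimes> z)"
    have "rstab M e v" if "rstab M e (v \<otimes> z)" "v \<in> carrier M" for v
    proof -
      obtain u where "u \<in> carrier M" "e \<otimes> (v \<otimes> z) \<otimes> u = e"
        using \<open>rstab M e (v \<otimes> z)\<close> by (auto simp: rstab_def)
      then have "e \<otimes> v \<otimes> (z \<otimes> u) = e" using that z e by (simp add: m_assoc)
      then show ?thesis unfolding rstab_def using z \<open>u \<in> carrier M\<close> by blast
    qed
    then have "e \<otimes> x = e \<otimes> y"
      using e c sim_KD[OF xy monoid_axioms e(1,2)] by blast
    then show "e \<otimes> (x \<otimes> z) = e \<otimes> (y \<otimes> z)"
      using c z e by (simp flip: m_assoc)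
  qed
  have left0: "e \<otimes> (z \<otimes> x) = e \<otimes> (z \<otimes> y)"
    if xy: "(x, y) \<in> sim_K M" and z: "z \<in> carrier M" and e: "e \<in> carrier M"
      and st: "rstab M e (z \<otimes> x)" for x y z e
  proof -
    have c: "x \<in> carrier M" "y \<in> carrier M" using sim_K_closed[OF xy] by auto
    obtain u where u: "u \<in> carrier M" "e \<otimes> (z \<otimes> x) \<otimes> u = e"
      using st by (auto simp: rstab_def)
    \<comment> \<open>\<open>e z\<close> need not be idempotent, so \<open>sim_K\<close> does not
      test it directly. But \<open>x u z\<close> fixes it from the right, and the idempotent power
      \<open>g\<close> of \<open>x u z\<close> satisfies both \<open>e z g = e z\<close> and the
      stability needed for the test.\<close>
    have "e \<otimes> z \<otimes> (x \<otimes> (u \<otimes> z)) = e \<otimes> (z \<otimes> x) \<otimes> u \<otimes> z"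
      using u(1) c z e by (simp add: m_assoc)
    also have "\<dots> = e \<otimes> z" using u(2) by simp
    finally have fx: "e \<otimes> z \<otimes> (x \<otimes> (u \<otimes> z)) = e \<otimes> z" .
    have "e \<otimes> z \<in> carrier M" "x \<otimes> (u \<otimes> z) \<in> carrier M" using u(1) c z e by auto
    then obtain g v where g: "g \<in> carrier M" "g \<otimes> g = g" "e \<otimes> z \<otimes> g = e \<otimes> z"
      "v \<in> carrier M" "g = x \<otimes> (u \<otimes> z) \<otimes> v" "g = v \<otimes> (x \<otimes> (u \<otimes> z))"
      by (rule idempotent_fixing[OF _ _ fx])
    have "g \<otimes> x \<otimes> (u \<otimes> z \<otimes> v) = g"
      using g c z u(1) by (metis m_assoc m_closed)
    then have "rstab M g x" unfolding rstab_def using g u(1) z by blast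
    then have "g \<otimes> x = g \<otimes> y" using sim_KD[OF xy monoid_axioms g(1,2)] by blast
    then have "e \<otimes> z \<otimes> g \<otimes> x = e \<otimes> z \<otimes> g \<otimes> y"
      using g(1) e z c by (simp add: m_assoc)
    then show ?thesis using g e z c by (simp add: m_assoc)
  qed
  have sym: "(y, x) \<in> sim_K M" if "(x, y) \<in> sim_K M" for x y
    using that equiv_sim_K[OF monoid_axioms] unfolding equiv_def by (blast dest: symD)
  have left: "(z \<otimes> x, z \<otimes> y) \<in> sim_K M" if xy: "(x, y) \<in> sim_K M" and z: "z \<in> carrier M" for x y z
    unfolding sim_K_iff[OF monoid_axioms]
  proof (intro conjI ballI impI)
    show "z \<otimes> x \<in> carrier M" "z \<otimes> y \<in> carrier M" using sim_K_closed[OF xy] z by auto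
    fix e assume "e \<in> carrier M" "rstab M e (z \<otimes> x) \<or> rstab M e (z \<otimes> y)"
    then show "e \<otimes> (z \<otimes> x) = e \<otimes> (z \<otimes> y)"
      using left0[OF xy z] left0[OF sym[OF xy] z] by metis
  qed
  have "(x \<otimes> y, x' \<otimes> y) \<in> sim_K M" "(x' \<otimes> y, x' \<otimes> y') \<in> sim_K M"
    using right[OF assms(1)] left[OF assms(2)] sim_K_closed[OF assms(1)] sim_K_closed[OF assms(2)] by blast+
  then show ?thesis
    using equiv_sim_K[OF monoid_axioms] unfolding equiv_def trans_def by blast
qed

text \<open>Varieties here consist of monoids on \<open>nat\<close>. A map into \<open>nat\<close>
  whose kernel is a congruence gives the quotient with the codes as its elements.\<close>

lemma monoid_epi_copy:
  fixes c :: "'a \<Rightarrow> nat"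
  assumes M: "monoid M" and fin: "finite (c ` carrier M)"
    and cong: "\<And>x x' y y'. x \<in> carrier M \<Longrightarrow> x' \<in> carrier M \<Longrightarrow> y \<in> carrier M \<Longrightarrow> y' \<in> carrier M \<Longrightarrow>
      c x = c x' \<Longrightarrow> c y = c y' \<Longrightarrow> c (x \<otimes>\<^bsub>M\<^esub> y) = c (x' \<otimes>\<^bsub>M\<^esub> y')"
  obtains Q where "Q \<in> finite_monoids" "c \<in> epi M Q"
proof -
  interpret monoid M by fact
  define r where "r = inv_into (carrier M) c"
  have r: "r i \<in> carrier M" "c (r i) = i" if "i \<in> c ` carrier M" for i
    using that by (auto simp: r_def inv_into_into f_inv_into_f)
  define Q where "Q = \<lparr>carrier = c ` carrier M, monoid.mult = (\<lambda>i j. c (r i \<otimes>\<^bsub>M\<^esub> r j)), one = c \<one>\<^bsub>M\<^esub>\<rparr>"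
  have mult: "c x \<otimes>\<^bsub>Q\<^esub> c y = c (x \<otimes>\<^bsub>M\<^esub> y)" if "x \<in> carrier M" "y \<in> carrier M" for x y
    using that r by (auto simp: Q_def intro!: cong)
  have Q: "carrier Q = c ` carrier M" "\<one>\<^bsub>Q\<^esub> = c \<one>\<^bsub>M\<^esub>" by (auto simp: Q_def)
  have "monoid Q"
    by (rule monoidI) (auto simp: Q mult m_assoc)
  then have "Q \<in> finite_monoids" using fin by (simp add: finite_monoids_def Q)
  moreover have "c \<in> epi M Q" by (auto simp: epi_def hom_def Q mult)
  ultimately show thesis using that by blast
qed

lemma epi_factor:
  assumes h: "h \<in> epi M Q" and g: "g \<in> epi M P" and M: "monoid M"
    and ker: "\<And>x y. x \<in> carrier M \<Longrightarrow> y \<in> carrier M \<Longrightarrow> h x = h y \<Longrightarrow> g x = g y"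
  shows "epi Q P \<noteq> {}"
proof -
  have hh: "h \<in> hom M Q" "carrier Q = h ` carrier M" and gh: "g \<in> hom M P" "carrier P = g ` carrier M"
    using h g by (auto simp: epi_def)
  define r where "r = inv_into (carrier M) h"
  have r: "g (r (h x)) = g x" if "x \<in> carrier M" for x
    using that by (intro ker) (auto simp: r_def inv_into_into f_inv_into_f)
  have "g \<circ> r \<in> epi Q P"
  proof -
    have "g (r (h x \<otimes>\<^bsub>Q\<^esub> h y)) = g (r (h x)) \<otimes>\<^bsub>P\<^esub> g (r (h y))"
      if "x \<in> carrier M" "y \<in> carrier M" for x y
      using that r hom_mult[OF hh(1)] hom_mult[OF gh(1)] monoid.m_closed[OF M] by metis
    then show ?thesis
      using r gh(2) by (auto simp: epi_def hom_def hh(2) image_image)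
  qed
  then show ?thesis by blast
qed

lemma epi_comp: "f \<in> epi M N \<Longrightarrow> g \<in> epi N P \<Longrightarrow> g \<circ> f \<in> epi M P"
  unfolding epi_def using hom_compose[of f M N g P] image_comp[of g f "carrier M"] by auto

text \<open>Replaces the monoid of classes by any epimorphism with kernel \<open>sim_K\<close>, the
  form in which copies on natural numbers are built and compared.\<close>

lemma malcev_K_iff:
  fixes M (structure)
  shows "M \<in> malcev_K V \<longleftrightarrow> M \<in> finite_monoids \<and>
     (\<exists>N\<in>V. \<exists>h\<in>epi M N. \<forall>x\<in>carrier M. \<forall>y\<in>carrier M. h x = h y \<longleftrightarrow> (x, y) \<in> sim_K M)"
proof (cases "M \<in> finite_monoids")
  case True
  interpret finite_monoid M using True by (simp add: finite_monoids_iff)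
  define c where "c x = sim_K M `` {x}" for x
  let ?Q = "quotient_monoid M (sim_K M)"
  note eq = equiv_sim_K[OF monoid_axioms]
  have cc: "c x = c y \<longleftrightarrow> (x, y) \<in> sim_K M" if "x \<in> carrier M" "y \<in> carrier M" for x y
    unfolding c_def using eq_equiv_class_iff[OF eq that] .
  have Q: "carrier ?Q = c ` carrier M"
    by (auto simp: quotient_monoid_def quotient_def c_def)
  have mult: "c x \<otimes>\<^bsub>?Q\<^esub> c y = c (x \<otimes> y)" if xy: "x \<in> carrier M" "y \<in> carrier M" for x y
  proof -
    have "c x <#> c y \<subseteq> c (x \<otimes> y)"
      unfolding c_def set_mult_def using sim_K_mult by blast
    moreover have "x \<otimes> y \<in> c x <#> c y"
      unfolding c_def set_mult_def using xy eq by (auto simp: equiv_def refl_on_def)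
    ultimately have "sim_K M `` (c x <#> c y) = c (x \<otimes> y)"
      using eq unfolding c_def equiv_def sym_def trans_def by blast
    then show ?thesis by (simp add: quotient_monoid_def)
  qed
  have c: "c \<in> epi M ?Q" by (auto simp: epi_def hom_def Q mult)
  have "?Q \<cong> N \<longleftrightarrow> (\<exists>h\<in>epi M N. \<forall>x\<in>carrier M. \<forall>y\<in>carrier M. h x = h y \<longleftrightarrow> (x, y) \<in> sim_K M)" for N
  proof
    assume "?Q \<cong> N"
    then obtain g where g: "g \<in> hom ?Q N" "bij_betw g (carrier ?Q) (carrier N)"
      by (auto simp: is_iso_def iso_def)
    then have "g \<in> epi ?Q N" by (auto simp: epi_def bij_betw_def)
    then have "g \<circ> c \<in> epi M N" using c epi_comp by blast
    moreover have "(g \<circ> c) x = (g \<circ> c) y \<longleftrightarrow> (x, y) \<in> sim_K M"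
      if "x \<in> carrier M" "y \<in> carrier M" for x y
      using inj_on_eq_iff[OF bij_betw_imp_inj_on[OF g(2)], of "c x" "c y"] Q that cc[OF that] by simp
    ultimately show "\<exists>h\<in>epi M N. \<forall>x\<in>carrier M. \<forall>y\<in>carrier M. h x = h y \<longleftrightarrow> (x, y) \<in> sim_K M"
      by blast
  next
    assume "\<exists>h\<in>epi M N. \<forall>x\<in>carrier M. \<forall>y\<in>carrier M. h x = h y \<longleftrightarrow> (x, y) \<in> sim_K M"
    then obtain h where h: "h \<in> hom M N" "h ` carrier M = carrier N"
      and ker: "\<And>x y. x \<in> carrier M \<Longrightarrow> y \<in> carrier M \<Longrightarrow> h x = h y \<longleftrightarrow> (x, y) \<in> sim_K M"
      by (auto simp: epi_def)
    define g where "g A = the_elem (h ` A)" for A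
    have "h ` c x = {h x}" if "x \<in> carrier M" for x
    proof -
      have "x \<in> c x" using that eq by (auto simp: c_def equiv_def refl_on_def)
      moreover have "h y = h x" if "y \<in> c x" for y
        using that ker[of x y] sim_K_closed[of x y M] by (simp add: c_def)
      ultimately show ?thesis by blast
    qed
    then have gc: "g (c x) = h x" if "x \<in> carrier M" for x
      using that by (simp add: g_def)
    have "g \<in> hom ?Q N"
      using h gc by (auto simp: hom_def Q mult)
    moreover have "bij_betw g (carrier ?Q) (carrier N)"
    proof -
      have "inj_on g (carrier ?Q)"
        unfolding Q by (intro inj_onI; clarify; rule cc[THEN iffD2]) (simp_all add: gc ker)
      moreover have "g ` carrier ?Q = carrier N"
        using gc h(2) by (auto simp: Q image_image)
      ultimately show ?thesis by (simp add: bij_betw_def)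
    qed
    ultimately show "?Q \<cong> N" by (auto simp: is_iso_def iso_def)
  qed
  then show ?thesis unfolding malcev_K_def mem_Collect_eq by (intro conj_cong bex_cong refl)
qed (auto simp: malcev_K_def)

text \<open>A test with an idempotent \<open>e\<close> of \<open>N\<close> is carried out in
  \<open>M\<close>. A low preimage \<open>q\<close> of \<open>e\<close> need not be idempotent, but
  its idempotent power \<open>q p\<close> is, and it is stabilised by whatever maps to a stabiliser
  of \<open>e\<close>.\<close>

lemma (in finite_monoid) sim_K_epi:
  assumes N: "monoid N" and f: "f \<in> epi M N" and xy: "(x, y) \<in> sim_K M"
  shows "(f x, f y) \<in> sim_K N"
  unfolding sim_K_iff[OF N]
proof (intro conjI ballI impI)
  have ff: "f \<in> hom M N" "f ` carrier M = carrier N" using f by (auto simp: epi_def)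
  have c: "x \<in> carrier M" "y \<in> carrier M" using sim_K_closed[OF xy] by auto
  show "f x \<in> carrier N" "f y \<in> carrier N" using c ff(2) by blast+
  fix e assume e: "e \<in> carrier N" "e \<otimes>\<^bsub>N\<^esub> e = e" and st: "rstab N e (f x) \<or> rstab N e (f y)"
  obtain q where q: "q \<in> carrier M" "f q = e"
    and min: "\<And>w. w \<in> carrier M \<Longrightarrow> rstab N e (f w) \<Longrightarrow> rstab M q w"
    using minimal_lift[OF f N e(1)] by blast
  obtain n :: nat where n: "n > 0" "q [^] n \<otimes> q [^] n = q [^] n"
    using idempotent_power[OF q(1)] by blast
  obtain k where k: "n = Suc k" using n(1) gr0_conv_Suc by blast
  define p where "p = q [^] k"
  have p: "p \<in> carrier M" "q \<otimes> p \<in> carrier M" using q by (auto simp: p_def)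
  have id: "q \<otimes> p \<otimes> (q \<otimes> p) = q \<otimes> p"
    using n(2) nat_pow_Suc2[OF q(1), of k] unfolding k p_def by (simp del: nat_pow_Suc)
  have epk: "e \<otimes>\<^bsub>N\<^esub> f (q [^] k) = e" for k :: nat
  proof (induction k)
    case 0
    show ?case using hom_mult[OF ff(1) q(1) one_closed] q by simp
  next
    case (Suc k)
    have "e \<otimes>\<^bsub>N\<^esub> f (q [^] Suc k) = e \<otimes>\<^bsub>N\<^esub> (f (q [^] k) \<otimes>\<^bsub>N\<^esub> e)"
      using hom_mult[OF ff(1) nat_pow_closed[OF q(1)] q(1)] q(2) by simp
    also have "\<dots> = e"
    proof -
      have "f (q [^] k) \<in> carrier N" using ff(2) q(1) by (metis image_eqI nat_pow_closed)
      then have "e \<otimes>\<^bsub>N\<^esub> (f (q [^] k) \<otimes>\<^bsub>N\<^esub> e) = e \<otimes>\<^bsub>N\<^esub> f (q [^] k) \<otimes>\<^bsub>N\<^esub> e"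
        using e(1) monoid.m_assoc[OF N] by metis
      then show ?thesis using Suc e(2) by simp
    qed
    finally show ?case .
  qed
  have fp: "f p \<in> carrier N" "e \<otimes>\<^bsub>N\<^esub> f p = e" using epk[of k] p(1) ff(2) by (auto simp: p_def)
  \<comment> \<open>Minimality is known for \<open>q\<close> and is applied to the factor
    \<open>p w\<close>, which is possible because \<open>e (f p) = e\<close>.\<close>
  have st': "rstab M (q \<otimes> p) w" if w: "w \<in> carrier M" and "rstab N e (f w)" for w
  proof -
    have "e \<otimes>\<^bsub>N\<^esub> f (p \<otimes> w) = e \<otimes>\<^bsub>N\<^esub> f w"
      using hom_mult[OF ff(1) p(1) w] monoid.m_assoc[OF N e(1) fp(1)] hom_in_carrier[OF ff(1) w] fp(2) by metis
    then have "rstab N e (f (p \<otimes> w))" using that(2) rstab_cong by metis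
    then obtain z where z: "z \<in> carrier M" "q \<otimes> (p \<otimes> w) \<otimes> z = q"
      using min[of "p \<otimes> w"] p w by (auto simp: rstab_def)
    have "q \<otimes> p \<otimes> w \<otimes> (z \<otimes> p) = q \<otimes> (p \<otimes> w) \<otimes> z \<otimes> p"
      using q p w z(1) by (simp add: m_assoc)
    then have "q \<otimes> p \<otimes> w \<otimes> (z \<otimes> p) = q \<otimes> p" using z(2) by simp
    then show ?thesis unfolding rstab_def using z p by blast
  qed
  have "rstab M (q \<otimes> p) x \<or> rstab M (q \<otimes> p) y" using st st' c by blast
  then have "q \<otimes> p \<otimes> x = q \<otimes> p \<otimes> y"
    using sim_KD[OF xy monoid_axioms p(2) id] by blast
  then have "f (q \<otimes> p \<otimes> x) = f (q \<otimes> p \<otimes> y)" by simp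
  then show "e \<otimes>\<^bsub>N\<^esub> f x = e \<otimes>\<^bsub>N\<^esub> f y"
    using ff(1) p(1) c q fp(2) by (simp add: hom_mult)
qed

section \<open>Closure under quotients, and the identities along the hierarchy\<close>

definition epi_closed :: "nat monoid set \<Rightarrow> bool" where
  "epi_closed V \<longleftrightarrow> V \<subseteq> finite_monoids \<and> (\<forall>M\<in>V. \<forall>N\<in>finite_monoids. epi M N \<noteq> {} \<longrightarrow> N \<in> V)"

lemma epi_closed_R_trivial: "epi_closed R_trivial_monoids"
  unfolding epi_closed_def
proof (intro conjI ballI impI)
  fix M N assume M: "M \<in> R_trivial_monoids" and N: "N \<in> finite_monoids" and "epi M N \<noteq> {}"
  then obtain f where ff: "f \<in> epi M N" by blast
  then have f: "f \<in> hom M N" "f ` carrier M = carrier N" by (auto simp: epi_def)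
  interpret finite_monoid M using M by (simp add: R_trivial_iff finite_monoids_iff)
  have mN: "monoid N" using N by (simp add: finite_monoids_def)
  have "p \<otimes>\<^bsub>N\<^esub> w = p" if pw: "p \<in> carrier N" "w \<in> carrier N" "rstab N p w" for p w
  proof -
    obtain q where q: "q \<in> carrier M" "f q = p"
      and min: "\<And>w. w \<in> carrier M \<Longrightarrow> rstab N p (f w) \<Longrightarrow> rstab M q w"
      using minimal_lift[OF ff mN pw(1)] by blast
    obtain w0 where w0: "w0 \<in> carrier M" "f w0 = w" using pw(2) f(2) by (metis imageE)
    have "q \<otimes>\<^bsub>M\<^esub> w0 = q" using M min[OF w0(1)] w0 q pw(3) by (simp add: R_trivial_iff)
    then show ?thesis using hom_mult[OF f(1) q(1) w0(1)] q w0 by simp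
  qed
  then show "N \<in> R_trivial_monoids" using N by (auto simp: R_trivial_iff)
qed (auto simp: R_trivial_monoids_def)

lemma sim_K_quotient:
  fixes N :: "nat monoid"
  assumes N: "N \<in> finite_monoids"
  obtains Q c where "Q \<in> finite_monoids" "c \<in> epi N Q"
    "\<And>x y. x \<in> carrier N \<Longrightarrow> y \<in> carrier N \<Longrightarrow> c x = c y \<longleftrightarrow> (x, y) \<in> sim_K N"
proof -
  interpret N: finite_monoid N using N by (simp add: finite_monoids_iff)
  note eq = equiv_sim_K[OF N.monoid_axioms]
  \<comment> \<open>Classes are coded by their least elements.\<close>
  define c where "c x = (LEAST y. y \<in> sim_K N `` {x})" for x
  have c: "c x = c y \<longleftrightarrow> (x, y) \<in> sim_K N" if xy: "x \<in> carrier N" "y \<in> carrier N" for x y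
  proof
    assume "c x = c y"
    moreover have "(z, c z) \<in> sim_K N" if "z \<in> carrier N" for z
      using LeastI[of "\<lambda>y. y \<in> sim_K N `` {z}" z] that eq by (auto simp: c_def equiv_def refl_on_def)
    ultimately show "(x, y) \<in> sim_K N"
      using xy eq unfolding equiv_def sym_def trans_def by metis
  next
    assume "(x, y) \<in> sim_K N"
    then have "sim_K N `` {x} = sim_K N `` {y}" using eq equiv_class_eq by metis
    then show "c x = c y" by (simp add: c_def)
  qed
  obtain Q where Q: "Q \<in> finite_monoids" "c \<in> epi N Q"
    by (rule monoid_epi_copy[of N c])
      (use N.monoid_axioms N.fin c N.sim_K_mult in \<open>auto\<close>)
  then show thesis using that c by blast
qed

text \<open>By \<open>sim_K_epi\<close>, an epimorphism from \<open>M\<close> to \<open>N\<close>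
  induces one from \<open>M\<close> modulo \<open>sim_K\<close> to \<open>N\<close> modulo
  \<open>sim_K\<close>, so closure of \<open>V\<close> applies.\<close>

lemma epi_closed_malcev_K:
  assumes V: "epi_closed V"
  shows "epi_closed (malcev_K V)"
  unfolding epi_closed_def
proof (intro conjI ballI impI)
  fix M N assume M: "M \<in> malcev_K V" and N: "N \<in> finite_monoids" and "epi M N \<noteq> {}"
  then obtain f where f: "f \<in> epi M N" by blast
  obtain P h where P: "P \<in> V" "h \<in> epi M P"
    and h: "\<And>x y. x \<in> carrier M \<Longrightarrow> y \<in> carrier M \<Longrightarrow> h x = h y \<longleftrightarrow> (x, y) \<in> sim_K M"
    using M by (auto simp: malcev_K_iff)
  interpret M: finite_monoid M using M by (simp add: malcev_K_iff finite_monoids_iff)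
  interpret N: finite_monoid N using N by (simp add: finite_monoids_iff)
  obtain Q c where Q: "Q \<in> finite_monoids" "c \<in> epi N Q"
    and c: "\<And>x y. x \<in> carrier N \<Longrightarrow> y \<in> carrier N \<Longrightarrow> c x = c y \<longleftrightarrow> (x, y) \<in> sim_K N"
    using sim_K_quotient[OF N] by blast
  have "epi P Q \<noteq> {}"
  proof (rule epi_factor[OF P(2) epi_comp[OF f Q(2)] M.monoid_axioms])
    fix x y assume "x \<in> carrier M" "y \<in> carrier M" "h x = h y"
    then have "(f x, f y) \<in> sim_K N" using h M.sim_K_epi[OF N.monoid_axioms f] by blast
    then show "(c \<circ> f) x = (c \<circ> f) y" using c[of "f x" "f y"] sim_K_closed by fastforce
  qed
  then have "Q \<in> V" using V P(1) Q(1) by (auto simp: epi_closed_def)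
  then show "N \<in> malcev_K V" unfolding malcev_K_iff using N Q c by blast
qed (auto simp: malcev_K_iff)

lemma malcev_D_iff: "M \<in> malcev_D V \<longleftrightarrow> opp M \<in> malcev_K {N. opp N \<in> V}"
proof -
  have sim: "sim_D M = sim_K (opp M)"
    by (simp add: sim_D_def sim_K_def idempotents_def green_L_opp)
  have quot: "quotient_monoid (opp M) r = opp (quotient_monoid M r)" for r
  proof -
    have "A <#>\<^bsub>opp M\<^esub> B = B <#>\<^bsub>M\<^esub> A" for A B by (auto simp: set_mult_def)
    then show ?thesis by (simp add: quotient_monoid_def opp_def)
  qed
  have iso: "A \<cong> B \<longleftrightarrow> opp A \<cong> opp B" for A :: "nat set monoid" and B :: "nat monoid"
    by (simp add: is_iso_def iso_def)
  have "(\<exists>N\<in>V. quotient_monoid M (sim_D M) \<cong> N) \<longleftrightarrow>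
    (\<exists>N::nat monoid. opp N \<in> V \<and> quotient_monoid (opp M) (sim_K (opp M)) \<cong> N)"
  proof -
    have "(\<exists>N\<in>V. quotient_monoid M (sim_D M) \<cong> N) \<longleftrightarrow> (\<exists>N\<in>V. opp (quotient_monoid M (sim_D M)) \<cong> opp N)"
      using iso by simp
    also have "\<dots> \<longleftrightarrow> (\<exists>N::nat monoid. opp N \<in> V \<and> opp (quotient_monoid M (sim_D M)) \<cong> N)"
    proof safe
      fix N :: "nat monoid" assume "N \<in> V" "opp (quotient_monoid M (sim_D M)) \<cong> opp N"
      then show "\<exists>N::nat monoid. opp N \<in> V \<and> opp (quotient_monoid M (sim_D M)) \<cong> N"
        by (intro exI[of _ "opp N"]) simp
    next
      fix N :: "nat monoid" assume "opp N \<in> V" "opp (quotient_monoid M (sim_D M)) \<cong> N"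
      then show "\<exists>N\<in>V. opp (quotient_monoid M (sim_D M)) \<cong> opp N"
        by (intro bexI[of _ "opp N"]) simp_all
    qed
    finally show ?thesis by (simp only: quot sim)
  qed
  then show ?thesis by (simp add: malcev_D_def malcev_K_def)
qed

lemma TW_L_iff: "M \<in> TW_L m \<longleftrightarrow> opp M \<in> TW_R m"
proof (induction m arbitrary: M rule: less_induct)
  case (less m)
  show ?case
  proof (cases "m \<le> 2")
    case True
    then show ?thesis
      by (simp add: TW_L.simps[of m] TW_R.simps[of m] L_trivial_monoids_def R_trivial_monoids_def green_L_opp)
  next
    case False
    then have "{N. opp N \<in> TW_R (m - 1)} = TW_L (m - 1)" using less by auto
    then show ?thesis using False
      by (simp add: TW_L.simps[of m] TW_R.simps[of m] malcev_D_iff)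
  qed
qed

lemma epi_closed_opp:
  assumes "epi_closed V"
  shows "epi_closed {M. opp M \<in> V}"
  unfolding epi_closed_def
proof (intro conjI ballI impI)
  show "{M. opp M \<in> V} \<subseteq> finite_monoids"
    using assms by (auto simp: epi_closed_def)
  fix M N assume "M \<in> {M. opp M \<in> V}" "N \<in> finite_monoids" "epi M N \<noteq> {}"
  then have "opp M \<in> V" "opp N \<in> finite_monoids" "epi (opp M) (opp N) \<noteq> {}" by auto
  then show "N \<in> {M. opp M \<in> V}" using assms by (auto simp: epi_closed_def simp del: epi_opp opp_mem_finite_monoids)
qed

lemma epi_closed_TW_R: "epi_closed (TW_R m)" and epi_closed_TW_L: "epi_closed (TW_L m)"
proof -
  have L: "epi_closed (TW_L m)" if "epi_closed (TW_R m)" for m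
  proof -
    have "TW_L m = {M. opp M \<in> TW_R m}" by (auto simp: TW_L_iff)
    then show ?thesis using epi_closed_opp[OF that] by simp
  qed
  have R: "epi_closed (TW_R m)" for m
  proof (induction m rule: less_induct)
    case (less m)
    then show ?case
      using epi_closed_R_trivial epi_closed_malcev_K[OF L[of "m - 1"]]
      by (simp add: TW_R.simps[of m])
  qed
  show "epi_closed (TW_R m)" "epi_closed (TW_L m)" using R L by auto
qed

text \<open>One level is gained because \<open>h\<close> identifies pairs of level \<open>n\<close>,
  so \<open>w\<close> and \<open>w'\<close> are \<open>sim_K\<close>-equivalent. As
  \<open>sim_K\<close> only tests idempotents, \<open>p\<close> is replaced by an idempotent
  \<open>e\<close> with \<open>p e = p\<close>, taken from the loop \<open>w z\<close> at
  \<open>p\<close>; then \<open>e w = e w'\<close> gives \<open>p w = p w'\<close>.\<close>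

lemma join_cond_malcev_K:
  fixes M (structure)
  assumes V: "V \<subseteq> {N \<in> finite_monoids. join_cond n N}" and M: "M \<in> malcev_K V"
  shows "join_cond (Suc n) M"
proof -
  interpret finite_monoid M using M by (simp add: malcev_K_iff finite_monoids_iff)
  obtain N h where N: "N \<in> V" "h \<in> epi M N"
    and ker: "\<And>x y. x \<in> carrier M \<Longrightarrow> y \<in> carrier M \<Longrightarrow> h x = h y \<longleftrightarrow> (x, y) \<in> sim_K M"
    using M by (auto simp: malcev_K_iff)
  have mN: "monoid N" and cond: "join_cond n N" using N(1) V by (auto simp: finite_monoids_def)
  have hh: "h \<in> hom M N" using N(2) by (simp add: epi_def)
  have "is_DA M"
    unfolding is_DA_def
  proof (intro ballI impI)
    fix e a x b
    assume c: "e \<in> carrier M" "a \<in> carrier M" "x \<in> carrier M" "b \<in> carrier M"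
      and e: "e \<otimes> e = e" "a \<otimes> x \<otimes> b = e"
    have "h e \<otimes>\<^bsub>N\<^esub> h x \<otimes>\<^bsub>N\<^esub> h e = h e"
    proof (rule is_DAD)
      show "is_DA N" using cond by (simp add: join_cond_def)
      show "h e \<otimes>\<^bsub>N\<^esub> h e = h e" using hom_mult[OF hh c(1,1)] e(1) by simp
      show "h a \<otimes>\<^bsub>N\<^esub> h x \<otimes>\<^bsub>N\<^esub> h b = h e"
        using c by (subst e(2)[symmetric]) (simp add: hom_mult[OF hh])
    qed (use c hom_in_carrier[OF hh] in auto)
    then have "h (e \<otimes> x \<otimes> e) = h e" using c by (simp add: hom_mult[OF hh])
    \<comment> \<open>Testing this equivalence with \<open>e\<close> itself turns it into an
      equality.\<close>
    then have sim: "(e \<otimes> x \<otimes> e, e) \<in> sim_K M" using ker c by simp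
    moreover have "rstab M e e" unfolding rstab_def using c(1) e(1) by auto
    ultimately have "e \<otimes> (e \<otimes> x \<otimes> e) = e \<otimes> e"
      using sim_KD[OF sim monoid_axioms c(1) e(1)] by blast
    then show "e \<otimes> x \<otimes> e = e" using c e(1) by (simp flip: m_assoc)
  qed
  moreover have "x = y" if xy: "(x, y) \<in> stable_pairs M (Suc n)" for x y
  proof -
    obtain p w w' t where *: "x = p \<otimes> w \<otimes> t" "y = p \<otimes> w' \<otimes> t"
      "p \<in> carrier M" "(w, w') \<in> stable_pairs M n" "rstab M p w"
      "t \<in> carrier M" "rstab M p w'" "lstab M w t" "lstab M w' t"
      using xy by auto
    have w: "w \<in> carrier M" "w' \<in> carrier M"
      using stable_pairs_closed[OF monoid_axioms *(4)] by auto
    have "h w = h w'"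
      using stable_pairs_hom[OF monoid_axioms mN hh *(4)] cond by (auto simp: join_cond_def)
    then have sim: "(w, w') \<in> sim_K M" using ker w by blast
    obtain z where z: "z \<in> carrier M" "p \<otimes> (w \<otimes> z) = p"
      using *(3,5) w by (auto simp: rstab_def m_assoc)
    have "w \<otimes> z \<in> carrier M" using z w by auto
    then obtain e u where e: "e \<in> carrier M" "e \<otimes> e = e" "p \<otimes> e = p" "u \<in> carrier M"
      "e = w \<otimes> z \<otimes> u" "e = u \<otimes> (w \<otimes> z)"
      by (rule idempotent_fixing[OF *(3) _ z(2)])
    have "e \<otimes> w \<otimes> (z \<otimes> u) = e" 
      using e(2) unfolding e(5) using w(1) z(1) e(4) by (simp add: m_assoc)
    then have "rstab M e w" unfolding rstab_def using e z by blast
    then have "e \<otimes> w = e \<otimes> w'" using sim_KD[OF sim monoid_axioms e(1,2)] by blast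
    then have "p \<otimes> e \<otimes> w = p \<otimes> e \<otimes> w'" using *(3) e(1) w by (simp add: m_assoc)
    then show ?thesis using * e(3) by simp
  qed
  ultimately show ?thesis unfolding join_cond_def by (auto simp del: stable_pairs.simps)
qed

lemma join_cond_R_trivial:
  fixes M (structure)
  assumes M: "M \<in> R_trivial_monoids"
  shows "join_cond 1 M"
proof -
  interpret finite_monoid M using M by (simp add: R_trivial_iff finite_monoids_iff)
  have triv: "p \<otimes> w = p" if "p \<in> carrier M" "w \<in> carrier M" "rstab M p w" for p w
    using M that by (auto simp: R_trivial_iff)
  have "is_DA M"
    unfolding is_DA_def
  proof (intro ballI impI)
    fix e a x b
    assume c: "e \<in> carrier M" "a \<in> carrier M" "x \<in> carrier M" "b \<in> carrier M"
      and e: "e \<otimes> e = e" "a \<otimes> x \<otimes> b = e"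
    have eq: "e \<otimes> (a \<otimes> (x \<otimes> b)) = e" using c e by (simp add: m_assoc)
    then have "e \<otimes> a \<otimes> (x \<otimes> b) = e" using c by (simp add: m_assoc)
    then have ea: "e \<otimes> a = e" using c triv[of e a] by (auto simp: rstab_def)
    then have "e \<otimes> x \<otimes> b = e" using \<open>e \<otimes> a \<otimes> (x \<otimes> b) = e\<close> c by (simp add: m_assoc)
    then have "e \<otimes> x = e" using c triv[of e x] by (auto simp: rstab_def)
    then show "e \<otimes> x \<otimes> e = e" using e by simp
  qed
  \<comment> \<open>Since \<open>p w = p = p w'\<close>, both components of a pair of level 1 equal
    \<open>p t\<close>.\<close>
  moreover have "stable_pairs M 1 \<subseteq> Id" by (auto simp: triv)
  ultimately show ?thesis by (simp add: join_cond_def)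
qed

lemma TW_R_join_cond: "m \<ge> 2 \<Longrightarrow> TW_R m \<subseteq> {M \<in> finite_monoids. join_cond (m - 1) M}"
proof (induction m rule: less_induct)
  case (less m)
  show ?case
  proof (cases "m = 2")
    case True
    then show ?thesis
      using join_cond_R_trivial by (auto simp: TW_R.simps[of 2] R_trivial_monoids_def)
  next
    case False
    then have m: "m > 2" using less.prems by simp
    have "TW_L (m - 1) \<subseteq> {M \<in> finite_monoids. join_cond (m - 2) M}"
    proof
      fix N assume "N \<in> TW_L (m - 1)"
      moreover have "2 \<le> m - 1" "m - 1 - 1 = m - 2" using m by auto
      ultimately have "opp N \<in> finite_monoids" "join_cond (m - 2) (opp N)"
        using less.IH[of "m - 1"] m by (auto simp: TW_L_iff)
      then show "N \<in> {M \<in> finite_monoids. join_cond (m - 2) M}"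
        using join_cond_opp[of "opp N"] opp_mem_finite_monoids[of N]
        by (simp add: finite_monoids_def del: opp_mem_finite_monoids)
    qed
    moreover have "m - 1 = Suc (m - 2)" using m by simp
    ultimately show ?thesis
      using join_cond_malcev_K[of "TW_L (m - 1)" "m - 2"] m
      by (auto simp: TW_R.simps[of m] malcev_K_iff)
  qed
qed

lemma TW_L_join_cond: "m \<ge> 2 \<Longrightarrow> TW_L m \<subseteq> {M \<in> finite_monoids. join_cond (m - 1) M}"
proof
  fix N assume "m \<ge> 2" "N \<in> TW_L m"
  then have "opp N \<in> finite_monoids" "join_cond (m - 1) (opp N)"
    using TW_R_join_cond[of m] by (auto simp: TW_L_iff)
  then show "N \<in> {M \<in> finite_monoids. join_cond (m - 1) M}"
    using join_cond_opp[of "opp N"] opp_mem_finite_monoids[of N]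
    by (simp add: finite_monoids_def del: opp_mem_finite_monoids)
qed

section \<open>Congruences on words\<close>

text \<open>A word is split at the first occurrence of \<open>a\<close>. Without an occurrence,
  \<open>bef\<close> is the whole word and \<open>aft\<close> is empty.\<close>

definition bef :: "'a \<Rightarrow> 'a list \<Rightarrow> 'a list" where
  "bef a u = takeWhile (\<lambda>x. x \<noteq> a) u"

definition aft :: "'a \<Rightarrow> 'a list \<Rightarrow> 'a list" where
  "aft a u = tl (dropWhile (\<lambda>x. x \<noteq> a) u)"

lemma bef_Nil [simp]: "bef a [] = []" and bef_Cons [simp]: "bef a (x # u) = (if x = a then [] else x # bef a u)"
  and aft_Nil [simp]: "aft a [] = []" and aft_Cons [simp]: "aft a (x # u) = (if x = a then u else aft a u)"
  by (auto simp: bef_def aft_def)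

lemma bef_aft_split: "a \<in> set u \<Longrightarrow> bef a u @ a # aft a u = u"
  by (induction u) auto

lemma set_bef_subset: "set (bef a u) \<subseteq> set u" and set_aft_subset: "set (aft a u) \<subseteq> set u"
  by (induction u) auto

lemma bef_append: "bef a (u @ v) = (if a \<in> set u then bef a u else u @ bef a v)"
  and aft_append: "aft a (u @ v) = (if a \<in> set u then aft a u @ v else aft a v)"
  by (induction u) auto

lemma bef_bef: "b \<in> set (bef a u) \<Longrightarrow> bef b (bef a u) = bef b u"
  and aft_bef: "b \<in> set (bef a u) \<Longrightarrow> aft b (bef a u) = bef a (aft b u)"
  and in_aft: "b \<in> set (bef a u) \<Longrightarrow> a \<in> set u \<Longrightarrow> a \<in> set (aft b u)"
  by (induction u) (auto split: if_splits)

lemma subseq_Cons_aft: "subseq (a # b) u \<longleftrightarrow> a \<in> set u \<and> subseq b (aft a u)"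
  by (induction u) (auto dest: subseq_Cons')

text \<open>The word counterpart of \<open>malcev_K\<close>. Along at most \<open>k\<close>
  successive jumps to first occurrences, \<open>r\<close> compares the segments jumped over and the
  remaining words. In quotients by \<open>Kexp r k\<close>, the images of
  \<open>r\<close>-equivalent words are \<open>sim_K\<close>-equivalent; this rests on
  \<open>Kexp_quotient_absorb\<close>.\<close>

primrec Kexp :: "('a list \<Rightarrow> 'a list \<Rightarrow> bool) \<Rightarrow> nat \<Rightarrow> 'a list \<Rightarrow> 'a list \<Rightarrow> bool" where
  "Kexp r 0 = r"
| "Kexp r (Suc k) = (\<lambda>u v. r u v \<and>
     (\<forall>a\<in>set u \<union> set v. r (bef a u) (bef a v) \<and> Kexp r k (aft a u) (aft a v)))"

lemma Kexp_SucD: "Kexp r (Suc k) u v \<Longrightarrow> a \<in> set u \<union> set v \<Longrightarrow> r (bef a u) (bef a v) \<and> Kexp r k (aft a u) (aft a v)"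
  by simp

lemma Kexp_imp: "Kexp r k u v \<Longrightarrow> r u v"
  by (cases k) auto

lemma Kexp_Suc_imp: "Kexp r (Suc k) u v \<Longrightarrow> Kexp r k u v"
proof (induction k arbitrary: u v)
  case (Suc k)
  have "Kexp r k (aft a u) (aft a v)" if "a \<in> set u \<union> set v" for a
    using Kexp_SucD[OF Suc.prems that] Suc.IH by blast
  moreover have "r u v" "r (bef a u) (bef a v)" if "a \<in> set u \<union> set v" for a
    using Kexp_imp[OF Suc.prems] Kexp_SucD[OF Suc.prems that] by auto
  ultimately show ?case using Kexp_imp[OF Suc.prems] by (simp only: Kexp.simps) blast
qed (auto intro: Kexp_imp)

lemma Kexp_antimono: "Kexp r k u v \<Longrightarrow> j \<le> k \<Longrightarrow> Kexp r j u v"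
  by (induction k) (auto simp only: le_Suc_eq dest: Kexp_Suc_imp)

lemma Kexp_mono: "Kexp r k u v \<Longrightarrow> (\<And>u v. r u v \<Longrightarrow> r' u v) \<Longrightarrow> Kexp r' k u v"
  by (induction k arbitrary: u v) auto

text \<open>\<open>alph\<close> ensures that a first occurrence exists in both of two related words
  or in neither, so that they can be cut in parallel.\<close>

locale word_congruence =
  fixes r :: "'a list \<Rightarrow> 'a list \<Rightarrow> bool"
  assumes refl: "r u u"
    and sym: "r u v \<Longrightarrow> r v u"
    and trans: "r u v \<Longrightarrow> r v w \<Longrightarrow> r u w"
    and append: "r u v \<Longrightarrow> r u' v' \<Longrightarrow> r (u @ u') (v @ v')"
    and alph: "r u v \<Longrightarrow> set u = set v"

lemma word_congruence_set: "word_congruence (\<lambda>u v. set u = set v)"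
  by unfold_locales auto

lemma word_congruence_rev:
  assumes "word_congruence r"
  shows "word_congruence (\<lambda>u v. r (rev u) (rev v))"
proof -
  interpret word_congruence r by fact
  show ?thesis
  proof
    fix u v w u' v' :: "'a list"
    show "r (rev u) (rev u)" by (rule refl)
    show "r (rev u) (rev v) \<Longrightarrow> r (rev v) (rev u)" by (rule sym)
    show "r (rev u) (rev v) \<Longrightarrow> r (rev v) (rev w) \<Longrightarrow> r (rev u) (rev w)" by (rule trans)
    show "r (rev (u @ u')) (rev (v @ v'))" if "r (rev u) (rev v)" "r (rev u') (rev v')"
      using append[OF that(2,1)] by simp
    show "set u = set v" if "r (rev u) (rev v)"
      using alph[OF that] by simp
  qed
qed

context word_congruence
begin

lemma Kexp_refl: "Kexp r k u u"
  by (induction k arbitrary: u) (auto simp: refl)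

lemma Kexp_sym: "Kexp r k u v \<Longrightarrow> Kexp r k v u"
  by (induction k arbitrary: u v) (auto simp: sym)

lemma Kexp_alph: "Kexp r k u v \<Longrightarrow> set u = set v"
  using Kexp_imp alph by blast

lemma Kexp_trans: "Kexp r k u v \<Longrightarrow> Kexp r k v w \<Longrightarrow> Kexp r k u w"
proof (induction k arbitrary: u v w)
  case 0
  then show ?case by (simp, metis trans)
next
  case (Suc k)
  have "set u = set v" "set v = set w" using Suc.prems Kexp_alph by blast+
  then have "r (bef a u) (bef a w) \<and> Kexp r k (aft a u) (aft a w)" if "a \<in> set u \<union> set w" for a
    using that Kexp_SucD[OF Suc.prems(1), of a] Kexp_SucD[OF Suc.prems(2), of a] trans Suc.IH by blast
  then show ?case
    using trans[OF Kexp_imp[OF Suc.prems(1)] Kexp_imp[OF Suc.prems(2)]] by (simp only: Kexp.simps) blast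
qed

lemma Kexp_append_left: "Kexp r k u v \<Longrightarrow> Kexp r k (z @ u) (z @ v)"
proof (induction k arbitrary: z)
  case 0
  then show ?case using append refl by simp
next
  case (Suc k)
  have eq: "set u = set v" using Suc.prems Kexp_alph by blast
  have IH: "Kexp r k (z @ u) (z @ v)" for z
    using Suc.IH Kexp_Suc_imp[OF Suc.prems] by blast
  have "r (bef a (z @ u)) (bef a (z @ v)) \<and> Kexp r k (aft a (z @ u)) (aft a (z @ v))"
    if "a \<in> set (z @ u) \<union> set (z @ v)" for a
  proof (cases "a \<in> set z")
    case False
    then have "a \<in> set u \<union> set v" using that by auto
    then show ?thesis
      using False Kexp_SucD[OF Suc.prems] append[OF refl] by (simp add: bef_append aft_append)
  qed (use IH refl in \<open>simp add: bef_append aft_append\<close>)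
  then show ?case using append[OF refl Kexp_imp[OF Suc.prems]] by (simp only: Kexp.simps) blast
qed

lemma Kexp_append_right: "Kexp r k u v \<Longrightarrow> Kexp r k (u @ z) (v @ z)"
proof (induction k arbitrary: u v)
  case 0
  then show ?case using append refl by simp
next
  case (Suc k)
  have eq: "set u = set v" using Suc.prems Kexp_alph by blast
  have "r (bef a (u @ z)) (bef a (v @ z)) \<and> Kexp r k (aft a (u @ z)) (aft a (v @ z))"
    if "a \<in> set (u @ z) \<union> set (v @ z)" for a
  proof (cases "a \<in> set u")
    case True
    then show ?thesis
      using eq Kexp_SucD[OF Suc.prems, of a] Suc.IH by (simp add: bef_append aft_append)
  qed (use eq append[OF Kexp_imp[OF Suc.prems] refl] Kexp_refl in \<open>simp add: bef_append aft_append\<close>)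
  then show ?case using append[OF Kexp_imp[OF Suc.prems] refl] by (simp only: Kexp.simps) blast
qed

lemma word_congruence_Kexp: "word_congruence (Kexp r k)"
proof
  fix u v u' v' assume "Kexp r k u v" "Kexp r k u' v'"
  then show "Kexp r k (u @ u') (v @ v')"
    using Kexp_append_left Kexp_append_right Kexp_trans by blast
qed (use Kexp_refl Kexp_sym Kexp_trans Kexp_alph in blast)+

text \<open>Greedy matching puts every letter of \<open>a\<close> at its next first occurrence and
  spends one jump on it.\<close>

lemma Kexp_subseq: "Kexp r k u v \<Longrightarrow> length a \<le> k \<Longrightarrow> subseq a u \<longleftrightarrow> subseq a v"
proof (induction a arbitrary: k u v)
  case (Cons x a)
  then obtain k' where k: "k = Suc k'" by (cases k) auto
  have eq: "set u = set v" using Cons.prems Kexp_alph by blast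
  have "subseq a (aft x u) \<longleftrightarrow> subseq a (aft x v)" if "x \<in> set u"
    using Kexp_SucD[of r k' u v x] Cons.prems Cons.IH[of k' "aft x u" "aft x v"] that by (simp only: k) simp
  then show ?case using eq unfolding subseq_Cons_aft by blast
qed simp

text \<open>A letter \<open>b\<close> occurring before the first \<open>a\<close> has the same first
  occurrence in \<open>bef a u\<close> as in \<open>u\<close>, and what follows it up to
  \<open>a\<close> is \<open>bef a (aft b u)\<close>. The induction thus applies to
  \<open>aft b u\<close>; the level lost is the jump to \<open>a\<close>.\<close>

lemma Kexp_bef: "Kexp r (Suc k) u v \<Longrightarrow> a \<in> set u \<Longrightarrow> Kexp r k (bef a u) (bef a v)"
proof (induction k arbitrary: u v)
  case 0
  then show ?case by simp
next
  case (Suc k)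
  have eq: "set u = set v" using Suc.prems Kexp_alph by blast
  have ra: "r (bef a u) (bef a v)" using Kexp_SucD[OF Suc.prems(1)] Suc.prems(2) by blast
  then have eq': "set (bef a u) = set (bef a v)" using alph by blast
  have "r (bef b (bef a u)) (bef b (bef a v)) \<and> Kexp r k (aft b (bef a u)) (aft b (bef a v))"
    if "b \<in> set (bef a u) \<union> set (bef a v)" for b
  proof -
    have b: "b \<in> set (bef a u)" "b \<in> set (bef a v)" using that eq' by auto
    then have bu: "b \<in> set u" using set_bef_subset by fast
    have "Kexp r (Suc k) (aft b u) (aft b v)" "r (bef b u) (bef b v)"
      using Kexp_SucD[OF Suc.prems(1), of b] bu by blast+
    then show ?thesis
      using Suc.IH in_aft[OF b(1) Suc.prems(2)] b by (simp add: bef_bef aft_bef)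
  qed
  then show ?case using ra by (simp only: Kexp.simps) blast
qed

end

text \<open>In \<open>x @ c # y\<close> the greedy search from the left for \<open>a @ [c]\<close>
  ends precisely at this \<open>c\<close>. Phrased by \<open>subseq\<close>, this is a property of
  the short subsequences of \<open>x\<close> and needs no positions.\<close>

definition lmark :: "'a list \<Rightarrow> 'a list \<Rightarrow> 'a \<Rightarrow> bool" where
  "lmark a x c \<longleftrightarrow> subseq a x \<and> \<not> subseq (a @ [c]) x"

lemma lmark_Nil: "lmark [] x c \<longleftrightarrow> c \<notin> set x"
  by (simp add: lmark_def subseq_singleton_left)

lemma lmark_Cons: "lmark (d # a) x c \<longleftrightarrow> d \<in> set x \<and> lmark a (aft d x) c"
  by (auto simp: lmark_def subseq_Cons_aft)

context word_congruence
begin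

text \<open>Each jump to the next letter of \<open>a\<close> spends one level, and so does the jump
  to \<open>c\<close>. The suffix comes out directly; the prefix is reassembled from the segments by
  compatibility with concatenation.\<close>

lemma Kexp_lmark:
  assumes "Kexp r (k + Suc (length a)) (x @ c # y) (x' @ c # y')" "lmark a x c" "lmark a x' c"
  shows "Kexp r k x x' \<and> Kexp r k y y'"
  using assms
proof (induction a arbitrary: x x')
  case Nil
  then have n: "c \<notin> set x" "c \<notin> set x'" by (auto simp: lmark_Nil)
  have K: "Kexp r (Suc k) (x @ c # y) (x' @ c # y')" using Nil by simp
  have "Kexp r k (bef c (x @ c # y)) (bef c (x' @ c # y'))"
    by (rule Kexp_bef[OF K]) simp
  moreover have "Kexp r k (aft c (x @ c # y)) (aft c (x' @ c # y'))"
    using Kexp_SucD[OF K, of c] by simp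
  ultimately show ?case using n by (simp add: bef_append aft_append)
next
  case (Cons d a)
  have d: "d \<in> set x" "d \<in> set x'" and m: "lmark a (aft d x) c" "lmark a (aft d x') c"
    using Cons.prems by (auto simp: lmark_Cons)
  have K: "Kexp r (Suc (k + Suc (length a))) (x @ c # y) (x' @ c # y')" using Cons.prems(1) by simp
  then have "Kexp r (k + Suc (length a)) (aft d (x @ c # y)) (aft d (x' @ c # y'))"
    using d Kexp_SucD[OF K, of d] by simp
  then have IH: "Kexp r k (aft d x) (aft d x')" "Kexp r k y y'"
    using Cons.IH[OF _ m] d by (auto simp: aft_append)
  have "Kexp r (k + Suc (length a)) (bef d (x @ c # y)) (bef d (x' @ c # y'))"
    by (rule Kexp_bef[OF K]) (use d in simp)
  then have "Kexp r k (bef d x) (bef d x')"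
    using d by (intro Kexp_antimono[of r "k + Suc (length a)" _ _ k]) (auto simp: bef_append)
  then have "Kexp r k ((bef d x @ [d]) @ aft d x) ((bef d x' @ [d]) @ aft d x')"
    using IH(1) Kexp_refl by (intro word_congruence.append[OF word_congruence_Kexp])
  then show ?case using IH(2) d by (simp add: bef_aft_split)
qed

text \<open>\<open>w\<close> is so rich in subsequences that \<open>k\<close> jumps end inside it.
  The tails are therefore only ever compared by the base relation \<open>r\<close>.\<close>

lemma Kexp_absorb:
  assumes "r x y" "set x \<subseteq> B" "set w \<subseteq> B" "\<And>a. a \<in> lists B \<Longrightarrow> length a \<le> k \<Longrightarrow> subseq a w"
  shows "Kexp r k (w @ x) (w @ y)"
  using assms(3,4)
proof (induction k arbitrary: w)
  case 0
  then show ?case using assms(1) append refl by simp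
next
  case (Suc k)
  have eq: "set x = set y" using assms(1) alph by blast
  have "r (bef a (w @ x)) (bef a (w @ y)) \<and> Kexp r k (aft a (w @ x)) (aft a (w @ y))"
    if "a \<in> set (w @ x) \<union> set (w @ y)" for a
  proof -
    have aB: "a \<in> B" using that Suc.prems(1) assms(2) eq by auto
    have aw: "a \<in> set w" using Suc.prems(2)[of "[a]"] aB by (simp add: subseq_singleton_left)
    have "Kexp r k (aft a w @ x) (aft a w @ y)"
    proof (rule Suc.IH)
      show "set (aft a w) \<subseteq> B" using set_aft_subset Suc.prems(1) by fast
      show "subseq b (aft a w)" if "b \<in> lists B" "length b \<le> k" for b
        using Suc.prems(2)[of "a # b"] that aB by (simp add: subseq_Cons_aft)
    qed
    then show ?thesis using aw refl by (simp add: bef_append aft_append)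
  qed
  then show ?case using append[OF refl assms(1)] by (simp only: Kexp.simps) blast
qed

text \<open>\<open>w\<close> is equivalent to its positive powers, a high power contains every short
  word over the letters of \<open>w\<close>, and short subsequences are invariant.\<close>

lemma subseq_of_Kexp_idempotent:
  assumes "Kexp r k (w @ w) w" "a \<in> lists (set w)" "length a \<le> k"
  shows "subseq a w"
proof -
  have "Kexp r k (concat (replicate (Suc n) w)) w" for n
  proof (induction n)
    case (Suc n)
    have "Kexp r k (w @ concat (replicate (Suc n) w)) (w @ w)"
      using Suc by (rule Kexp_append_left)
    then show ?case using Kexp_trans assms(1) by simp
  qed (simp add: Kexp_refl)
  moreover have "subseq a (concat (replicate n w))" if "length a \<le> n" for n
    using assms(2) that
  proof (induction a arbitrary: n)
    case (Cons b a)
    then obtain n' where n: "n = Suc n'" by (cases n) auto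
    have "subseq ([b] @ a) (w @ concat (replicate n' w))"
      using Cons n by (intro list_emb_append_mono) (auto simp: subseq_singleton_left)
    then show ?case using n by simp
  qed simp
  ultimately show ?thesis
    using Kexp_subseq[of k "concat (replicate (Suc (length a)) w)" w a] assms(3) le_SucI[OF order.refl]
    by blast
qed

end

text \<open>A colouring finer than \<open>r\<close> is enough, so classes need not be counted and
  colours for \<open>Kexp\<close> can simply be collected from colours for \<open>r\<close>.\<close>

definition finite_index :: "'a set \<Rightarrow> ('a list \<Rightarrow> 'a list \<Rightarrow> bool) \<Rightarrow> bool" where
  "finite_index A r \<longleftrightarrow> (\<exists>f :: 'a list \<Rightarrow> nat. finite (f ` lists A) \<and>
     (\<forall>u\<in>lists A. \<forall>v\<in>lists A. f u = f v \<longrightarrow> r u v))"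

lemma finite_indexI:
  fixes f :: "'a list \<Rightarrow> 'b"
  assumes "finite (f ` lists A)" "\<And>u v. u \<in> lists A \<Longrightarrow> v \<in> lists A \<Longrightarrow> f u = f v \<Longrightarrow> r u v"
  shows "finite_index A r"
proof -
  obtain n :: nat and g :: "'b \<Rightarrow> nat" where g: "inj_on g (f ` lists A)"
    using finite_imp_inj_to_nat_seg[OF assms(1)] by auto
  show ?thesis
    unfolding finite_index_def
  proof (intro exI conjI ballI impI)
    show "finite ((\<lambda>u. g (f u)) ` lists A)"
      using assms(1) by (simp add: image_image[symmetric])
    fix u v assume "u \<in> lists A" "v \<in> lists A" "g (f u) = g (f v)"
    then show "r u v" using assms(2) g by (metis inj_onD imageI)
  qed
qed

lemma finite_index_set: "finite A \<Longrightarrow> finite_index A (\<lambda>u v. set u = set v)"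
  by (rule finite_indexI[of set]) (auto intro: finite_subset[of _ "Pow A"])

lemma finite_index_rev: "finite_index A r \<Longrightarrow> finite_index A (\<lambda>u v. r (rev u) (rev v))"
proof -
  assume "finite_index A r"
  then obtain f :: "'a list \<Rightarrow> nat" where f: "finite (f ` lists A)"
    "\<And>u v. u \<in> lists A \<Longrightarrow> v \<in> lists A \<Longrightarrow> f u = f v \<Longrightarrow> r u v"
    by (auto simp: finite_index_def)
  show ?thesis
  proof (rule finite_indexI[of "\<lambda>u. f (rev u)"])
    show "finite ((\<lambda>u. f (rev u)) ` lists A)"
      by (rule finite_subset[OF _ f(1)]) (auto simp: in_lists_conv_set)
  qed (use f(2) in \<open>auto simp: in_lists_conv_set\<close>)
qed

lemma bef_in_lists: "u \<in> lists A \<Longrightarrow> bef a u \<in> lists A" and aft_in_lists: "u \<in> lists A \<Longrightarrow> aft a u \<in> lists A"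
  using set_bef_subset[of a u] set_aft_subset[of a u] by (auto simp: in_lists_conv_set)

lemma finite_index_Kexp:
  assumes A: "finite A" and r: "finite_index A r"
  shows "finite_index A (Kexp r k)"
proof (induction k)
  case 0
  then show ?case using r by simp
next
  case (Suc k)
  obtain f :: "'a list \<Rightarrow> nat" where f: "finite (f ` lists A)"
    "\<And>u v. u \<in> lists A \<Longrightarrow> v \<in> lists A \<Longrightarrow> f u = f v \<Longrightarrow> r u v"
    using r by (auto simp: finite_index_def)
  obtain g :: "'a list \<Rightarrow> nat" where g: "finite (g ` lists A)"
    "\<And>u v. u \<in> lists A \<Longrightarrow> v \<in> lists A \<Longrightarrow> g u = g v \<Longrightarrow> Kexp r k u v"
    using Suc by (auto simp: finite_index_def)
  \<comment> \<open>For each letter, the colours of the two parts. The letter is kept in the record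
    so that equal records force equal alphabets.\<close>
  define h where "h u = (\<lambda>a. (a, f (bef a u), g (aft a u))) ` set u" for u
  show ?case
  proof (rule finite_indexI[of "\<lambda>u. (f u, h u)"])
    show "finite ((\<lambda>u. (f u, h u)) ` lists A)"
    proof (rule finite_subset)
      show "(\<lambda>u. (f u, h u)) ` lists A \<subseteq> f ` lists A \<times> Pow (A \<times> f ` lists A \<times> g ` lists A)"
        unfolding h_def
        by (intro image_subsetI SigmaI PowI imageI bef_in_lists aft_in_lists) (auto simp: in_lists_conv_set)
    qed (use A f(1) g(1) in auto)
  next
    fix u v assume uv: "u \<in> lists A" "v \<in> lists A" "(f u, h u) = (f v, h v)"
    have *: "r (bef a u) (bef a v) \<and> Kexp r k (aft a u) (aft a v)"
      if "a \<in> set u" "u \<in> lists A" "v \<in> lists A" "h u = h v" for a u v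
    proof -
      have "(a, f (bef a u), g (aft a u)) \<in> h v" using that by (auto simp: h_def)
      then have "f (bef a u) = f (bef a v)" "g (aft a u) = g (aft a v)" by (auto simp: h_def)
      then show ?thesis
        using f(2)[OF bef_in_lists bef_in_lists] g(2)[OF aft_in_lists aft_in_lists] that(2,3) by blast
    qed
    have "fst ` h u = fst ` h v" using uv by simp
    then have "set u = set v" by (simp add: h_def image_image)
    moreover have "r u v" using f(2) uv by simp
    ultimately show "Kexp r (Suc k) u v"
      using *[OF _ uv(1,2)] uv(3) by simp
  qed
qed

text \<open>The quotients by \<open>rho (m - 1) k\<close> lie in the variety \<open>R\<^sub>m\<close>; the reversals lie in \<open>L\<^sub>m\<close>.\<close>

primrec rho :: "nat \<Rightarrow> nat \<Rightarrow> 'a list \<Rightarrow> 'a list \<Rightarrow> bool" where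
  "rho 0 k = (\<lambda>u v. set u = set v)"
| "rho (Suc m) k = Kexp (\<lambda>u v. rho m k (rev u) (rev v)) k"

lemma word_congruence_rho: "word_congruence (rho m k)"
proof (induction m)
  case 0
  show ?case using word_congruence_set by simp
next
  case (Suc m)
  show ?case
    using word_congruence.word_congruence_Kexp[OF word_congruence_rev[OF Suc]] by simp
qed

lemma finite_index_rho: "finite A \<Longrightarrow> finite_index A (rho m k)"
  by (induction m) (simp_all add: finite_index_set finite_index_Kexp finite_index_rev)

lemma rho_sym: "rho m k u v \<Longrightarrow> rho m k v u"
  using word_congruence.sym[OF word_congruence_rho] .

lemma rho_antimono: "rho m k u v \<Longrightarrow> j \<le> k \<Longrightarrow> rho m j u v"
proof (induction m arbitrary: u v)
  case (Suc m)
  have "Kexp (\<lambda>u v. rho m j (rev u) (rev v)) k u v"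
    using Suc.prems Suc.IH by (simp, elim Kexp_mono) blast
  then show ?case using Kexp_antimono Suc.prems(2) by simp
qed simp

lemma rho_Suc_rev: "rho (Suc m) k u v \<Longrightarrow> rho m k (rev u) (rev v)"
  using Kexp_imp by fastforce

lemma rho_Suc: "rho (Suc m) k u v \<Longrightarrow> rho m k u v"
proof (induction m arbitrary: u v)
  case 0
  then show ?case using rho_Suc_rev[OF 0] by simp
next
  case (Suc m)
  show ?case
    unfolding rho.simps(2)[of m]
    by (rule Kexp_mono[of "\<lambda>u v. rho (Suc m) k (rev u) (rev v)"])
      (use Suc.prems Suc.IH in \<open>auto simp only: rho.simps(2)[of "Suc m"]\<close>)
qed

lemma rho_subseq: "rho (Suc m) k u v \<Longrightarrow> length a \<le> k \<Longrightarrow> subseq a u \<longleftrightarrow> subseq a v"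
  using word_congruence.Kexp_subseq[OF word_congruence_rev[OF word_congruence_rho]] by simp

text \<open>One parameter serves all levels of \<open>rho\<close>. The jumps spent on the cut
  therefore lower it in the inner relations too, which are weakened from \<open>k + j\<close> to
  \<open>k\<close>.\<close>

lemma rho_lmark:
  assumes "rho (Suc m) (k + j) (x @ c # y) (x' @ c # y')" "lmark a x c" "lmark a x' c" "length a < j"
  shows "rho (Suc m) k x x' \<and> rho (Suc m) k y y'"
proof -
  interpret word_congruence "\<lambda>u v. rho m (k + j) (rev u) (rev v)"
    using word_congruence_rev[OF word_congruence_rho] .
  let ?K = "Kexp (\<lambda>u v. rho m (k + j) (rev u) (rev v))"
  have K: "?K (k + Suc (length a)) (x @ c # y) (x' @ c # y')"
    by (rule Kexp_antimono[of _ "k + j"]) (use assms(1,4) in simp_all)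
  have "?K k x x'" "?K k y y'" using Kexp_lmark[OF K assms(2,3)] by blast+
  then show ?thesis
    unfolding rho.simps by (blast intro: Kexp_mono rho_antimono[OF _ le_add1])
qed

declare rho.simps(2) [simp del]

section \<open>Marked positions\<close>

lemma subseq_rev_imp: "subseq a u \<Longrightarrow> subseq (rev a) (rev u)"
  by (induction rule: list_emb.induct) (auto intro: subseq_rev_drop_many list_emb_append_mono)

lemma subseq_rev_iff: "subseq (rev a) (rev u) \<longleftrightarrow> subseq a u"
  using subseq_rev_imp[of a u] subseq_rev_imp[of "rev a" "rev u"] by auto

lemma subseq_snoc: "subseq (a @ [c]) (x @ [d]) \<longleftrightarrow> subseq (a @ [c]) x \<or> (c = d \<and> subseq a x)"
proof -
  have "subseq (c # rev a) (d # rev x) \<longleftrightarrow> subseq (c # rev a) (rev x) \<or> (c = d \<and> subseq (rev a) (rev x))"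
    by (auto dest: subseq_Cons' split: if_splits)
  then show ?thesis
    using subseq_rev_iff[of "a @ [c]" "x @ [d]"] subseq_rev_iff[of "a @ [c]" x] subseq_rev_iff[of a x]
    by simp
qed

lemma lmark_extend: "lmark a x d \<Longrightarrow> d \<notin> set w \<Longrightarrow> lmark a (x @ w) d"
proof (induction w rule: rev_induct)
  case (snoc e w)
  then have "lmark a (x @ w) d" "e \<noteq> d" by auto
  then show ?case
    using subseq_snoc[of a d "x @ w" e] subseq_rev_drop_many[of a "x @ w" "[e]"]
    unfolding lmark_def by auto
qed simp

lemma lmark_exists:
  assumes "subseq (a @ [c]) v"
  obtains x y where "v = x @ c # y" "lmark a x c"
proof -
  have "\<exists>x y. v = x @ c # y \<and> lmark a x c"
    using assms
  proof (induction v rule: rev_induct)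
    case (snoc d v)
    show ?case
    proof (cases "subseq (a @ [c]) v")
      case True
      then show ?thesis using snoc.IH by fastforce
    next
      case False
      then have "c = d" "subseq a v" using snoc.prems subseq_snoc by metis+
      then show ?thesis using False by (intro exI[of _ v] exI[of _ "[]"]) (simp add: lmark_def)
    qed
  qed simp
  then show thesis using that by blast
qed

text \<open>Expresses the order of a marked position and another cut as a subsequence test on one
  prefix; such tests can be transferred between equivalent words.\<close>

lemma lmark_before_iff:
  assumes "lmark a x c" "x @ c # y = x' @ y'"
  shows "subseq (a @ [c]) x' \<longleftrightarrow> length x < length x'"
proof
  assume s: "subseq (a @ [c]) x'"
  show "length x < length x'"
  proof (rule ccontr)
    assume "\<not> length x < length x'"
    then obtain z where "x = x' @ z"
      using assms(2) by (auto simp: append_eq_append_conv2 Cons_eq_append_conv)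
    then show False using s assms(1) subseq_rev_drop_many unfolding lmark_def by blast
  qed
next
  assume "length x < length x'"
  then obtain z where "x' = (x @ [c]) @ z"
    using assms(2) by (auto simp: append_eq_append_conv2 Cons_eq_append_conv)
  moreover have "subseq (a @ [c]) (x @ [c])"
    using assms(1) unfolding lmark_def by (simp add: subseq_snoc)
  ultimately show "subseq (a @ [c]) x'" using subseq_rev_drop_many by blast
qed

definition subseq_eq :: "nat \<Rightarrow> 'a list \<Rightarrow> 'a list \<Rightarrow> bool" where
  "subseq_eq K u v \<longleftrightarrow> (\<forall>a. length a \<le> K \<longrightarrow> (subseq a u \<longleftrightarrow> subseq a v))"

lemma subseq_eq_rev: "subseq_eq K (rev u) (rev v) \<longleftrightarrow> subseq_eq K u v"
  unfolding subseq_eq_def by (metis length_rev rev_rev_ident subseq_rev_iff)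

lemma subseq_eq_snoc: "subseq_eq K x x' \<Longrightarrow> subseq_eq K (x @ [c]) (x' @ [c])"
  unfolding subseq_eq_def
proof (intro allI impI)
  fix a :: "'a list"
  assume *: "\<forall>a. length a \<le> K \<longrightarrow> subseq a x = subseq a x'" and a: "length a \<le> K"
  show "subseq a (x @ [c]) \<longleftrightarrow> subseq a (x' @ [c])"
  proof (cases a rule: rev_cases)
    case (snoc b d)
    then have "subseq b x = subseq b x'" "subseq a x = subseq a x'"
      using a *[rule_format, of b] *[rule_format, of a] by simp_all
    then show ?thesis using snoc by (simp add: subseq_snoc)
  qed simp
qed

text \<open>Inside \<open>X\<close> and \<open>X'\<close> the greedy search consumes the same
  initial part of \<open>a\<close>, because these words share their short subsequences;
  \<open>b\<close> is the part left for \<open>w\<close> and \<open>w'\<close>.\<close>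

lemma lmark_split:
  assumes "\<And>t. length t \<le> length a \<Longrightarrow> subseq t X \<longleftrightarrow> subseq t X'"
    "lmark a (X @ w) c" "lmark a (X' @ w') c"
  shows "\<exists>b. length b \<le> length a \<and> lmark b w c \<and> lmark b w' c"
  using assms
proof (induction a arbitrary: X X')
  case Nil
  then show ?case using lmark_Nil[of "X @ w" c] lmark_Nil[of "X' @ w'" c]
    by (intro exI[of _ "[]"]) (simp only: lmark_Nil set_append Un_iff, simp)
next
  case (Cons d a)
  have d: "d \<in> set X \<longleftrightarrow> d \<in> set X'"
    using Cons.prems(1)[of "[d]"] by (simp add: subseq_singleton_left)
  show ?case
  proof (cases "d \<in> set X")
    case True
    have "\<exists>b. length b \<le> length a \<and> lmark b w c \<and> lmark b w' c"
    proof (rule Cons.IH)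
      show "subseq t (aft d X) \<longleftrightarrow> subseq t (aft d X')" if "length t \<le> length a" for t
        using Cons.prems(1)[of "d # t"] that True d by (simp add: subseq_Cons_aft)
      show "lmark a (aft d X @ w) c" "lmark a (aft d X' @ w') c"
        using Cons.prems(2,3) True d by (simp_all add: lmark_Cons aft_append)
    qed
    then show ?thesis by (auto intro: le_SucI)
  next
    case False
    then show ?thesis
      using Cons.prems(2,3) d by (intro exI[of _ "d # a"]) (simp add: lmark_Cons aft_append)
  qed
qed

section \<open>Corresponding positions in two equivalent words\<close>

definition both_rho :: "nat \<Rightarrow> nat \<Rightarrow> 'a list \<Rightarrow> 'a list \<Rightarrow> bool" where
  "both_rho m k u v \<longleftrightarrow> rho m k u v \<and> rho m k (rev u) (rev v)"

lemma both_rho_rev: "both_rho m k (rev u) (rev v) \<longleftrightarrow> both_rho m k u v"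
  by (auto simp: both_rho_def)

lemma both_rho_sym: "both_rho m k u v \<Longrightarrow> both_rho m k v u"
  by (simp add: both_rho_def rho_sym)

lemma both_rhoI: "rho (Suc m) k u v \<Longrightarrow> both_rho m k u v"
  by (simp add: both_rho_def rho_Suc rho_Suc_rev)

lemma both_rho_antimono: "both_rho m k u v \<Longrightarrow> j \<le> k \<Longrightarrow> both_rho m j u v"
  by (auto simp: both_rho_def intro: rho_antimono)

lemma rho_subseq_eq: "rho (Suc m) k u v \<Longrightarrow> K \<le> k \<Longrightarrow> subseq_eq K u v"
  unfolding subseq_eq_def using rho_subseq[of m k u v] by auto

text \<open>Corresponding positions of \<open>u\<close> and \<open>v\<close>: they carry the same letter and are found by the same
  greedy search for a word of length at most \<open>K\<close>, either from the left or from the right.\<close>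

definition mark_pair :: "nat \<Rightarrow> 'a list \<Rightarrow> 'a list \<Rightarrow> 'a list \<Rightarrow> 'a \<Rightarrow> 'a list \<Rightarrow> 'a list \<Rightarrow> 'a list \<Rightarrow> bool" where
  "mark_pair K u v x c y x' y' \<longleftrightarrow> u = x @ c # y \<and> v = x' @ c # y' \<and>
     ((\<exists>a. length a < K \<and> lmark a x c \<and> lmark a x' c) \<or>
      (\<exists>b. length b < K \<and> lmark b (rev y) c \<and> lmark b (rev y') c))"

lemma mark_pair_swap: "mark_pair K u v x c y x' y' \<Longrightarrow> mark_pair K v u x' c y' x y"
  unfolding mark_pair_def by blast

lemma mark_pair_rev:
  "mark_pair K u v x c y x' y' \<Longrightarrow> mark_pair K (rev u) (rev v) (rev y) c (rev x) (rev y') (rev x')"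
  unfolding mark_pair_def by auto

lemma mark_pair_cases:
  assumes J: "both_rho (Suc m) (k + K) u v" and mp: "mark_pair K u v x c y x' y'"
  obtains (left) a where "length a < K" "lmark a x c" "lmark a x' c"
      "rho (Suc m) k x x'" "rho (Suc m) k y y'"
    | (right) b where "length b < K" "lmark b (rev y) c" "lmark b (rev y') c"
      "rho (Suc m) k (rev x) (rev x')" "rho (Suc m) k (rev y) (rev y')"
proof -
  have uv: "u = x @ c # y" "v = x' @ c # y'" using mp by (auto simp: mark_pair_def)
  consider (l) a where "length a < K" "lmark a x c" "lmark a x' c"
    | (r) b where "length b < K" "lmark b (rev y) c" "lmark b (rev y') c"
    using mp unfolding mark_pair_def by blast
  then show thesis
  proof cases
    case l
    then show thesis using left rho_lmark[of m k K x c y x' y' a] J uv by (simp add: both_rho_def)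
  next
    case r
    then show thesis
      using right rho_lmark[of m k K "rev y" c "rev x" "rev y'" "rev x'" b] J uv
      by (simp add: both_rho_def)
  qed
qed

text \<open>A cut keeps level \<open>Suc m\<close> for the reading direction that found it; having
  both directions afterwards costs one level.\<close>

lemma mark_pair_both_rho:
  assumes "both_rho (Suc m) (k + K) u v" "mark_pair K u v x c y x' y'"
  shows "both_rho m k x x' \<and> both_rho m k y y'"
  using assms
proof (cases rule: mark_pair_cases)
  case (right b)
  then show ?thesis using both_rhoI[of m k "rev x" "rev x'"] both_rhoI[of m k "rev y" "rev y'"]
    by (simp add: both_rho_rev)
qed (simp add: both_rhoI)

lemma mark_pair_subseq_eq:
  assumes "both_rho (Suc m) (K + K) u v" "mark_pair K u v x c y x' y'"
  shows "subseq_eq K x x' \<and> subseq_eq K y y'"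
  using assms
proof (cases rule: mark_pair_cases)
  case left
  then show ?thesis using rho_subseq_eq by blast
next
  case right
  then show ?thesis using rho_subseq_eq[OF _ order.refl] subseq_eq_rev by blast
qed

text \<open>If the first position is found from the left or the second from the right, a subsequence
  test at the other position decides the order, and its outcome is the same in \<open>u\<close> and
  \<open>v\<close>.\<close>

lemma mark_pair_less:
  assumes J: "both_rho (Suc m) (K + K) u v"
    and 1: "mark_pair K u v x1 c1 y1 x1' y1'" and 2: "mark_pair K u v x2 c2 y2 x2' y2'"
    and less: "length x1 < length x2"
  shows "length x1' < length x2'"
proof -
  have e1: "subseq_eq K x1 x1'" "subseq_eq K y1 y1'" and e2: "subseq_eq K x2 x2'" "subseq_eq K y2 y2'"
    using mark_pair_subseq_eq[OF J 1] mark_pair_subseq_eq[OF J 2] by auto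
  have u: "x1 @ c1 # y1 = x2 @ c2 # y2" and v: "x1' @ c1 # y1' = x2' @ c2 # y2'"
    using 1 2 by (auto simp: mark_pair_def)
  have len: "length x1 + length y1 = length x2 + length y2" "length x1' + length y1' = length x2' + length y2'"
    using arg_cong[OF u, of length] arg_cong[OF v, of length] by auto
  have ur: "rev y2 @ c2 # rev x2 = rev y1 @ c1 # rev x1" and vr: "rev y2' @ c2 # rev x2' = rev y1' @ c1 # rev x1'"
    using arg_cong[OF u, of rev] arg_cong[OF v, of rev] by auto
  consider (L1) a where "length a < K" "lmark a x1 c1" "lmark a x1' c1"
    | (R2) b where "length b < K" "lmark b (rev y2) c2" "lmark b (rev y2') c2"
    | (RL) a b where "length b < K" "lmark b (rev y1) c1" "lmark b (rev y1') c1"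
        "length a < K" "lmark a x2 c2" "lmark a x2' c2"
    using 1 2 unfolding mark_pair_def by blast
  then show ?thesis
  proof cases
    case L1
    have "subseq (a @ [c1]) x2" using lmark_before_iff[OF L1(2) u] less by simp
    then have "subseq (a @ [c1]) x2'" using e2(1) L1(1) by (simp add: subseq_eq_def)
    then show ?thesis using lmark_before_iff[OF L1(3) v] by simp
  next
    case R2
    have "subseq (b @ [c2]) (rev y1)" using lmark_before_iff[OF R2(2) ur] less len by simp
    then have "subseq (b @ [c2]) (rev y1')"
      using e1(2) R2(1) subseq_eq_rev[of K y1 y1'] by (simp add: subseq_eq_def)
    then show ?thesis using lmark_before_iff[OF R2(3) vr] len by simp
  next
    \<comment> \<open>Each search runs over the other position of \<open>u\<close> before it ends,
      so neither gives a direct test; the other possible orders in \<open>v\<close> are excluded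
      instead.\<close>
    case RL
    have "\<not> length x2' < length x1'"
    proof
      assume "length x2' < length x1'"
      then have "subseq (a @ [c2]) x1'" using lmark_before_iff[OF RL(6) v[symmetric]] by simp
      then have "subseq (a @ [c2]) x1" using e1(1) RL(4) by (simp add: subseq_eq_def)
      then show False using lmark_before_iff[OF RL(5) u[symmetric]] less by simp
    qed
    \<comment> \<open>If the positions coincided in \<open>v\<close>, then in \<open>u\<close> the
      word \<open>b\<close> would embed to the right of position 2, which carries the letter
      \<open>c2 = c1\<close>. The search from the right would then end before it reaches position
      1.\<close>
    moreover have "length x1' \<noteq> length x2'"
    proof
      assume "length x1' = length x2'"
      then have eq: "x1' = x2'" "c1 = c2" "y1' = y2'" using v by auto
      then have "subseq b (rev y2')" using RL(3) by (simp add: lmark_def)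
      then have "subseq b (rev y2)"
        using e2(2) RL(1) subseq_eq_rev[of K y2 y2'] by (simp add: subseq_eq_def)
      then have "subseq (b @ [c1]) (rev y2 @ [c2])" using eq by (simp add: subseq_snoc)
      moreover obtain z where "y1 = z @ c2 # y2"
        using u less by (auto simp: append_eq_append_conv2 Cons_eq_append_conv)
      ultimately have "subseq (b @ [c1]) (rev y1)"
        using subseq_rev_drop_many[of "b @ [c1]" "rev y2 @ [c2]" "rev z"] by simp
      then show False using RL(2) by (simp add: lmark_def)
    qed
    ultimately show ?thesis by simp
  qed
qed

lemma mark_pair_less_iff:
  assumes J: "both_rho (Suc m) (K + K) u v"
    and 1: "mark_pair K u v x1 c1 y1 x1' y1'" and 2: "mark_pair K u v x2 c2 y2 x2' y2'"
  shows "length x1' < length x2' \<longleftrightarrow> length x1 < length x2"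
  using mark_pair_less[OF J 1 2]
    mark_pair_less[OF both_rho_sym[OF J] mark_pair_swap[OF 1] mark_pair_swap[OF 2]] by blast

lemma mark_pair_exists:
  assumes J: "both_rho (Suc m) (K + K) u v" and u: "u = x @ c # y" and a: "length a < K" "lmark a x c"
  obtains x' y' where "mark_pair K u v x c y x' y'"
proof -
  have "subseq (a @ [c]) (x @ [c])" using a(2) by (simp add: lmark_def subseq_snoc)
  then have "subseq (a @ [c]) u" using subseq_rev_drop_many[of _ "x @ [c]" y] u by simp
  moreover have "subseq_eq K u v" using J rho_subseq_eq[of m "K + K" u v K] by (simp add: both_rho_def)
  ultimately have "subseq (a @ [c]) v" using a(1) by (simp add: subseq_eq_def)
  then obtain x' y' where "v = x' @ c # y'" "lmark a x' c" by (rule lmark_exists)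
  then show thesis using that u a unfolding mark_pair_def by blast
qed

section \<open>Factors between two cuts\<close>

definition cut_after :: "nat \<Rightarrow> 'a list \<Rightarrow> 'a list \<Rightarrow> 'a list \<Rightarrow> 'a list \<Rightarrow> 'a list \<Rightarrow> 'a list \<Rightarrow> bool" where
  "cut_after K u v x y x' y' \<longleftrightarrow> u = x @ y \<and> v = x' @ y' \<and>
     (x = [] \<and> x' = [] \<or> (\<exists>z c z'. x = z @ [c] \<and> x' = z' @ [c] \<and> mark_pair K u v z c y z' y'))"

definition cut_before :: "nat \<Rightarrow> 'a list \<Rightarrow> 'a list \<Rightarrow> 'a list \<Rightarrow> 'a list \<Rightarrow> 'a list \<Rightarrow> 'a list \<Rightarrow> bool" where
  "cut_before K u v x y x' y' \<longleftrightarrow> u = x @ y \<and> v = x' @ y' \<and>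
     (y = [] \<and> y' = [] \<or> (\<exists>c z z'. y = c # z \<and> y' = c # z' \<and> mark_pair K u v x c z x' z'))"

lemma cut_after_rev: "cut_after K u v x y x' y' \<Longrightarrow> cut_before K (rev u) (rev v) (rev y) (rev x) (rev y') (rev x')"
  unfolding cut_after_def cut_before_def using mark_pair_rev by fastforce

lemma cut_before_rev: "cut_before K u v x y x' y' \<Longrightarrow> cut_after K (rev u) (rev v) (rev y) (rev x) (rev y') (rev x')"
  unfolding cut_after_def cut_before_def using mark_pair_rev by fastforce

text \<open>Each end of the gap is removed by \<open>rho_lmark\<close> at the price of
  \<open>K\<close>. The one level pays for the change of reading direction: between the two
  removals, or, if both ends are found from the right, for turning the reversed result
  round.\<close>

lemma gap_rho:
  assumes J: "both_rho (Suc (Suc m)) (k + K + K) u v"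
    and A: "cut_after K u v x (w @ y) x' (w' @ y')"
    and B: "cut_before K u v (x @ w) y (x' @ w') y'"
  shows "rho (Suc m) k w w'"
proof -
  consider (whole) "y = []" "y' = []" "x = []" "x' = []" | (startB) "x = []" "x' = []" "y \<noteq> []" | (Aend) "y = []" "y' = []" "x \<noteq> []"
    | (AB) "x \<noteq> []" "y \<noteq> []"
    using A B by (auto simp: cut_after_def cut_before_def)
  then show ?thesis
  proof cases
    case whole
    then have "u = w" "v = w'" using A by (auto simp: cut_after_def)
    then show ?thesis
      using J rho_Suc rho_antimono[of "Suc m" "k + K + K" w w' k] by (auto simp: both_rho_def)
  next
    case startB
    then obtain c z z' where "mark_pair K u v w c z w' z'"
      using B by (auto simp: cut_before_def)
    then have "both_rho (Suc m) (k + K) w w'" using mark_pair_both_rho[OF J] by blast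
    then show ?thesis using rho_antimono[of "Suc m" "k + K" w w' k] by (simp add: both_rho_def)
  next
    case Aend
    then obtain c z z' where "mark_pair K u v z c w z' w'"
      using A by (auto simp: cut_after_def)
    then have "both_rho (Suc m) (k + K) w w'" using mark_pair_both_rho[OF J] by blast
    then show ?thesis using rho_antimono[of "Suc m" "k + K" w w' k] by (simp add: both_rho_def)
  next
    case AB
    obtain z1 c1 z1' where 1: "x = z1 @ [c1]" "x' = z1' @ [c1]" "mark_pair K u v z1 c1 (w @ y) z1' (w' @ y')"
      using A AB unfolding cut_after_def by blast
    obtain c2 z2 z2' where 2: "y = c2 # z2" "y' = c2 # z2'" "mark_pair K u v (x @ w) c2 z2 (x' @ w') z2'"
      using B AB unfolding cut_before_def by blast
    have J1: "both_rho (Suc m) (k + K) (w @ y) (w' @ y')" using mark_pair_both_rho[OF J 1(3)] by blast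
    have J2: "both_rho (Suc m) (k + K) (x @ w) (x' @ w')" using mark_pair_both_rho[OF J 2(3)] by blast
    from J 2(3) show ?thesis
    proof (cases rule: mark_pair_cases)
      \<comment> \<open>The search for the right end starts at the beginning of the word, not at the
        gap. \<open>lmark_split\<close> discards the part of \<open>a\<close> already read in
        \<open>x\<close>.\<close>
      case (left a)
      have J': "both_rho (Suc (Suc m)) (K + K) u v"
        using both_rho_antimono[OF J] by simp
      have "subseq_eq K z1 z1'" using mark_pair_subseq_eq[OF J' 1(3)] by blast
      then have "subseq_eq K x x'" unfolding 1(1,2) by (rule subseq_eq_snoc)
      then have "subseq t x \<longleftrightarrow> subseq t x'" if "length t \<le> length a" for t
        using that left(1) by (simp add: subseq_eq_def)
      then obtain b where b: "length b \<le> length a" "lmark b w c2" "lmark b w' c2"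
        using lmark_split[OF _ left(2,3)] by blast
      have "rho (Suc m) (k + K) (w @ c2 # z2) (w' @ c2 # z2')"
        using J1 2(1,2) by (simp add: both_rho_def)
      then show ?thesis
        using rho_lmark[OF _ b(2,3)] b(1) left(1) by fastforce
    next
      case (right b2)
      note b2 = right
      from J 1(3) show ?thesis
      proof (cases rule: mark_pair_cases)
        \<comment> \<open>The right end is removed already by \<open>J2\<close>; the search for the
          left end from the left is not affected by that.\<close>
        case (left a)
        have "rho (Suc m) (k + K) (z1 @ c1 # w) (z1' @ c1 # w')"
          using J2 1(1,2) by (simp add: both_rho_def)
        then show ?thesis using rho_lmark[OF _ left(2,3,1)] by blast
      next
        \<comment> \<open>Both searches run from the right, so both ends are removed at level
          \<open>Suc (Suc m)\<close> for the reversed words. Only \<open>rho_Suc_rev\<close> costs a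
          level.\<close>
        case (right b1)
        have "rho (Suc (Suc m)) (k + K) (rev z2 @ c2 # rev w) (rev z2' @ c2 # rev w')"
          using right(5) 2(1,2) by simp
        from rho_lmark[OF this b2(2,3,1)] have "rho (Suc (Suc m)) k (rev w) (rev w')" by blast
        from rho_Suc_rev[OF this] show ?thesis by simp
      qed
    qed
  qed
qed

lemma gap_both_rho:
  assumes J: "both_rho (Suc (Suc m)) (k + K + K) u v"
    and A: "cut_after K u v x (w @ y) x' (w' @ y')"
    and B: "cut_before K u v (x @ w) y (x' @ w') y'"
  shows "both_rho (Suc m) k w w'"
proof -
  have "rho (Suc m) k (rev w) (rev w')"
  proof (rule gap_rho[of m k K "rev u" "rev v"])
    show "both_rho (Suc (Suc m)) (k + K + K) (rev u) (rev v)" using J by (simp add: both_rho_rev)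
    show "cut_after K (rev u) (rev v) (rev y) (rev w @ rev x) (rev y') (rev w' @ rev x')"
      using cut_before_rev[OF B] by simp
    show "cut_before K (rev u) (rev v) (rev y @ rev w) (rev x) (rev y' @ rev w') (rev x')"
      using cut_after_rev[OF A] by simp
  qed
  then show ?thesis using gap_rho[OF assms] by (simp add: both_rho_def)
qed

section \<open>Evaluating words in a monoid\<close>

definition wprod :: "('a, 'b) monoid_scheme \<Rightarrow> 'a list \<Rightarrow> 'a" where
  "wprod M u = foldr (\<lambda>x y. x \<otimes>\<^bsub>M\<^esub> y) u \<one>\<^bsub>M\<^esub>"

lemma wprod_Nil [simp]: "wprod M [] = \<one>\<^bsub>M\<^esub>" and wprod_Cons [simp]: "wprod M (x # u) = x \<otimes>\<^bsub>M\<^esub> wprod M u"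
  by (simp_all add: wprod_def)

context monoid
begin

lemma wprod_closed [simp]: "set u \<subseteq> carrier G \<Longrightarrow> wprod G u \<in> carrier G"
  by (induction u) auto

lemma wprod_append: "set u \<subseteq> carrier G \<Longrightarrow> set v \<subseteq> carrier G \<Longrightarrow> wprod G (u @ v) = wprod G u \<otimes> wprod G v"
  by (induction u) (auto simp: m_assoc)

lemma wprod_opp_rev: "set u \<subseteq> carrier G \<Longrightarrow> wprod (opp G) (rev u) = wprod G u"
proof (induction u)
  case (Cons x u)
  then show ?case
    using monoid.wprod_append[OF monoid_opp[OF monoid_axioms], of "rev u" "[x]"] by simp
qed simp

end

section \<open>Stability under words in DA\<close>

context finite_monoid
begin

text \<open>Here DA enters. The loop \<open>z w\<close> fixes \<open>s w\<close>, and
  \<open>d\<close> is a factor of its idempotent power \<open>e\<close>. So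
  \<open>e d e = e\<close>, and reading \<open>d\<close> and then \<open>e\<close> brings
  \<open>s w\<close> back.\<close>

lemma rstab_letter:
  assumes DA: "is_DA M" and s: "s \<in> carrier M" and w: "set w \<subseteq> carrier M"
    and st: "rstab M s (wprod M w)" and d: "d \<in> set w"
  shows "rstab M (s \<otimes> wprod M w) d"
proof -
  obtain p r where pr: "w = p @ d # r" using d by (meson split_list)
  have c: "wprod M p \<in> carrier M" "d \<in> carrier M" "wprod M r \<in> carrier M" "wprod M w \<in> carrier M"
    using w pr by auto
  have eq: "wprod M w = wprod M p \<otimes> (d \<otimes> wprod M r)" using w pr by (simp add: wprod_append)
  obtain z where z: "z \<in> carrier M" "s \<otimes> wprod M w \<otimes> z = s" using st by (auto simp: rstab_def)
  have "s \<otimes> wprod M w \<otimes> (z \<otimes> wprod M w) = s \<otimes> wprod M w \<otimes> z \<otimes> wprod M w"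
    using s c z(1) by (simp add: m_assoc)
  then have fx: "s \<otimes> wprod M w \<otimes> (z \<otimes> wprod M w) = s \<otimes> wprod M w" using z(2) by simp
  have "s \<otimes> wprod M w \<in> carrier M" "z \<otimes> wprod M w \<in> carrier M" using s c z by auto
  then obtain e v where e: "e \<in> carrier M" "e \<otimes> e = e" "s \<otimes> wprod M w \<otimes> e = s \<otimes> wprod M w"
    "v \<in> carrier M" "e = z \<otimes> wprod M w \<otimes> v" "e = v \<otimes> (z \<otimes> wprod M w)"
    by (rule idempotent_fixing[OF _ _ fx])
  have "e \<otimes> d \<otimes> e = e"
  proof (rule is_DAD[OF DA])
    show "(z \<otimes> wprod M p) \<otimes> d \<otimes> (wprod M r \<otimes> v) = e"
      unfolding e(5) eq using c(1-3) z(1) e(4) by (simp add: m_assoc)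
  qed (use e c z in auto)
  moreover have "s \<otimes> wprod M w \<otimes> d \<otimes> e = s \<otimes> wprod M w \<otimes> e \<otimes> d \<otimes> e" using e(3) by simp
  moreover have "\<dots> = s \<otimes> wprod M w \<otimes> (e \<otimes> d \<otimes> e)" using s c(2,4) e(1) by (simp add: m_assoc)
  ultimately have "s \<otimes> wprod M w \<otimes> d \<otimes> e = s \<otimes> wprod M w" using e(3) by simp
  then show ?thesis unfolding rstab_def using e(1) by blast
qed

text \<open>A further letter \<open>c\<close>, stable at \<open>s\<close>, is stable at
  \<open>s w\<close> too, because a loop at \<open>s w\<close> can be led through \<open>s\<close>
  and \<open>c\<close>. Thus all words over the letters of a gap are covered at once.\<close>

lemma rstab_word:
  assumes DA: "is_DA M" and s: "s \<in> carrier M" and w: "set w \<subseteq> carrier M"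
    and st: "\<And>d. d \<in> set w \<Longrightarrow> rstab M s d"
  shows "rstab M s (wprod M w)"
  using w st
proof (induction w rule: rev_induct)
  case Nil
  show ?case unfolding rstab_def using s by (intro bexI[of _ "\<one>"]) auto
next
  case (snoc c w)
  then have c: "set w \<subseteq> carrier M" "wprod M w \<in> carrier M" "c \<in> carrier M" by auto
  obtain y where y: "y \<in> carrier M" "s \<otimes> wprod M w \<otimes> y = s"
    using snoc by (auto simp: rstab_def)
  obtain d where d: "d \<in> carrier M" "s \<otimes> c \<otimes> d = s"
    using snoc.prems(2)[of c] by (auto simp: rstab_def)
  let ?q = "s \<otimes> wprod M w"
  have q: "?q \<in> carrier M" using s c by simp
  \<comment> \<open>From \<open>s w\<close> this word returns to \<open>s\<close> by
    \<open>y\<close>, reads \<open>c\<close>, comes back by \<open>d\<close> and reads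
    \<open>w\<close> again. It fixes \<open>s w\<close> and contains \<open>c\<close>, so
    \<open>rstab_letter\<close> applies.\<close>
  have W: "wprod M ([y, c, d] @ w) = y \<otimes> (c \<otimes> (d \<otimes> wprod M w))"
    using y d c by (simp add: m_assoc)
  then have "?q \<otimes> wprod M ([y, c, d] @ w) = ?q \<otimes> y \<otimes> c \<otimes> d \<otimes> wprod M w"
    using s c y(1) d(1) by (simp add: m_assoc)
  then have fx: "?q \<otimes> wprod M ([y, c, d] @ w) = ?q" using y(2) d(2) by simp
  have "rstab M (?q \<otimes> wprod M ([y, c, d] @ w)) c"
  proof (rule rstab_letter[OF DA q])
    show "rstab M ?q (wprod M ([y, c, d] @ w))"
      unfolding rstab_def fx using q by (intro bexI[of _ "\<one>"]) simp_all
  qed (use c y d in auto)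
  then obtain z where z: "z \<in> carrier M" "?q \<otimes> c \<otimes> z = ?q" unfolding fx by (auto simp: rstab_def)
  have "s \<otimes> wprod M (w @ [c]) \<otimes> (z \<otimes> y) = ?q \<otimes> c \<otimes> z \<otimes> y"
    using s c y(1) z(1) by (simp add: wprod_append m_assoc)
  also have "\<dots> = s" using z(2) y(2) by simp
  finally show ?case unfolding rstab_def using z(1) y(1) by blast
qed

text \<open>The word \<open>a\<close> consists of the letters at which a prefix of \<open>x\<close> leaves its \<open>\<R>\<close>-class. It is short
  because the right ideal generated by the prefix shrinks at each of them.\<close>

lemma descent_lmark:
  assumes DA: "is_DA M" and x: "set x \<subseteq> carrier M" and c: "c \<in> carrier M"
    and desc: "\<not> rstab M (wprod M x) c"
  obtains a where "length a < card (carrier M)" "lmark a x c"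
proof -
  define I where "I s = (\<lambda>z. s \<otimes> z) ` carrier M" for s
  have finI: "finite (I s)" for s using fin by (simp add: I_def)
  have I_self: "s \<in> I s" if "s \<in> carrier M" for s
    unfolding I_def using that by (intro image_eqI[of _ _ "\<one>"]) auto
  have I_sub: "I (s \<otimes> d) \<subseteq> I s" if sd: "s \<in> carrier M" "d \<in> carrier M" for s d
  proof
    fix v assume "v \<in> I (s \<otimes> d)"
    then obtain z where "z \<in> carrier M" "v = s \<otimes> (d \<otimes> z)" using sd by (auto simp: I_def m_assoc)
    then show "v \<in> I s" unfolding I_def using sd by blast
  qed
  \<comment> \<open>\<open>x1\<close> ends at the last descent and \<open>x2\<close> is the tail
    read since then within one \<open>\<R>\<close>-class. The clause on \<open>a @ [c]\<close> says
    that the greedy search for \<open>a\<close> ends exactly where \<open>x1\<close> ends; each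
    letter of \<open>a\<close> is paid for by a loss in the right ideal.\<close>
  have "\<exists>a x1 x2. x = x1 @ x2 \<and> subseq a x \<and> (\<forall>c. subseq (a @ [c]) x \<longleftrightarrow> c \<in> set x2) \<and>
    rstab M (wprod M x1) (wprod M x2) \<and> length a + card (I (wprod M x)) \<le> card (carrier M)"
    using x
  proof (induction x rule: rev_induct)
    case Nil
    have "rstab M \<one> \<one>" unfolding rstab_def by (intro bexI[of _ "\<one>"]) auto
    moreover have "card (I \<one>) \<le> card (carrier M)" unfolding I_def using fin by (rule card_image_le)
    ultimately show ?case by (intro exI[of _ "[]"]) simp
  next
    case (snoc d x)
    then obtain a x1 x2 where *: "x = x1 @ x2" "subseq a x" "\<And>c. subseq (a @ [c]) x \<longleftrightarrow> c \<in> set x2"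
      "rstab M (wprod M x1) (wprod M x2)" "length a + card (I (wprod M x)) \<le> card (carrier M)"
      by auto
    have cl: "d \<in> carrier M" "set x1 \<subseteq> carrier M" "set x2 \<subseteq> carrier M" "wprod M x \<in> carrier M"
      using snoc.prems *(1) by auto
    have xx: "wprod M x = wprod M x1 \<otimes> wprod M x2" using cl *(1) by (simp add: wprod_append)
    have xd: "wprod M (x @ [d]) = wprod M x \<otimes> d" using cl snoc.prems by (simp add: wprod_append)
    have sub: "I (wprod M (x @ [d])) \<subseteq> I (wprod M x)" unfolding xd using I_sub cl by blast
    show ?case
    proof (cases "rstab M (wprod M x) d")
      case True
      then obtain y where y: "y \<in> carrier M" "wprod M x \<otimes> d \<otimes> y = wprod M x" by (auto simp: rstab_def)
      obtain z where z: "z \<in> carrier M" "wprod M x1 \<otimes> wprod M x2 \<otimes> z = wprod M x1"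
        using *(4) by (auto simp: rstab_def)
      have "wprod M x1 \<otimes> wprod M (x2 @ [d]) \<otimes> (y \<otimes> z) = wprod M x \<otimes> d \<otimes> y \<otimes> z"
        unfolding xx using cl y(1) z(1) by (simp add: wprod_append m_assoc)
      also have "\<dots> = wprod M x1" unfolding y(2) using z(2) xx by simp
      finally have "rstab M (wprod M x1) (wprod M (x2 @ [d]))"
        unfolding rstab_def using y(1) z(1) by blast
      moreover have "\<forall>c. subseq (a @ [c]) (x @ [d]) \<longleftrightarrow> c \<in> set (x2 @ [d])"
        using *(2,3) by (auto simp: subseq_snoc)
      moreover have "card (I (wprod M (x @ [d]))) \<le> card (I (wprod M x))"
        by (rule card_mono[OF finI sub])
      then have "length a + card (I (wprod M (x @ [d]))) \<le> card (carrier M)" using *(5) by linarith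
      moreover have "subseq a (x @ [d])" using *(2) by (rule subseq_rev_drop_many)
      moreover have "x @ [d] = x1 @ x2 @ [d]" using *(1) by simp
      ultimately show ?thesis by blast
    next
      case False
      \<comment> \<open>In DA a letter of the tail can be read again without leaving the class. So a
        descending letter is new to the tail, and the search for \<open>a @ [d]\<close> ends exactly
        here.\<close>
      then have "d \<notin> set x2"
        using rstab_letter[OF DA _ cl(3) *(4)] cl(2) unfolding xx by auto
      then have na: "\<not> subseq (a @ [d]) x" using *(3) by simp
      have "\<not> subseq ((a @ [d]) @ [c]) (x @ [d])" for c
      proof (rule notI)
        assume "subseq ((a @ [d]) @ [c]) (x @ [d])"
        then have "subseq ((a @ [d]) @ [c]) x \<or> subseq (a @ [d]) x" unfolding subseq_snoc by blast
        moreover have "subseq (a @ [d]) ((a @ [d]) @ [c])" by (rule subseq_rev_drop_many) simp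
        ultimately show False using na subseq_order.order_trans by blast
      qed
      moreover have "subseq (a @ [d]) (x @ [d])" using *(2) by (simp add: subseq_snoc)
      moreover have "card (I (wprod M (x @ [d]))) < card (I (wprod M x))"
      proof (rule psubset_card_mono[OF finI])
        have "wprod M x \<notin> I (wprod M (x @ [d]))"
          using False unfolding xd I_def rstab_def by auto
        then show "I (wprod M (x @ [d])) \<subset> I (wprod M x)" using sub I_self[OF cl(4)] by blast
      qed
      moreover have "rstab M (wprod M (x @ [d])) (wprod M [])"
        unfolding rstab_def xd using cl by (intro bexI[of _ "\<one>"]) auto
      moreover have "length (a @ [d]) = Suc (length a)" by simp
      ultimately have "x @ [d] = (x @ [d]) @ []" "subseq (a @ [d]) (x @ [d])"
        "\<forall>c. subseq ((a @ [d]) @ [c]) (x @ [d]) \<longleftrightarrow> c \<in> set []"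
        "rstab M (wprod M (x @ [d])) (wprod M [])"
        "length (a @ [d]) + card (I (wprod M (x @ [d]))) \<le> card (carrier M)"
        using *(5) by simp_all
      then show ?thesis by blast
    qed
  qed
  then obtain a x1 x2 where *: "x = x1 @ x2" "subseq a x" "\<And>c. subseq (a @ [c]) x \<longleftrightarrow> c \<in> set x2"
      "rstab M (wprod M x1) (wprod M x2)" "length a + card (I (wprod M x)) \<le> card (carrier M)"
    by blast
  have cl: "set x1 \<subseteq> carrier M" "set x2 \<subseteq> carrier M" "wprod M x \<in> carrier M" using x *(1) by auto
  have xx: "wprod M x = wprod M x1 \<otimes> wprod M x2" using cl *(1) by (simp add: wprod_append)
  have "c \<notin> set x2" using rstab_letter[OF DA _ cl(2) *(4)] cl(1) desc unfolding xx by auto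
  then have "lmark a x c" using *(2,3) by (simp add: lmark_def)
  \<comment> \<open>This makes the bound on \<open>length a\<close> strict, as
    \<open>mark_pair\<close> requires.\<close>
  moreover have "card (I (wprod M x)) > 0"
    using finI I_self[OF cl(3)] by (metis card_gt_0_iff empty_iff)
  ultimately show thesis using that[of a] *(5) by simp
qed

text \<open>If a letter \<open>d\<close> of the gap left the \<open>\<R>\<close>-class of
  \<open>X'\<close>, then \<open>descent_lmark\<close> would give a short search whose end is the
  next \<open>d\<close>: a mark inside the gap. The search transfers from \<open>X'\<close> to
  \<open>X\<close>, as it involves only subsequences of length at most
  \<open>card (carrier M)\<close>.\<close>

lemma gap_stable:
  assumes DA: "is_DA M" and X': "set X' \<subseteq> carrier M" and w: "set w \<union> set w' \<subseteq> carrier M"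
    and eq: "subseq_eq (card (carrier M)) X X'"
    and no: "\<And>a w1 d w2. w = w1 @ d # w2 \<Longrightarrow> length a < card (carrier M) \<Longrightarrow> \<not> lmark a (X @ w1) d"
    and no': "\<And>a w1 d w2. w' = w1 @ d # w2 \<Longrightarrow> length a < card (carrier M) \<Longrightarrow> \<not> lmark a (X' @ w1) d"
    and z: "set z \<subseteq> set w \<union> set w'"
  shows "rstab M (wprod M X') (wprod M z)"
proof (rule rstab_word[OF DA])
  show "wprod M X' \<in> carrier M" "set z \<subseteq> carrier M" using X' w z by auto
  fix d assume "d \<in> set z"
  then have d: "d \<in> set w \<union> set w'" "d \<in> carrier M" using z w by auto
  show "rstab M (wprod M X') d"
  proof (rule ccontr)
    assume "\<not> rstab M (wprod M X') d"
    then obtain a where a: "length a < card (carrier M)" "lmark a X' d"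
      using descent_lmark[OF DA X' d(2)] by blast
    show False
    proof (cases "d \<in> set w'")
      case True
      then obtain w1 w2 where w1: "w' = w1 @ d # w2" "d \<notin> set w1" by (meson split_list_first)
      then show False using no'[OF w1(1) a(1)] lmark_extend[OF a(2) w1(2)] by blast
    next
      case False
      then have "d \<in> set w" using d by simp
      then obtain w1 w2 where w1: "w = w1 @ d # w2" "d \<notin> set w1" by (meson split_list_first)
      moreover have "lmark a X d" using a eq by (simp add: lmark_def subseq_eq_def)
      ultimately show False using no[OF w1(1) a(1)] lmark_extend[OF _ w1(2)] by blast
    qed
  qed
qed

end

text \<open>The bound \<open>B\<close> is carried along because the intermediate words of a chain
  inside a gap may use only letters of that gap, or stability would fail for them.\<close>

definition word_step :: "('a, 'b) monoid_scheme \<Rightarrow> nat \<Rightarrow> 'a set \<Rightarrow> ('a list \<times> 'a list) set" where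
  "word_step M m B = {(z, z'). set z \<subseteq> B \<and> set z' \<subseteq> B \<and> (wprod M z, wprod M z') \<in> stable_pairs M m}"

lemma cut_before_swap: "cut_before K u v x y x' y' \<Longrightarrow> cut_before K v u x' y' x y"
proof -
  assume A: "cut_before K u v x y x' y'"
  then consider "y = []" "y' = []" | c z z' where "y = c # z" "y' = c # z'" "mark_pair K u v x c z x' z'"
    unfolding cut_before_def by blast
  then show ?thesis
  proof cases
    case 2
    from mark_pair_swap[OF this(3)] show ?thesis using A 2(1,2) unfolding cut_before_def by blast
  qed (use A in \<open>simp add: cut_before_def\<close>)
qed

lemma cut_before_less_iff:
  assumes J: "both_rho (Suc m) (K + K) u v"
    and 1: "mark_pair K u v x1 c1 y1 x1' y1'" and 2: "cut_before K u v x y x' y'"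
  shows "length x1' < length x' \<longleftrightarrow> length x1 < length x"
proof (cases "y = []")
  case True
  then have "x = u" "x' = v" using 2 by (auto simp: cut_before_def)
  then show ?thesis using 1 by (auto simp: mark_pair_def)
next
  case False
  then obtain c z z' where "mark_pair K u v x c z x' z'"
    using 2 unfolding cut_before_def by blast
  then show ?thesis using mark_pair_less_iff[OF J 1] by blast
qed

lemma cut_after_subseq_eq:
  assumes "both_rho (Suc m) (K + K) u v" "cut_after K u v x y x' y'"
  shows "subseq_eq K x x'"
  using assms(2) mark_pair_subseq_eq[OF assms(1)] subseq_eq_snoc
  unfolding cut_after_def by (metis subseq_eq_def)

lemma (in finite_monoid) gap_stable_left:
  assumes DA: "is_DA M" and K: "K = card (carrier M)"
    and uv: "set u \<union> set v \<subseteq> carrier M" and J: "both_rho (Suc m) (K + K) u v"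
    and A: "cut_after K u v x (w @ y) x' (w' @ y')"
    and no: "\<And>p c q p' q'. mark_pair K u v p c q p' q' \<Longrightarrow>
      \<not> (length x \<le> length p \<and> length p < length (x @ w)) \<and>
      \<not> (length x' \<le> length p' \<and> length p' < length (x' @ w'))"
    and z: "set z \<subseteq> set w \<union> set w'"
  shows "rstab M (wprod M x') (wprod M z)"
proof -
  have u: "u = x @ w @ y" and v: "v = x' @ w' @ y'" using A by (auto simp: cut_after_def)
  show ?thesis
  proof (rule gap_stable[OF DA _ _ _ _ _ z])
    show "set x' \<subseteq> carrier M" "set w \<union> set w' \<subseteq> carrier M" using uv u v by auto
    show "subseq_eq (card (carrier M)) x x'" using cut_after_subseq_eq[OF J A] K by simp
    fix a w1 w2 :: "'a list" and d :: 'a assume "length a < card (carrier M)"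
    then have a: "length a < K" using K by simp
    show "\<not> lmark a (x @ w1) d" if we: "w = w1 @ d # w2"
    proof
      assume "lmark a (x @ w1) d"
      then obtain p' q' where "mark_pair K u v (x @ w1) d (w2 @ y) p' q'"
        using mark_pair_exists[OF J _ a, of "x @ w1" d "w2 @ y"] u we by auto
      from no[OF this] show False using we by simp
    qed
    show "\<not> lmark a (x' @ w1) d" if we: "w' = w1 @ d # w2"
    proof
      assume "lmark a (x' @ w1) d"
      then obtain p q where "mark_pair K v u (x' @ w1) d (w2 @ y') p q"
        using mark_pair_exists[OF both_rho_sym[OF J] _ a, of "x' @ w1" d "w2 @ y'"] v we by auto
      from no[OF mark_pair_swap[OF this]] show False using we by simp
    qed
  qed
qed

lemma (in finite_monoid) gap_stable_right:
  assumes DA: "is_DA M" and K: "K = card (carrier M)"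
    and uv: "set u \<union> set v \<subseteq> carrier M" and J: "both_rho (Suc m) (K + K) u v"
    and A: "cut_after K u v x (w @ y) x' (w' @ y')"
    and B: "cut_before K u v (x @ w) y (x' @ w') y'"
    and no: "\<And>p c q p' q'. mark_pair K u v p c q p' q' \<Longrightarrow>
      \<not> (length x \<le> length p \<and> length p < length (x @ w)) \<and>
      \<not> (length x' \<le> length p' \<and> length p' < length (x' @ w'))"
    and z: "set z \<subseteq> set w \<union> set w'"
  shows "lstab M (wprod M z) (wprod M y)"
proof -
  interpret op: finite_monoid "opp M" by (rule finite_monoid_opp) unfold_locales
  have u: "u = x @ w @ y" and v: "v = x' @ w' @ y'" using A by (auto simp: cut_after_def)
  have "rstab (opp M) (wprod (opp M) (rev y)) (wprod (opp M) (rev z))"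
  \<comment> \<open>Reversal makes the suffix a prefix. \<open>u\<close> and \<open>v\<close> change
    places because the suffix needed is that of \<open>u\<close>, whereas
    \<open>gap_stable_left\<close> speaks of the prefix of its second word.\<close>
  proof (rule op.gap_stable_left[of K "rev v" "rev u" m "rev y'" "rev w'" "rev x'" "rev y" "rev w" "rev x"])
    show "is_DA (opp M)" using is_DA_opp[OF monoid_axioms DA] .
    show "both_rho (Suc m) (K + K) (rev v) (rev u)" using both_rho_sym[OF J] by (simp add: both_rho_rev)
    show "cut_after K (rev v) (rev u) (rev y') (rev w' @ rev x') (rev y) (rev w @ rev x)"
      using cut_before_rev[OF cut_before_swap[OF B]] by simp
    fix p c q p' q' assume "mark_pair K (rev v) (rev u) p c q p' q'"
    then have mp: "mark_pair K u v (rev q') c (rev p') (rev q) (rev p)"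
      using mark_pair_rev mark_pair_swap by fastforce
    then have "length u = length q' + 1 + length p'" "length v = length q + 1 + length p"
      by (auto simp: mark_pair_def)
    then show "\<not> (length (rev y') \<le> length p \<and> length p < length (rev y' @ rev w')) \<and>
      \<not> (length (rev y) \<le> length p' \<and> length p' < length (rev y @ rev w))"
      using no[OF mp] u v by auto
  qed (use K uv z in auto)
  moreover have "set z \<subseteq> carrier M" "set y \<subseteq> carrier M" using uv u v z by auto
  ultimately show ?thesis using wprod_opp_rev[of y] wprod_opp_rev[of z] by simp
qed

text \<open>A gap agrees one level lower with \<open>2 * K\<close> less, hence the budget
  \<open>2 * m * K\<close>. Level 0 demands nothing, as all pairs have level 0.\<close>

lemma (in finite_monoid) word_chain:
  assumes DA: "is_DA M" and K: "K = card (carrier M)"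
    and "m = 0 \<or> both_rho m (2 * m * K) u v" "set u \<union> set v \<subseteq> B" "B \<subseteq> carrier M"
  shows "(u, v) \<in> (word_step M m B)\<^sup>*"
  using assms(3-5)
proof (induction m arbitrary: u v B)
  case 0
  then have "set u \<subseteq> carrier M" "set v \<subseteq> carrier M" by auto
  then show ?case using 0 by (intro r_into_rtrancl) (simp add: word_step_def)
next
  case (Suc m)
  have J0: "both_rho (Suc m) (2 * Suc m * K) u v" using Suc.prems by simp
  then have J: "both_rho (Suc m) (K + K) u v" by (rule both_rho_antimono) simp
  have uv: "set u \<union> set v \<subseteq> carrier M" using Suc.prems by blast
  have gap: "(x' @ w @ y, x' @ w' @ y) \<in> (word_step M (Suc m) B)\<^sup>*"
    if A: "cut_after K u v x (w @ y) x' (w' @ y')"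
      and B: "cut_before K u v (x @ w) y (x' @ w') y'"
      and no: "\<And>p c q p' q'. mark_pair K u v p c q p' q' \<Longrightarrow>
        \<not> (length x \<le> length p \<and> length p < length (x @ w)) \<and>
        \<not> (length x' \<le> length p' \<and> length p' < length (x' @ w'))"
    for x w y x' w' y'
  proof -
    have u: "u = x @ w @ y" and v: "v = x' @ w' @ y'" using A by (auto simp: cut_after_def)
    let ?W = "set w \<union> set w'"
    have "(w, w') \<in> (word_step M m ?W)\<^sup>*"
    proof (rule Suc.IH)
      show "m = 0 \<or> both_rho m (2 * m * K) w w'"
      proof (cases m)
        case (Suc n)
        have "both_rho (Suc (Suc n)) (2 * m * K + K + K) u v"
          using J0 Suc by (simp add: algebra_simps)
        then show ?thesis using gap_both_rho[OF _ A B] Suc by blast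
      qed simp
    qed (use uv u v in auto)
    then show ?thesis
    proof (induction rule: rtrancl_induct)
      case (step z z')
      have zz: "set z \<subseteq> ?W" "set z' \<subseteq> ?W" "(wprod M z, wprod M z') \<in> stable_pairs M m"
        using step.hyps(2) by (auto simp: word_step_def)
      have c: "set x' \<subseteq> carrier M" "set y \<subseteq> carrier M" "set z \<subseteq> carrier M" "set z' \<subseteq> carrier M"
        using uv u v zz by auto
      \<comment> \<open>Both \<open>z\<close> and \<open>z'\<close> use only letters of the gap, so
        they are stable between the prefix \<open>x'\<close> of \<open>v\<close> and the suffix
        \<open>y\<close> of \<open>u\<close>. A step of level \<open>m\<close> thus becomes one of
        level \<open>Suc m\<close>.\<close>
      have "(wprod M x' \<otimes> wprod M z \<otimes> wprod M y, wprod M x' \<otimes> wprod M z' \<otimes> wprod M y) \<in> stable_pairs M (Suc m)"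
        using c zz gap_stable_left[OF DA K uv J A no] gap_stable_right[OF DA K uv J A B no]
        unfolding stable_pairs.simps mem_Collect_eq
        by (intro exI[of _ "wprod M x'"] exI[of _ "wprod M z"] exI[of _ "wprod M z'"] exI[of _ "wprod M y"]) simp
      then have "(x' @ z @ y, x' @ z' @ y) \<in> word_step M (Suc m) B"
        using c zz(1,2) Suc.prems(2) u v by (auto simp: word_step_def wprod_append m_assoc simp del: stable_pairs.simps)
      then show ?case using step.IH by (rule rtrancl_into_rtrancl[rotated])
    qed simp
  qed
  \<comment> \<open>At each cut, everything before it has been replaced by the corresponding part of
    \<open>v\<close>. The cut at the end of the words gives the claim.\<close>
  have "(u, x' @ y) \<in> (word_step M (Suc m) B)\<^sup>*" if "cut_before K u v x y x' y'" for x y x' y'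
    using that
  proof (induction "length x" arbitrary: x y x' y' rule: less_induct)
    case less
    \<comment> \<open>\<open>Max S\<close> is the last marked position before the cut, so no mark
      lies between them. If there is none, the gap begins at the start of the words.\<close>
    define S where "S = {length p | p c q p' q'. mark_pair K u v p c q p' q' \<and> length p < length x}"
    have fS: "finite S" by (rule finite_subset[of _ "{..<length x}"]) (auto simp: S_def)
    have ux: "u = x @ y" "v = x' @ y'" using less.prems by (auto simp: cut_before_def)
    show ?case
    proof (cases "S = {}")
      case True
      have "(([] :: 'a list) @ x @ y, [] @ x' @ y) \<in> (word_step M (Suc m) B)\<^sup>*"
      proof (rule gap[of "[]" x y "[]" x' y'])
        show "cut_after K u v [] (x @ y) [] (x' @ y')" using ux by (simp add: cut_after_def)
        show "cut_before K u v ([] @ x) y ([] @ x') y'" using less.prems by simp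
        fix p c q p' q' assume mp: "mark_pair K u v p c q p' q'"
        then have "\<not> length p < length x" using True unfolding S_def by blast
        then show "\<not> (length ([] :: 'a list) \<le> length p \<and> length p < length ([] @ x)) \<and>
          \<not> (length ([] :: 'a list) \<le> length p' \<and> length p' < length ([] @ x'))"
          using cut_before_less_iff[OF J mp less.prems] by simp
      qed
      then show ?thesis using ux by simp
    next
      case False
      then have "Max S \<in> S" using fS by simp
      then have "\<exists>p c q p' q'. Max S = length p \<and> mark_pair K u v p c q p' q' \<and> length p < length x"
        by (subst (asm) (2) S_def) simp
      then obtain p c q p' q' where mp: "mark_pair K u v p c q p' q'" and lp: "length p < length x"
        and max: "length p = Max S" by metis
      have pq: "u = p @ c # q" "v = p' @ c # q'" using mp by (auto simp: mark_pair_def)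
      have lp': "length p' < length x'" using cut_before_less_iff[OF J mp less.prems] lp by simp
      obtain w where w: "x = p @ c # w" "q = w @ y"
        using lp ux(1) pq(1) by (auto simp: append_eq_append_conv2 Cons_eq_append_conv)
      obtain w' where w': "x' = p' @ c # w'" "q' = w' @ y'"
        using lp' ux(2) pq(2) by (auto simp: append_eq_append_conv2 Cons_eq_append_conv)
      have "cut_before K u v p (c # q) p' (c # q')" using mp pq by (auto simp: cut_before_def)
      then have 1: "(u, p' @ c # q) \<in> (word_step M (Suc m) B)\<^sup>*" using less.hyps[OF lp] by blast
      have "((p' @ [c]) @ w @ y, (p' @ [c]) @ w' @ y) \<in> (word_step M (Suc m) B)\<^sup>*"
      proof (rule gap[of "p @ [c]" w y "p' @ [c]" w' y'])
        show "cut_after K u v (p @ [c]) (w @ y) (p' @ [c]) (w' @ y')"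
          using mp pq w w' by (auto simp: cut_after_def)
        show "cut_before K u v ((p @ [c]) @ w) y ((p' @ [c]) @ w') y'" using less.prems w w' by simp
        fix p1 c1 q1 p1' q1' assume mp1: "mark_pair K u v p1 c1 q1 p1' q1'"
        have "length p1 \<le> length p" if "length p1 < length x"
          unfolding max using fS mp1 that by (intro Max_ge) (unfold S_def, blast+)
        then show "\<not> (length (p @ [c]) \<le> length p1 \<and> length p1 < length ((p @ [c]) @ w)) \<and>
          \<not> (length (p' @ [c]) \<le> length p1' \<and> length p1' < length ((p' @ [c]) @ w'))"
          using cut_before_less_iff[OF J mp1 less.prems] mark_pair_less_iff[OF J mp mp1] w(1) w'(1) by auto
      qed
      then show ?thesis using 1 w w' by simp
    qed
  qed
  from this[of u "[]" v "[]"] show ?case by (simp add: cut_before_def)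
qed

section \<open>Quotients of free monoids in the hierarchy\<close>

definition words :: "'a set \<Rightarrow> 'a list monoid" where
  "words A = \<lparr>carrier = lists A, monoid.mult = (@), one = []\<rparr>"

lemma words_simps [simp]:
  "carrier (words A) = lists A" "u \<otimes>\<^bsub>words A\<^esub> v = u @ v" "\<one>\<^bsub>words A\<^esub> = []"
  by (simp_all add: words_def)

lemma monoid_words: "monoid (words A)"
  by (rule monoidI) auto

lemma word_quotient:
  assumes r: "word_congruence r" and fi: "finite_index A r"
  obtains Q \<psi> where "Q \<in> finite_monoids" "\<psi> \<in> epi (words A) Q"
    "\<And>u v. u \<in> lists A \<Longrightarrow> v \<in> lists A \<Longrightarrow> \<psi> u = \<psi> v \<longleftrightarrow> r u v"
proof -
  interpret word_congruence r by fact
  obtain f :: "'a list \<Rightarrow> nat" where f: "finite (f ` lists A)"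
    "\<And>u v. u \<in> lists A \<Longrightarrow> v \<in> lists A \<Longrightarrow> f u = f v \<Longrightarrow> r u v"
    using fi by (auto simp: finite_index_def)
  \<comment> \<open>The colouring \<open>f\<close> may separate equivalent words; the least colour
    in a class depends on the class alone.\<close>
  define \<psi> where "\<psi> u = (LEAST n. \<exists>v\<in>lists A. r u v \<and> f v = n)" for u
  have ex: "\<exists>v\<in>lists A. r u v \<and> f v = \<psi> u" if "u \<in> lists A" for u
    unfolding \<psi>_def using LeastI[of "\<lambda>n. \<exists>v\<in>lists A. r u v \<and> f v = n" "f u"] that refl by blast
  have ker: "\<psi> u = \<psi> v \<longleftrightarrow> r u v" if uv: "u \<in> lists A" "v \<in> lists A" for u v
  proof
    assume eq: "\<psi> u = \<psi> v"
    obtain u' where u': "u' \<in> lists A" "r u u'" "f u' = \<psi> u" using ex[OF uv(1)] by blast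
    obtain v' where v': "v' \<in> lists A" "r v v'" "f v' = \<psi> v" using ex[OF uv(2)] by blast
    have "r u' v'" using f(2)[OF u'(1) v'(1)] u'(3) v'(3) eq by simp
    then show "r u v" using trans[OF u'(2)] trans[OF _ sym[OF v'(2)]] by blast
  next
    assume "r u v"
    then have "r u w \<longleftrightarrow> r v w" for w using trans sym by blast
    then show "\<psi> u = \<psi> v" by (simp add: \<psi>_def)
  qed
  have "finite (\<psi> ` carrier (words A))"
  proof (rule finite_subset[OF _ f(1)])
    show "\<psi> ` carrier (words A) \<subseteq> f ` lists A"
    proof
      fix n assume "n \<in> \<psi> ` carrier (words A)"
      then obtain u where "u \<in> lists A" "n = \<psi> u" by auto
      then show "n \<in> f ` lists A" using ex[of u] by (metis imageI)
    qed
  qed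
  then obtain Q where "Q \<in> finite_monoids" "\<psi> \<in> epi (words A) Q"
  proof (rule monoid_epi_copy[OF monoid_words])
    fix x x' y y' assume "x \<in> carrier (words A)" "x' \<in> carrier (words A)" "y \<in> carrier (words A)"
      "y' \<in> carrier (words A)" "\<psi> x = \<psi> x'" "\<psi> y = \<psi> y'"
    then show "\<psi> (x \<otimes>\<^bsub>words A\<^esub> y) = \<psi> (x' \<otimes>\<^bsub>words A\<^esub> y')" using append ker by simp
  qed blast
  then show thesis using that ker by blast
qed

lemma epi_one:
  assumes M: "monoid M" and N: "monoid N" and h: "h \<in> epi M N"
  shows "h \<one>\<^bsub>M\<^esub> = \<one>\<^bsub>N\<^esub>"
proof -
  interpret M: monoid M by fact
  interpret N: monoid N by fact
  have hh: "h \<in> hom M N" "h ` carrier M = carrier N" using h by (auto simp: epi_def)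
  obtain x where x: "x \<in> carrier M" "h x = \<one>\<^bsub>N\<^esub>" using hh(2) N.one_closed by (metis imageE)
  have "h \<one>\<^bsub>M\<^esub> = h \<one>\<^bsub>M\<^esub> \<otimes>\<^bsub>N\<^esub> h x" using x hom_in_carrier[OF hh(1) M.one_closed] by simp
  also have "\<dots> = h (\<one>\<^bsub>M\<^esub> \<otimes>\<^bsub>M\<^esub> x)" using hom_mult[OF hh(1) M.one_closed x(1)] by simp
  finally show ?thesis using x by simp
qed

text \<open>Stability forces the letters of \<open>x\<close> into \<open>w\<close>, and a word
  representing an idempotent contains all short words over its letters. So jumps never leave
  \<open>w\<close>, and \<open>r\<close>-equivalent words behind it are interchangeable.\<close>

lemma Kexp_quotient_absorb:
  assumes r: "word_congruence r" and Q: "monoid Q" and \<psi>: "\<psi> \<in> epi (words A) Q"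
    and ker: "\<forall>u\<in>lists A. \<forall>v\<in>lists A. \<psi> u = \<psi> v \<longleftrightarrow> Kexp r k u v"
    and w: "w \<in> lists A" "\<psi> w \<otimes>\<^bsub>Q\<^esub> \<psi> w = \<psi> w"
    and st: "x \<in> lists A" "rstab Q (\<psi> w) (\<psi> x)"
  shows "set x \<subseteq> set w" and "y \<in> lists A \<Longrightarrow> r x y \<Longrightarrow> \<psi> w \<otimes>\<^bsub>Q\<^esub> \<psi> x = \<psi> w \<otimes>\<^bsub>Q\<^esub> \<psi> y"
proof -
  interpret word_congruence r by fact
  have hom: "\<psi> (u @ v) = \<psi> u \<otimes>\<^bsub>Q\<^esub> \<psi> v" if "u \<in> lists A" "v \<in> lists A" for u v
    using \<psi> that by (auto simp: epi_def hom_def)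
  have surj: "\<psi> ` lists A = carrier Q" using \<psi> by (simp add: epi_def)
  have "\<psi> (w @ w) = \<psi> w" using hom w by simp
  then have idem: "Kexp r k (w @ w) w" using ker w by simp
  obtain z where z: "z \<in> lists A" "\<psi> w \<otimes>\<^bsub>Q\<^esub> \<psi> x \<otimes>\<^bsub>Q\<^esub> \<psi> z = \<psi> w"
    using st(2) surj unfolding rstab_def by (metis imageE)
  have "\<psi> ((w @ x) @ z) = \<psi> w \<otimes>\<^bsub>Q\<^esub> \<psi> x \<otimes>\<^bsub>Q\<^esub> \<psi> z"
    using hom[of "w @ x" z] hom[of w x] w(1) st(1) z(1) by simp
  then have "Kexp r k ((w @ x) @ z) w" using ker w(1) st(1) z by simp
  then have "set ((w @ x) @ z) = set w" by (rule Kexp_alph)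
  then show sub: "set x \<subseteq> set w" by auto
  assume y: "y \<in> lists A" "r x y"
  have "Kexp r k (w @ x) (w @ y)"
    by (rule Kexp_absorb[OF y(2) sub order.refl]) (rule subseq_of_Kexp_idempotent[OF idem])
  then have "\<psi> (w @ x) = \<psi> (w @ y)" using ker w(1) st(1) y(1) by simp
  then show "\<psi> w \<otimes>\<^bsub>Q\<^esub> \<psi> x = \<psi> w \<otimes>\<^bsub>Q\<^esub> \<psi> y" using hom w(1) st(1) y(1) by simp
qed

lemma R_trivial_rho:
  assumes Q: "Q \<in> finite_monoids" and \<psi>: "\<psi> \<in> epi (words A) Q"
    and ker: "\<And>u v. u \<in> lists A \<Longrightarrow> v \<in> lists A \<Longrightarrow> \<psi> u = \<psi> v \<longleftrightarrow> rho 1 k u v"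
  shows "Q \<in> R_trivial_monoids"
  unfolding R_trivial_iff
proof (intro conjI ballI impI)
  interpret Q: finite_monoid Q using Q by (simp add: finite_monoids_iff)
  have hom: "\<psi> (u @ v) = \<psi> u \<otimes>\<^bsub>Q\<^esub> \<psi> v" if "u \<in> lists A" "v \<in> lists A" for u v
    using \<psi> that by (auto simp: epi_def hom_def)
  have surj: "\<psi> ` lists A = carrier Q" using \<psi> by (simp add: epi_def)
  let ?r = "\<lambda>u v :: 'a list. rho 0 k (rev u) (rev v)"
  have r: "word_congruence ?r" by (rule word_congruence_rev[OF word_congruence_rho])
  have ker': "\<forall>u\<in>lists A. \<forall>v\<in>lists A. \<psi> u = \<psi> v \<longleftrightarrow> Kexp ?r k u v"
    using ker by (simp only: One_nat_def rho.simps) blast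
  fix p s assume p: "p \<in> carrier Q" and s: "s \<in> carrier Q" and st: "rstab Q p s"
  obtain t where t: "t \<in> carrier Q" "p \<otimes>\<^bsub>Q\<^esub> (s \<otimes>\<^bsub>Q\<^esub> t) = p"
    using st p s by (auto simp: rstab_def Q.m_assoc)
  have "s \<otimes>\<^bsub>Q\<^esub> t \<in> carrier Q" using s t by simp
  then obtain e v where e: "e \<in> carrier Q" "e \<otimes>\<^bsub>Q\<^esub> e = e" "p \<otimes>\<^bsub>Q\<^esub> e = p" "v \<in> carrier Q"
    "e = s \<otimes>\<^bsub>Q\<^esub> t \<otimes>\<^bsub>Q\<^esub> v" "e = v \<otimes>\<^bsub>Q\<^esub> (s \<otimes>\<^bsub>Q\<^esub> t)"
    by (rule Q.idempotent_fixing[OF p _ t(2)])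
  have "e \<otimes>\<^bsub>Q\<^esub> s \<otimes>\<^bsub>Q\<^esub> (t \<otimes>\<^bsub>Q\<^esub> v) = e \<otimes>\<^bsub>Q\<^esub> (s \<otimes>\<^bsub>Q\<^esub> t \<otimes>\<^bsub>Q\<^esub> v)"
    using e(1,4) s t(1) by (simp add: Q.m_assoc)
  also have "\<dots> = e" using e(2) e(5) by simp
  finally have es: "rstab Q e s" unfolding rstab_def using t(1) e(4) by blast
  obtain w where w: "w \<in> lists A" "\<psi> w = e" using e(1) surj by (metis imageE)
  obtain s' where s': "s' \<in> lists A" "\<psi> s' = s" using s surj by (metis imageE)
  have ww: "\<psi> w \<otimes>\<^bsub>Q\<^esub> \<psi> w = \<psi> w" using w e(2) by simp
  have "set s' \<subseteq> set w"
    by (rule Kexp_quotient_absorb(1)[OF r Q.monoid_axioms \<psi> ker' w(1) ww s'(1)]) (use es w s' in auto)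
  \<comment> \<open>\<open>?r\<close> compares alphabets only. Absorption behind \<open>w\<close>
    turns this into \<open>e e = e (e s)\<close>.\<close>
  then have "?r w (w @ s')" by auto
  moreover have "rstab Q (\<psi> w) (\<psi> w)" unfolding rstab_def ww w(2) using e(1,2) by auto
  ultimately have "\<psi> w \<otimes>\<^bsub>Q\<^esub> \<psi> w = \<psi> w \<otimes>\<^bsub>Q\<^esub> \<psi> (w @ s')"
    using Kexp_quotient_absorb(2)[OF r Q.monoid_axioms \<psi> ker' w(1) ww w(1), of "w @ s'"] w(1) s'(1) by simp
  then have "e = e \<otimes>\<^bsub>Q\<^esub> (e \<otimes>\<^bsub>Q\<^esub> s)" using hom[OF w(1) s'(1)] w s' e(2) by simp
  then have "e = e \<otimes>\<^bsub>Q\<^esub> s" using e(1,2) s by (simp flip: Q.m_assoc)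
  then have "p \<otimes>\<^bsub>Q\<^esub> e = p \<otimes>\<^bsub>Q\<^esub> e \<otimes>\<^bsub>Q\<^esub> s" using p e(1) s by (metis Q.m_assoc)
  then show "p \<otimes>\<^bsub>Q\<^esub> s = p" using e(3) by simp
qed (rule Q)

lemma epi_words_rev: "\<psi> \<in> epi (words A) Q \<Longrightarrow> (\<lambda>u. \<psi> (rev u)) \<in> epi (words A) (opp Q)"
proof -
  assume \<psi>: "\<psi> \<in> epi (words A) Q"
  have "(\<lambda>u. \<psi> (rev u)) ` lists A = \<psi> ` lists A"
  proof (intro equalityI subsetI)
    fix x assume "x \<in> \<psi> ` lists A"
    then obtain u where "u \<in> lists A" "x = \<psi> (rev (rev u))" by auto
    then show "x \<in> (\<lambda>u. \<psi> (rev u)) ` lists A" by (intro image_eqI[of _ _ "rev u"]) (auto simp: in_lists_conv_set)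
  qed (auto simp: in_lists_conv_set intro!: imageI)
  moreover have "\<psi> (rev (u @ v)) = \<psi> (rev v) \<otimes>\<^bsub>Q\<^esub> \<psi> (rev u)" if "u \<in> lists A" "v \<in> lists A" for u v
    using \<psi> that by (auto simp: epi_def hom_def in_lists_conv_set)
  ultimately show ?thesis using \<psi> by (auto simp: epi_def hom_def in_lists_conv_set)
qed

text \<open>\<open>?r\<close>-equivalent words have \<open>sim_K\<close>-equivalent images, so
  \<open>Q\<close> modulo \<open>sim_K\<close> is a quotient of \<open>P\<close>, the words modulo
  \<open>?r\<close>. By induction and reversal \<open>P\<close> lies in \<open>TW_L (m - 1)\<close>,
  which is closed under quotients.\<close>

lemma TW_R_rho:
  assumes A: "finite A"
  shows "m \<ge> 2 \<Longrightarrow> Q \<in> finite_monoids \<Longrightarrow> \<psi> \<in> epi (words A) Q \<Longrightarrow>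
    (\<And>u v. u \<in> lists A \<Longrightarrow> v \<in> lists A \<Longrightarrow> \<psi> u = \<psi> v \<longleftrightarrow> rho (m - 1) k u v) \<Longrightarrow> Q \<in> TW_R m"
proof (induction m arbitrary: Q \<psi> rule: less_induct)
  case (less m)
  note Q = less.prems(2) and \<psi> = less.prems(3) and ker = less.prems(4)
  show ?case
  proof (cases "m = 2")
    case True
    then show ?thesis using R_trivial_rho[OF Q \<psi>, of k] ker by (simp add: TW_R.simps[of 2])
  next
    case False
    then have m: "m > 2" using less.prems by simp
    define n where "n = m - 2"
    have n: "m - 1 = Suc n" "m - 1 - 1 = n" using m by (auto simp: n_def)
    let ?r = "\<lambda>u v :: 'a list. rho n k (rev u) (rev v)"
    have r: "word_congruence ?r" by (rule word_congruence_rev[OF word_congruence_rho])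
    obtain P \<phi> where P: "P \<in> finite_monoids" "\<phi> \<in> epi (words A) P"
      and kerP: "\<And>u v. u \<in> lists A \<Longrightarrow> v \<in> lists A \<Longrightarrow> \<phi> u = \<phi> v \<longleftrightarrow> ?r u v"
      using word_quotient[OF r finite_index_rev[OF finite_index_rho[OF A]]] by blast
    have "opp P \<in> TW_R (m - 1)"
    proof (rule less.IH[of "m - 1" "opp P" "\<lambda>u. \<phi> (rev u)"])
      show "(\<lambda>u. \<phi> (rev u)) \<in> epi (words A) (opp P)" by (rule epi_words_rev[OF P(2)])
      show "\<phi> (rev u) = \<phi> (rev v) \<longleftrightarrow> rho (m - 1 - 1) k u v" if "u \<in> lists A" "v \<in> lists A" for u v
        using kerP[of "rev u" "rev v"] that n by (simp add: in_lists_conv_set)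
    qed (use m P(1) in auto)
    then have PL: "P \<in> TW_L (m - 1)" by (simp add: TW_L_iff)
    obtain N c where N: "N \<in> finite_monoids" "c \<in> epi Q N"
      and kerN: "\<And>x y. x \<in> carrier Q \<Longrightarrow> y \<in> carrier Q \<Longrightarrow> c x = c y \<longleftrightarrow> (x, y) \<in> sim_K Q"
      using sim_K_quotient[OF Q] by blast
    have mQ: "monoid Q" using Q by (simp add: finite_monoids_def)
    have surj: "\<psi> ` lists A = carrier Q" using \<psi> by (simp add: epi_def)
    have ker': "\<forall>u\<in>lists A. \<forall>v\<in>lists A. \<psi> u = \<psi> v \<longleftrightarrow> Kexp ?r k u v"
      using ker by (simp only: n rho.simps) blast
    have sim: "(\<psi> x, \<psi> y) \<in> sim_K Q" if xy: "x \<in> lists A" "y \<in> lists A" "?r x y" for x y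
      unfolding sim_K_iff[OF mQ]
    proof (intro conjI ballI impI)
      show "\<psi> x \<in> carrier Q" "\<psi> y \<in> carrier Q" using xy surj by auto
      fix e assume e: "e \<in> carrier Q" "e \<otimes>\<^bsub>Q\<^esub> e = e" and st: "rstab Q e (\<psi> x) \<or> rstab Q e (\<psi> y)"
      obtain w where w: "w \<in> lists A" "\<psi> w = e" using e(1) surj by (metis imageE)
      have ww: "\<psi> w \<otimes>\<^bsub>Q\<^esub> \<psi> w = \<psi> w" using w e by simp
      note absorb = Kexp_quotient_absorb(2)[OF r mQ \<psi> ker' w(1) ww]
      from st show "e \<otimes>\<^bsub>Q\<^esub> \<psi> x = e \<otimes>\<^bsub>Q\<^esub> \<psi> y"
      proof
        assume "rstab Q e (\<psi> x)"
        then show ?thesis using absorb[OF xy(1) _ xy(2,3)] w(2) by simp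
      next
        assume "rstab Q e (\<psi> y)"
        then show ?thesis using absorb[OF xy(2) _ xy(1)] word_congruence.sym[OF r xy(3)] w(2) by simp
      qed
    qed
    have "epi P N \<noteq> {}"
    proof (rule epi_factor[OF P(2) epi_comp[OF \<psi> N(2)] monoid_words])
      fix x y assume xy: "x \<in> carrier (words A)" "y \<in> carrier (words A)" "\<phi> x = \<phi> y"
      then have "(\<psi> x, \<psi> y) \<in> sim_K Q" using sim kerP by simp
      then show "(c \<circ> \<psi>) x = (c \<circ> \<psi>) y" using kerN[of "\<psi> x" "\<psi> y"] sim_K_closed by fastforce
    qed
    then have "N \<in> TW_L (m - 1)" using epi_closed_TW_L[of "m - 1"] PL N(1) unfolding epi_closed_def by blast
    then have "Q \<in> malcev_K (TW_L (m - 1))" unfolding malcev_K_iff using Q N kerN by blast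
    then show ?thesis using m by (simp add: TW_R.simps[of m])
  qed
qed

lemma TW_L_rho:
  assumes A: "finite A" and m: "m \<ge> 2" and Q: "Q \<in> finite_monoids" and \<psi>: "\<psi> \<in> epi (words A) Q"
    and ker: "\<And>u v. u \<in> lists A \<Longrightarrow> v \<in> lists A \<Longrightarrow> \<psi> u = \<psi> v \<longleftrightarrow> rho (m - 1) k (rev u) (rev v)"
  shows "Q \<in> TW_L m"
proof -
  have "opp Q \<in> TW_R m"
  proof (rule TW_R_rho[OF A m _ epi_words_rev[OF \<psi>]])
    show "\<psi> (rev u) = \<psi> (rev v) \<longleftrightarrow> rho (m - 1) k u v" if "u \<in> lists A" "v \<in> lists A" for u v
      using ker[of "rev u" "rev v"] that by (simp add: in_lists_conv_set)
  qed (use Q in simp)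
  then show ?thesis by (simp add: TW_L_iff)
qed

section \<open>Characterization of the join\<close>

lemma monoid_product_group:
  assumes "\<And>i. i \<in> I \<Longrightarrow> monoid (F i)"
  shows "monoid (product_group I F)"
proof (rule monoidI)
  fix x y z assume "x \<in> carrier (product_group I F)" "y \<in> carrier (product_group I F)" "z \<in> carrier (product_group I F)"
  then show "x \<otimes>\<^bsub>product_group I F\<^esub> y \<otimes>\<^bsub>product_group I F\<^esub> z =
      x \<otimes>\<^bsub>product_group I F\<^esub> (y \<otimes>\<^bsub>product_group I F\<^esub> z)"
    using assms by (auto simp: PiE_iff monoid.m_assoc intro!: restrict_ext)
qed (use assms in \<open>auto simp: PiE_iff monoid.m_closed monoid.one_closed monoid.l_one monoid.r_one extensional_def fun_eq_iff\<close>)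

lemma iso_sym_monoid:
  assumes G: "monoid G" and iso: "G \<cong> H"
  shows "H \<cong> G"
proof -
  obtain h where h: "h \<in> hom G H" "bij_betw h (carrier G) (carrier H)"
    using iso by (auto simp: is_iso_def iso_def)
  define g where "g = inv_into (carrier G) h"
  have gh: "g (h x) = x" if "x \<in> carrier G" for x
    using h(2) that by (simp add: g_def bij_betw_def)
  have H: "carrier H = h ` carrier G" using h(2) by (simp add: bij_betw_def)
  have "g (h x \<otimes>\<^bsub>H\<^esub> h y) = g (h x) \<otimes>\<^bsub>G\<^esub> g (h y)" if "x \<in> carrier G" "y \<in> carrier G" for x y
    using that gh hom_mult[OF h(1) that] monoid.m_closed[OF G that] by metis
  then have "g \<in> hom H G" using gh by (auto simp: hom_def H)
  moreover have "bij_betw g (carrier H) (carrier G)" unfolding g_def using h(2) by (rule bij_betw_inv_into)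
  ultimately show ?thesis by (auto simp: is_iso_def iso_def)
qed

lemma wprod_epi:
  assumes "monoid M"
  shows "wprod M \<in> epi (words (carrier M)) M"
proof -
  interpret monoid M by fact
  have "x \<in> wprod M ` lists (carrier M)" if "x \<in> carrier M" for x
    using that by (intro image_eqI[of _ _ "[x]"]) auto
  then show ?thesis
    by (auto simp: epi_def hom_def wprod_append wprod_closed subset_iff in_lists_conv_set)
qed

lemma wprod_eq_of_both_rho:
  assumes M: "finite_monoid M" and cond: "join_cond n M"
    and uv: "u \<in> lists (carrier M)" "v \<in> lists (carrier M)" "both_rho n (2 * n * card (carrier M)) u v"
  shows "wprod M u = wprod M v"
proof -
  interpret finite_monoid M by fact
  have "(u, v) \<in> (word_step M n (carrier M))\<^sup>*"
    by (rule word_chain) (use cond uv in \<open>auto simp: join_cond_def in_lists_conv_set\<close>)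
  then show ?thesis
    by (induction rule: rtrancl_induct) (use cond in \<open>auto simp: word_step_def join_cond_def\<close>)
qed

lemma variety_submonoid: "variety U \<Longrightarrow> M \<in> U \<Longrightarrow> submonoid H M \<Longrightarrow> M\<lparr>carrier := H\<rparr> \<in> U"
  unfolding variety_def by (elim conjE) (drule (1) bspec, drule spec, erule (1) mp)

lemma variety_epi: "variety U \<Longrightarrow> M \<in> U \<Longrightarrow> N \<in> finite_monoids \<Longrightarrow> epi M N \<noteq> {} \<Longrightarrow> N \<in> U"
  unfolding variety_def by (elim conjE) (drule (1) bspec, drule (1) bspec, erule (1) mp)

lemma variety_product:
  fixes k :: nat
  assumes "variety U" "\<And>i. F i \<in> U" "P \<in> finite_monoids" "P \<cong> product_group {..<k} F"
  shows "P \<in> U"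
proof -
  have "\<forall>(k::nat) F. (\<forall>i<k. F i \<in> U) \<longrightarrow>
      (\<forall>P\<in>finite_monoids. P \<cong> product_group {..<k} F \<longrightarrow> P \<in> U)"
    using assms(1) unfolding variety_def by (elim conjE)
  from this[THEN spec[of _ k], THEN spec[of _ F]] show ?thesis using assms(2-4) by blast
qed

lemma join_cond_in_variety:
  assumes m: "m \<ge> 2" and M: "M \<in> finite_monoids" and cond: "join_cond (m - 1) M"
    and U: "variety U" "TW_R m \<subseteq> U" "TW_L m \<subseteq> U"
  shows "M \<in> U"
proof -
  have fm: "finite_monoid M" using M by (simp add: finite_monoids_iff)
  have mM: "monoid M" using M by (auto simp: finite_monoids_def)
  define A where "A = carrier M"
  have finA: "finite A" using M by (simp add: A_def finite_monoids_def)
  \<comment> \<open>The parameter that \<open>word_chain\<close> needs at level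
    \<open>m - 1\<close>, the letters being the elements of \<open>M\<close>.\<close>
  define k where "k = 2 * (m - 1) * card A"
  obtain N1 \<psi>1 where N1: "N1 \<in> finite_monoids" "\<psi>1 \<in> epi (words A) N1"
    and k1: "\<And>u v. u \<in> lists A \<Longrightarrow> v \<in> lists A \<Longrightarrow> \<psi>1 u = \<psi>1 v \<longleftrightarrow> rho (m - 1) k u v"
    using word_quotient[OF word_congruence_rho[of "m - 1" k] finite_index_rho[OF finA]] by blast
  obtain N2 \<psi>2 where N2: "N2 \<in> finite_monoids" "\<psi>2 \<in> epi (words A) N2"
    and k2: "\<And>u v. u \<in> lists A \<Longrightarrow> v \<in> lists A \<Longrightarrow> \<psi>2 u = \<psi>2 v \<longleftrightarrow> rho (m - 1) k (rev u) (rev v)"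
    using word_quotient[OF word_congruence_rev[OF word_congruence_rho[of "m - 1" k]]
        finite_index_rev[OF finite_index_rho[OF finA]]] by blast
  have "N1 \<in> TW_R m" by (rule TW_R_rho[OF finA m N1]) (rule k1)
  moreover have "N2 \<in> TW_L m" by (rule TW_L_rho[OF finA m N2]) (rule k2)
  ultimately have NU: "N1 \<in> U" "N2 \<in> U" using U by auto
  define F where "F i = (if i = (0::nat) then N1 else N2)" for i
  let ?P = "product_group {..<2} F"
  have F: "monoid (F i)" "finite (carrier (F i))" "F i \<in> U" for i
    using N1 N2 NU by (auto simp: F_def finite_monoids_def)
  have mP: "monoid ?P" by (rule monoid_product_group) (rule F(1))
  have finP: "finite (carrier ?P)" unfolding carrier_product_group by (rule finite_PiE) (simp_all only: finite_lessThan F(2))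
  obtain c :: "(nat \<Rightarrow> nat) \<Rightarrow> nat" where c: "inj_on c (carrier ?P)"
    using finite_imp_inj_to_nat_seg[OF finP] by auto
  obtain P where P: "P \<in> finite_monoids" "c \<in> epi ?P P"
  proof (rule monoid_epi_copy[OF mP])
    show "finite (c ` carrier ?P)" using finP by blast
    fix x x' y y' assume *: "x \<in> carrier ?P" "x' \<in> carrier ?P" "y \<in> carrier ?P" "y' \<in> carrier ?P"
      "c x = c x'" "c y = c y'"
    have "x = x'" "y = y'" by (rule inj_onD[OF c *(5,1,2)], rule inj_onD[OF c *(6,3,4)])
    then show "c (x \<otimes>\<^bsub>?P\<^esub> y) = c (x' \<otimes>\<^bsub>?P\<^esub> y')" by simp
  qed blast
  have "?P \<cong> P" 
    unfolding is_iso_def iso_def bij_betw_def using c P(2) unfolding epi_def by blast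
  then have "P \<cong> ?P" by (rule iso_sym_monoid[OF mP])
  then have PU: "P \<in> U" by (rule variety_product[OF U(1) F(3) P(1)])
  have mPP: "monoid P" using P(1) by (simp add: finite_monoids_def)
  define h where "h u = (\<lambda>i\<in>{..<2::nat}. if i = 0 then \<psi>1 u else \<psi>2 u)" for u
  have h1: "h u \<in> carrier ?P" if "u \<in> lists A" for u
  proof -
    have "\<psi>1 u \<in> carrier N1" "\<psi>2 u \<in> carrier N2"
      using that N1(2) N2(2) by (auto simp: epi_def hom_def)
    then show ?thesis unfolding carrier_product_group h_def by (intro restrict_PiE_iff[THEN iffD2]) (simp add: F_def)
  qed
  have h2: "h (u @ v) = h u \<otimes>\<^bsub>?P\<^esub> h v" if "u \<in> lists A" "v \<in> lists A" for u v
  proof -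
    have "\<psi>1 (u @ v) = \<psi>1 u \<otimes>\<^bsub>N1\<^esub> \<psi>1 v" "\<psi>2 (u @ v) = \<psi>2 u \<otimes>\<^bsub>N2\<^esub> \<psi>2 v"
      using that N1(2) N2(2) by (auto simp: epi_def hom_def)
    then show ?thesis unfolding mult_product_group h_def by (intro restrict_ext) (simp add: F_def)
  qed
  have "\<psi>1 [] = \<one>\<^bsub>N1\<^esub>" "\<psi>2 [] = \<one>\<^bsub>N2\<^esub>"
    using epi_one[OF monoid_words _ N1(2)] epi_one[OF monoid_words _ N2(2)] N1(1) N2(1)
    by (simp_all add: finite_monoids_def)
  then have h3: "h [] = \<one>\<^bsub>?P\<^esub>"
    unfolding one_product_group h_def by (intro restrict_ext) (simp add: F_def)
  \<comment> \<open>Evaluation in \<open>M\<close> makes sense only for pairs of classes of one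
    common word, so this submonoid, and not all of \<open>P\<close>, is mapped onto
    \<open>M\<close>.\<close>
  define H where "H = (\<lambda>u. c (h u)) ` lists A"
  have ch: "c \<in> hom ?P P" using P(2) by (simp add: epi_def)
  have mult: "c (h (u @ v)) = c (h u) \<otimes>\<^bsub>P\<^esub> c (h v)" if "u \<in> lists A" "v \<in> lists A" for u v
    unfolding h2[OF that] by (rule hom_mult[OF ch h1[OF that(1)] h1[OF that(2)]])
  have sub: "submonoid H P"
  proof
    show "H \<subseteq> carrier P" unfolding H_def by (intro image_subsetI hom_in_carrier[OF ch] h1)
    show "\<one>\<^bsub>P\<^esub> \<in> H"
      unfolding H_def using epi_one[OF mP mPP P(2)] h3 by (intro image_eqI[of _ _ "[]"]) auto
    fix x y assume "x \<in> H" "y \<in> H"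
    then obtain u v where "u \<in> lists A" "v \<in> lists A" "x = c (h u)" "y = c (h v)" by (auto simp: H_def)
    then show "x \<otimes>\<^bsub>P\<^esub> y \<in> H" unfolding H_def using mult by (intro image_eqI[of _ _ "u @ v"]) auto
  qed
  let ?H = "P\<lparr>carrier := H\<rparr>"
  have HU: "?H \<in> U" by (rule variety_submonoid[OF U(1) PU sub])
  have "(\<lambda>u. c (h u)) \<in> epi (words A) ?H"
    using mult by (auto simp: epi_def hom_def H_def)
  then have "epi ?H M \<noteq> {}"
  proof (rule epi_factor[OF _ wprod_epi[OF mM, folded A_def] monoid_words])
    fix u v assume uv: "u \<in> carrier (words A)" "v \<in> carrier (words A)" and "c (h u) = c (h v)"
    then have "h u = h v" using inj_onD[OF c _ h1 h1] by simp
    then have "h u 0 = h v 0" "h u 1 = h v 1" by auto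
    then have "\<psi>1 u = \<psi>1 v" "\<psi>2 u = \<psi>2 v" by (auto simp: h_def)
    then have "both_rho (m - 1) k u v" using k1 k2 uv by (auto simp: both_rho_def)
    then show "wprod M u = wprod M v"
      using wprod_eq_of_both_rho[OF fm cond] uv by (simp add: k_def A_def)
  qed
  then show ?thesis by (rule variety_epi[OF U(1) HU M])
qed

theorem variety_join_iff:
  assumes m: "m \<ge> 2" and M: "M \<in> finite_monoids"
  shows "M \<in> variety_join (TW_R m) (TW_L m) \<longleftrightarrow> join_cond (m - 1) M"
proof
  assume "M \<in> variety_join (TW_R m) (TW_L m)"
  then have "M \<in> {M \<in> finite_monoids. join_cond (m - 1) M}"
    unfolding variety_join_def
    using variety_join_cond TW_R_join_cond[OF m] TW_L_join_cond[OF m] by blast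
  then show "join_cond (m - 1) M" by simp
next
  assume "join_cond (m - 1) M"
  then show "M \<in> variety_join (TW_R m) (TW_L m)"
    unfolding variety_join_def using join_cond_in_variety[OF m M] by blast
qed

section \<open>Total recursive functions\<close>

text \<open>Agreement on lists of length \<open>n\<close> makes the notion independent of the values
  that the constructors of \<open>recursive\<close> happen to produce on other lists.\<close>

definition rec_fun :: "nat \<Rightarrow> (nat list \<Rightarrow> nat) \<Rightarrow> bool" where
  "rec_fun n F \<longleftrightarrow> (\<exists>g. recursive n g \<and> (\<forall>xs. length xs = n \<longrightarrow> F xs = g xs))"

lemma rec_fun_cong: "rec_fun n F \<Longrightarrow> (\<And>xs. length xs = n \<Longrightarrow> G xs = F xs) \<Longrightarrow> rec_fun n G"
  unfolding rec_fun_def by metis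

lemma rec_fun_recursive: "recursive n g \<Longrightarrow> rec_fun n g"
  unfolding rec_fun_def by blast

lemma rec_fun_nth: "i < n \<Longrightarrow> rec_fun n (\<lambda>xs. xs ! i)"
  by (intro rec_fun_recursive proj)

lemma rec_fun_comp:
  assumes F: "rec_fun (length Gs) F" and Gs: "\<And>G. G \<in> set Gs \<Longrightarrow> rec_fun n G"
  shows "rec_fun n (\<lambda>xs. F (map (\<lambda>G. G xs) Gs))"
proof -
  obtain f where f: "recursive (length Gs) f" "\<And>xs. length xs = length Gs \<Longrightarrow> F xs = f xs"
    using F unfolding rec_fun_def by blast
  have "\<forall>G\<in>set Gs. \<exists>g. recursive n g \<and> (\<forall>xs. length xs = n \<longrightarrow> G xs = g xs)"
    using Gs unfolding rec_fun_def by blast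
  then obtain h where h: "\<And>G. G \<in> set Gs \<Longrightarrow> recursive n (h G)"
    "\<And>G xs. G \<in> set Gs \<Longrightarrow> length xs = n \<Longrightarrow> G xs = h G xs"
    by metis
  have "recursive n (\<lambda>xs. f (map (\<lambda>g. g xs) (map h Gs)))"
    by (rule comp) (use f(1) h(1) in auto)
  moreover have "F (map (\<lambda>G. G xs) Gs) = f (map (\<lambda>g. g xs) (map h Gs))" if "length xs = n" for xs
    using f(2)[of "map (\<lambda>G. G xs) Gs"] h(2) that by (simp add: comp_def cong: map_cong)
  ultimately show ?thesis unfolding rec_fun_def by blast
qed

lemma rec_fun_reindex:
  assumes "rec_fun (length is) F" "\<And>i. i \<in> set is \<Longrightarrow> i < n"
  shows "rec_fun n (\<lambda>xs. F (map (\<lambda>i. xs ! i) is))"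
  using rec_fun_comp[of "map (\<lambda>i xs. xs ! i) is" F n] assms rec_fun_nth by (auto simp: comp_def)

lemma rec_fun_Suc: "rec_fun n F \<Longrightarrow> rec_fun n (\<lambda>xs. Suc (F xs))"
  using rec_fun_comp[of "[F]" "\<lambda>xs. Suc (xs ! 0)" n] rec_fun_recursive[OF succ] by simp

lemma rec_fun_const: "rec_fun n (\<lambda>xs. c)"
  by (induction c) (auto intro: rec_fun_recursive zero rec_fun_Suc)

lemma rec_fun_prim:
  assumes "rec_fun n F" "rec_fun (Suc (Suc n)) G"
  shows "rec_fun (Suc n) (\<lambda>xs. rec_nat (F (tl xs)) (\<lambda>k r. G (k # r # tl xs)) (hd xs))"
proof -
  obtain f g where fg: "recursive n f" "\<And>xs. length xs = n \<Longrightarrow> F xs = f xs"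
    "recursive (Suc (Suc n)) g" "\<And>xs. length xs = Suc (Suc n) \<Longrightarrow> G xs = g xs"
    using assms unfolding rec_fun_def by metis
  show ?thesis
    by (rule rec_fun_cong[OF rec_fun_recursive[OF prim[OF fg(1,3)]]]) (simp add: fg(2,4))
qed

lemma rec_fun_mini:
  assumes "rec_fun (Suc n) F" "\<And>xs. length xs = n \<Longrightarrow> \<exists>k. F (k # xs) = 0"
  shows "rec_fun n (\<lambda>xs. LEAST k. F (k # xs) = 0)"
proof -
  obtain f where f: "recursive (Suc n) f" "\<And>xs. length xs = Suc n \<Longrightarrow> F xs = f xs"
    using assms(1) unfolding rec_fun_def by metis
  have "recursive n (\<lambda>xs. LEAST k. f (k # xs) = 0)"
    by (rule mini[OF f(1)]) (use assms(2) f(2) in force)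
  then show ?thesis by (rule rec_fun_cong[OF rec_fun_recursive]) (simp add: f(2))
qed

definition rec1 :: "(nat \<Rightarrow> nat) \<Rightarrow> bool" where "rec1 f \<longleftrightarrow> rec_fun 1 (\<lambda>xs. f (xs ! 0))"
definition rec2 :: "(nat \<Rightarrow> nat \<Rightarrow> nat) \<Rightarrow> bool" where "rec2 f \<longleftrightarrow> rec_fun 2 (\<lambda>xs. f (xs ! 0) (xs ! 1))"
definition rec3 :: "(nat \<Rightarrow> nat \<Rightarrow> nat \<Rightarrow> nat) \<Rightarrow> bool" where
  "rec3 f \<longleftrightarrow> rec_fun 3 (\<lambda>xs. f (xs ! 0) (xs ! 1) (xs ! 2))"

lemma rec1_comp: "rec1 f \<Longrightarrow> rec_fun n A \<Longrightarrow> rec_fun n (\<lambda>xs. f (A xs))"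
  using rec_fun_comp[of "[A]" "\<lambda>xs. f (xs ! 0)" n] by (simp add: rec1_def)

lemma rec2_comp: "rec2 f \<Longrightarrow> rec_fun n A \<Longrightarrow> rec_fun n B \<Longrightarrow> rec_fun n (\<lambda>xs. f (A xs) (B xs))"
  using rec_fun_comp[of "[A, B]" "\<lambda>xs. f (xs ! 0) (xs ! 1)" n] by (auto simp: rec2_def numeral_2_eq_2)

lemma rec3_comp:
  "rec3 f \<Longrightarrow> rec_fun n A \<Longrightarrow> rec_fun n B \<Longrightarrow> rec_fun n C \<Longrightarrow> rec_fun n (\<lambda>xs. f (A xs) (B xs) (C xs))"
  using rec_fun_comp[of "[A, B, C]" "\<lambda>xs. f (xs ! 0) (xs ! 1) (xs ! 2)" n]
  by (auto simp: rec3_def numeral_3_eq_3)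

lemma rec1_prim: "rec2 g \<Longrightarrow> rec1 (\<lambda>x. rec_nat a g x)"
proof -
  assume "rec2 g"
  then have "rec_fun (Suc 0) (\<lambda>xs. rec_nat a (\<lambda>k r. g ((k # r # tl xs) ! 0) ((k # r # tl xs) ! 1)) (hd xs))"
    using rec_fun_prim[OF rec_fun_const[of 0 a], of "\<lambda>xs. g (xs ! 0) (xs ! 1)"]
    by (simp add: rec2_def numeral_2_eq_2)
  then show ?thesis
    unfolding rec1_def One_nat_def
    by (rule rec_fun_cong) (auto simp: length_Suc_conv)
qed

lemma rec2_prim: "rec1 f \<Longrightarrow> rec3 g \<Longrightarrow> rec2 (\<lambda>x y. rec_nat (f y) (\<lambda>k r. g k r y) x)"
proof -
  assume f: "rec1 f" and g: "rec3 g"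
  have "rec_fun (Suc 1) (\<lambda>xs. rec_nat (f (tl xs ! 0))
      (\<lambda>k r. g ((k # r # tl xs) ! 0) ((k # r # tl xs) ! 1) ((k # r # tl xs) ! 2)) (hd xs))"
    by (rule rec_fun_prim) (use f g in \<open>simp_all add: rec1_def rec3_def numeral_3_eq_3\<close>)
  then show ?thesis
    unfolding rec2_def numeral_2_eq_2 One_nat_def
    by (rule rec_fun_cong) (auto simp: length_Suc_conv numeral_2_eq_2)
qed

lemma rec1_pred: "rec1 (\<lambda>x. x - 1)"
proof -
  have "rec2 (\<lambda>k r. k)" by (simp add: rec2_def rec_fun_nth)
  from rec1_prim[OF this, of 0] have "rec1 (\<lambda>x. rec_nat 0 (\<lambda>k r. k) x)" .
  moreover have "rec_nat 0 (\<lambda>k r. k) x = x - 1" for x :: nat by (cases x) auto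
  ultimately show ?thesis by simp
qed

lemma rec2_diff: "rec2 (\<lambda>x y. y - x)"
proof -
  have 1: "rec1 (\<lambda>y. y)" by (simp add: rec1_def rec_fun_nth)
  have 2: "rec3 (\<lambda>k r y. r - 1)"
    unfolding rec3_def by (rule rec1_comp[OF rec1_pred]) (simp add: rec_fun_nth)
  have "rec_nat y (\<lambda>k r. r - 1) x = y - x" for x y :: nat by (induction x) auto
  then show ?thesis using rec2_prim[OF 1 2] by simp
qed

lemma rec2_add: "rec2 (\<lambda>x y. x + y)"
proof -
  have 1: "rec1 (\<lambda>y. y)" by (simp add: rec1_def rec_fun_nth)
  have 2: "rec3 (\<lambda>k r y. Suc r)"
    unfolding rec3_def by (rule rec_fun_Suc) (simp add: rec_fun_nth)
  have "rec_nat y (\<lambda>k r. Suc r) x = x + y" for x y :: nat by (induction x) auto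
  then show ?thesis using rec2_prim[OF 1 2] by simp
qed

lemmas rec_fun_diff = rec2_comp[OF rec2_diff] and rec_fun_add = rec2_comp[OF rec2_add]

lemma rec1_triangle: "rec1 triangle"
proof -
  have 2: "rec2 (\<lambda>k r. r + Suc k)"
    unfolding rec2_def by (intro rec_fun_add rec_fun_Suc rec_fun_nth) simp_all
  have "rec_nat 0 (\<lambda>k r. r + Suc k) x = triangle x" for x by (induction x) auto
  then show ?thesis using rec1_prim[OF 2, of 0] by simp
qed

lemma rec_fun_if_zero:
  assumes C: "rec_fun n C" and A: "rec_fun n A" and B: "rec_fun n B"
  shows "rec_fun n (\<lambda>xs. if C xs = 0 then A xs else B xs)"
proof -
  \<comment> \<open>Case distinction as recursion on the value of \<open>C\<close>: the step ignores
    counter and previous value, so every successor yields \<open>B\<close>.\<close>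
  have "rec_fun (Suc n) (\<lambda>xs. rec_nat (A (tl xs)) (\<lambda>k r. (\<lambda>ys. B (tl (tl ys))) (k # r # tl xs)) (hd xs))"
  proof (rule rec_fun_prim[OF A])
    show "rec_fun (Suc (Suc n)) (\<lambda>ys. B (tl (tl ys)))"
    proof (rule rec_fun_cong[OF rec_fun_reindex[of "[2..<Suc (Suc n)]" B]])
      fix xs :: "nat list" assume "length xs = Suc (Suc n)"
      then show "B (tl (tl xs)) = B (map ((!) xs) [2..<Suc (Suc n)])"
        by (intro arg_cong[of _ _ B] nth_equalityI) (auto simp: nth_tl numeral_2_eq_2 simp del: upt_Suc)
    qed (use B in \<open>auto simp del: upt_Suc\<close>)
  qed
  then have "rec_fun (length (C # map (\<lambda>i xs. xs ! i) [0..<n]))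
      (\<lambda>xs. rec_nat (A (tl xs)) (\<lambda>k r. B (tl xs)) (hd xs))"
    by simp
  then have "rec_fun n (\<lambda>xs. (\<lambda>ys. rec_nat (A (tl ys)) (\<lambda>k r. B (tl ys)) (hd ys))
      (map (\<lambda>G. G xs) (C # map (\<lambda>i xs. xs ! i) [0..<n])))"
    by (rule rec_fun_comp) (use C rec_fun_nth in auto)
  then show ?thesis
  proof (rule rec_fun_cong)
    fix xs :: "nat list" assume "length xs = n"
    then have "map (\<lambda>i. xs ! i) [0..<n] = xs" by (auto intro: nth_equalityI)
    moreover have "rec_nat a (\<lambda>k r. b) x = (if x = 0 then a else b)" for a b x :: nat by (cases x) auto
    ultimately show "(if C xs = 0 then A xs else B xs) =
        (\<lambda>ys. rec_nat (A (tl ys)) (\<lambda>k r. B (tl ys)) (hd ys)) (map (\<lambda>G. G xs) (C # map (\<lambda>i xs. xs ! i) [0..<n]))"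
      by (simp add: comp_def)
  qed
qed

text \<open>The characteristic function takes the value 0 for truth, as minimization requires.\<close>

definition rec_rel :: "nat \<Rightarrow> (nat list \<Rightarrow> bool) \<Rightarrow> bool" where
  "rec_rel n P \<longleftrightarrow> rec_fun n (\<lambda>xs. if P xs then 0 else 1)"

lemma rec_rel_cong: "rec_rel n P \<Longrightarrow> (\<And>xs. length xs = n \<Longrightarrow> Q xs = P xs) \<Longrightarrow> rec_rel n Q"
  unfolding rec_rel_def by (erule rec_fun_cong) simp

lemma rec_fun_if: "rec_rel n P \<Longrightarrow> rec_fun n A \<Longrightarrow> rec_fun n B \<Longrightarrow> rec_fun n (\<lambda>xs. if P xs then A xs else B xs)"
  unfolding rec_rel_def by (drule (2) rec_fun_if_zero) (erule rec_fun_cong, simp)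

lemma rec_rel_not:
  assumes "rec_rel n P"
  shows "rec_rel n (\<lambda>xs. \<not> P xs)"
  unfolding rec_rel_def
  by (rule rec_fun_cong[OF rec_fun_if[OF assms rec_fun_const[of n 1] rec_fun_const[of n 0]]]) simp

lemma rec_rel_and:
  assumes "rec_rel n P" "rec_rel n Q"
  shows "rec_rel n (\<lambda>xs. P xs \<and> Q xs)"
  unfolding rec_rel_def
  by (rule rec_fun_cong[OF rec_fun_if[OF assms(1) assms(2)[unfolded rec_rel_def] rec_fun_const[of n 1]]]) simp

lemma rec_rel_imp:
  assumes "rec_rel n P" "rec_rel n Q"
  shows "rec_rel n (\<lambda>xs. P xs \<longrightarrow> Q xs)"
  by (rule rec_rel_cong[OF rec_rel_not[OF rec_rel_and[OF assms(1) rec_rel_not[OF assms(2)]]]]) simp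

lemma rec_rel_iff:
  assumes "rec_rel n P" "rec_rel n Q"
  shows "rec_rel n (\<lambda>xs. P xs \<longleftrightarrow> Q xs)"
  by (rule rec_rel_cong[OF rec_rel_and[OF rec_rel_imp[OF assms] rec_rel_imp[OF assms(2,1)]]]) auto

lemma rec_rel_le: "rec_fun n A \<Longrightarrow> rec_fun n B \<Longrightarrow> rec_rel n (\<lambda>xs. A xs \<le> B xs)"
  unfolding rec_rel_def
  by (rule rec_fun_cong[OF rec_fun_if_zero[OF rec_fun_diff[of n B A] rec_fun_const[of n 0] rec_fun_const[of n 1]]]) auto

lemma rec_rel_eq:
  assumes "rec_fun n A" "rec_fun n B"
  shows "rec_rel n (\<lambda>xs. A xs = B xs)"
  by (rule rec_rel_cong[OF rec_rel_and[OF rec_rel_le[OF assms] rec_rel_le[OF assms(2,1)]]]) auto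

lemma rec_rel_bex:
  assumes B: "rec_fun n B" and P: "rec_rel (Suc n) (\<lambda>ys. P (hd ys) (tl ys))"
  shows "rec_rel n (\<lambda>xs. \<exists>k<B xs. P k xs)"
proof -
  \<comment> \<open>One step of a bounded search with 0 for success: a witness sets the result to 0,
    otherwise the earlier result \<open>ys ! 1\<close> is kept.\<close>
  let ?G = "\<lambda>ys. if P (hd ys) (tl (tl ys)) then 0 else ys ! 1"
  have "rec_fun (Suc (Suc n)) (\<lambda>ys. if P (hd ys) (tl (tl ys)) then 0 else 1)"
  proof (rule rec_fun_cong[OF rec_fun_reindex[of "0 # [2..<Suc (Suc n)]"]])
    show "rec_fun (length (0 # [2..<Suc (Suc n)])) (\<lambda>ys. if P (hd ys) (tl ys) then 0 else 1)"
      using P by (simp add: rec_rel_def del: upt_Suc)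
    fix xs :: "nat list" assume l: "length xs = Suc (Suc n)"
    then have "tl (tl xs) = map ((!) xs) [2..<Suc (Suc n)]"
      by (intro nth_equalityI) (auto simp: nth_tl numeral_2_eq_2 simp del: upt_Suc)
    moreover have "hd xs = xs ! 0" using l by (cases xs) auto
    ultimately show "(if P (hd xs) (tl (tl xs)) then 0 else 1) =
        (if P (hd (map ((!) xs) (0 # [2..<Suc (Suc n)]))) (tl (map ((!) xs) (0 # [2..<Suc (Suc n)]))) then 0 else 1)"
      by (simp del: upt_Suc)
  qed auto
  then have "rec_rel (Suc (Suc n)) (\<lambda>ys. P (hd ys) (tl (tl ys)))" by (simp add: rec_rel_def)
  then have "rec_fun (Suc (Suc n)) ?G" by (rule rec_fun_if) (simp_all add: rec_fun_const rec_fun_nth)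
  from rec_fun_prim[OF rec_fun_const[of n 1] this]
  have "rec_fun (length (B # map (\<lambda>i xs. xs ! i) [0..<n]))
      (\<lambda>ys. rec_nat 1 (\<lambda>k r. ?G (k # r # tl ys)) (hd ys))"
    by simp
  then have "rec_fun n (\<lambda>xs. (\<lambda>ys. rec_nat 1 (\<lambda>k r. ?G (k # r # tl ys)) (hd ys))
      (map (\<lambda>G. G xs) (B # map (\<lambda>i xs. xs ! i) [0..<n])))"
    by (rule rec_fun_comp) (use B rec_fun_nth in auto)
  then show ?thesis
    unfolding rec_rel_def
  proof (rule rec_fun_cong)
    fix xs :: "nat list" assume "length xs = n"
    then have "map (\<lambda>i. xs ! i) [0..<n] = xs" by (auto intro: nth_equalityI)
    moreover have "rec_nat 1 (\<lambda>k r. ?G (k # r # xs)) b = (if \<exists>k<b. P k xs then 0 else 1)" for b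
      by (induction b) (auto simp: less_Suc_eq)
    ultimately show "(if \<exists>k<B xs. P k xs then 0 else 1) =
        (\<lambda>ys. rec_nat 1 (\<lambda>k r. ?G (k # r # tl ys)) (hd ys)) (map (\<lambda>G. G xs) (B # map (\<lambda>i xs. xs ! i) [0..<n]))"
      by (simp only: list.map map_map comp_def list.sel)
  qed
qed

lemma rec_rel_ball:
  assumes "rec_fun n B" "rec_rel (Suc n) (\<lambda>ys. P (hd ys) (tl ys))"
  shows "rec_rel n (\<lambda>xs. \<forall>k<B xs. P k xs)"
  by (rule rec_rel_cong[OF rec_rel_not[OF rec_rel_bex[OF assms(1) rec_rel_not[OF assms(2)]]]]) auto

lemma rec_fun_Least:
  assumes "rec_rel (Suc n) (\<lambda>ys. P (hd ys) (tl ys))" "\<And>xs. length xs = n \<Longrightarrow> \<exists>k. P k xs"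
  shows "rec_fun n (\<lambda>xs. LEAST k. P k xs)"
proof -
  have "rec_fun n (\<lambda>xs. LEAST k. (\<lambda>ys. if P (hd ys) (tl ys) then 0 else (1::nat)) (k # xs) = 0)"
    by (rule rec_fun_mini) (use assms in \<open>auto simp: rec_rel_def\<close>)
  then show ?thesis by (rule rec_fun_cong) simp
qed

lemma rec_fun_tl:
  assumes "rec_fun n F"
  shows "rec_fun (Suc n) (\<lambda>xs. F (tl xs))"
proof (rule rec_fun_cong[OF rec_fun_reindex[of "[1..<Suc n]" F]])
  fix xs :: "nat list" assume "length xs = Suc n"
  then show "F (tl xs) = F (map ((!) xs) [1..<Suc n])"
    by (intro arg_cong[of _ _ F] nth_equalityI) (auto simp: nth_tl simp del: upt_Suc)
qed (use assms in \<open>auto simp del: upt_Suc\<close>)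

lemma rec_fun_hd: "rec_fun (Suc n) hd"
proof (rule rec_fun_cong[OF rec_fun_nth[of 0]])
  fix xs :: "nat list" assume "length xs = Suc n"
  then show "hd xs = xs ! 0" by (cases xs) auto
qed simp

section \<open>Deciding the identities from a multiplication table\<close>

text \<open>A variable sits behind one \<open>tl\<close> for each enclosing bounded quantifier or
  search. Depth 8 occurs in \<open>next_table\<close>: the search and the quantifiers over
  \<open>i\<close>, \<open>j\<close>, \<open>p\<close>, \<open>w\<close>, \<open>w'\<close>,
  \<open>t\<close>, \<open>z\<close>.\<close>

lemmas rec_vars =
  rec_fun_nth rec_fun_nth[THEN rec_fun_tl] rec_fun_nth[THEN rec_fun_tl, THEN rec_fun_tl]
  rec_fun_nth[THEN rec_fun_tl, THEN rec_fun_tl, THEN rec_fun_tl]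
  rec_fun_nth[THEN rec_fun_tl, THEN rec_fun_tl, THEN rec_fun_tl, THEN rec_fun_tl]
  rec_fun_nth[THEN rec_fun_tl, THEN rec_fun_tl, THEN rec_fun_tl, THEN rec_fun_tl, THEN rec_fun_tl]
  rec_fun_nth[THEN rec_fun_tl, THEN rec_fun_tl, THEN rec_fun_tl, THEN rec_fun_tl, THEN rec_fun_tl, THEN rec_fun_tl]
  rec_fun_nth[THEN rec_fun_tl, THEN rec_fun_tl, THEN rec_fun_tl, THEN rec_fun_tl, THEN rec_fun_tl, THEN rec_fun_tl, THEN rec_fun_tl]
  rec_fun_nth[THEN rec_fun_tl, THEN rec_fun_tl, THEN rec_fun_tl, THEN rec_fun_tl, THEN rec_fun_tl, THEN rec_fun_tl, THEN rec_fun_tl, THEN rec_fun_tl]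
  rec_fun_hd rec_fun_hd[THEN rec_fun_tl] rec_fun_hd[THEN rec_fun_tl, THEN rec_fun_tl]
  rec_fun_hd[THEN rec_fun_tl, THEN rec_fun_tl, THEN rec_fun_tl]
  rec_fun_hd[THEN rec_fun_tl, THEN rec_fun_tl, THEN rec_fun_tl, THEN rec_fun_tl]
  rec_fun_hd[THEN rec_fun_tl, THEN rec_fun_tl, THEN rec_fun_tl, THEN rec_fun_tl, THEN rec_fun_tl]
  rec_fun_hd[THEN rec_fun_tl, THEN rec_fun_tl, THEN rec_fun_tl, THEN rec_fun_tl, THEN rec_fun_tl, THEN rec_fun_tl]
  rec_fun_hd[THEN rec_fun_tl, THEN rec_fun_tl, THEN rec_fun_tl, THEN rec_fun_tl, THEN rec_fun_tl, THEN rec_fun_tl, THEN rec_fun_tl]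

lemmas rec_logic = rec_rel_not rec_rel_and rec_rel_imp rec_rel_iff rec_rel_eq rec_rel_bex rec_rel_ball
  rec_fun_const rec_fun_Suc

section \<open>Decoding pairs, lists and tables\<close>

lemma rec2_prod_encode: "rec2 (\<lambda>a b. prod_encode (a, b))"
  unfolding rec2_def prod_encode_def prod.case
  by (intro rec_fun_add rec1_comp[OF rec1_triangle] rec_vars) simp_all

lemmas rec_fun_prod_encode = rec2_comp[OF rec2_prod_encode]

text \<open>Decoding by search; the other component is bounded because components never exceed the
  code of a pair.\<close>

lemma rec1_fst_decode: "rec1 (\<lambda>z. fst (prod_decode z))"
proof -
  have "fst (prod_decode z) = (LEAST a. \<exists>b<Suc z. prod_encode (a, b) = z)" for z
  proof (rule Least_equality[symmetric])
    show "\<exists>b<Suc z. prod_encode (fst (prod_decode z), b) = z"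
      using le_prod_encode_2[of "snd (prod_decode z)" "fst (prod_decode z)"]
      by (intro exI[of _ "snd (prod_decode z)"]) (auto simp: less_Suc_eq_le)
  qed (metis fst_conv order.refl prod_encode_inverse)
  moreover have "rec1 (\<lambda>z. LEAST a. \<exists>b<Suc z. prod_encode (a, b) = z)"
    unfolding rec1_def One_nat_def
  proof (rule rec_fun_Least)
    show "rec_rel (Suc (Suc 0)) (\<lambda>ys. \<exists>b<Suc (tl ys ! 0). prod_encode (hd ys, b) = tl ys ! 0)"
      by (intro rec_logic rec_fun_prod_encode rec_vars) simp_all
    show "\<exists>k. \<exists>b<Suc (xs ! 0). prod_encode (k, b) = xs ! 0" if "length xs = Suc 0" for xs :: "nat list"
      using le_prod_encode_2[of "snd (prod_decode (xs ! 0))" "fst (prod_decode (xs ! 0))"]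
      by (intro exI[of _ "fst (prod_decode (xs ! 0))"] exI[of _ "snd (prod_decode (xs ! 0))"])
        (auto simp: less_Suc_eq_le)
  qed
  ultimately show ?thesis by simp
qed

lemma rec1_snd_decode: "rec1 (\<lambda>z. snd (prod_decode z))"
proof -
  have "snd (prod_decode z) = (LEAST b. \<exists>a<Suc z. prod_encode (a, b) = z)" for z
  proof (rule Least_equality[symmetric])
    show "\<exists>a<Suc z. prod_encode (a, snd (prod_decode z)) = z"
      using le_prod_encode_1[of "fst (prod_decode z)" "snd (prod_decode z)"]
      by (intro exI[of _ "fst (prod_decode z)"]) (auto simp: less_Suc_eq_le)
  qed (metis snd_conv order.refl prod_encode_inverse)
  moreover have "rec1 (\<lambda>z. LEAST b. \<exists>a<Suc z. prod_encode (a, b) = z)"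
    unfolding rec1_def One_nat_def
  proof (rule rec_fun_Least)
    show "rec_rel (Suc (Suc 0)) (\<lambda>ys. \<exists>a<Suc (tl ys ! 0). prod_encode (a, hd ys) = tl ys ! 0)"
      by (intro rec_logic rec_fun_prod_encode rec_vars) simp_all
    show "\<exists>k. \<exists>a<Suc (xs ! 0). prod_encode (a, k) = xs ! 0" if "length xs = Suc 0" for xs :: "nat list"
      using le_prod_encode_1[of "fst (prod_decode (xs ! 0))" "snd (prod_decode (xs ! 0))"]
      by (intro exI[of _ "snd (prod_decode (xs ! 0))"] exI[of _ "fst (prod_decode (xs ! 0))"])
        (auto simp: less_Suc_eq_le)
  qed
  ultimately show ?thesis by simp
qed

text \<open>A nonempty list is coded by the successor of the pair of its head and the code of its
  tail, so \<open>r - 1\<close> is that pair. Past the end, 0 decodes to \<open>(0, 0)\<close> and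
  the result stays 0.\<close>

definition drop_code :: "nat \<Rightarrow> nat \<Rightarrow> nat" where
  "drop_code i c = rec_nat c (\<lambda>k r. snd (prod_decode (r - 1))) i"

text \<open>The search always ends: every number codes a list, and dropping all its elements gives
  0.\<close>

definition len_code :: "nat \<Rightarrow> nat" where
  "len_code c = (LEAST i. drop_code i c = 0)"

definition nth_code :: "nat \<Rightarrow> nat \<Rightarrow> nat" where
  "nth_code c i = fst (prod_decode (drop_code i c - 1))"

definition entry :: "nat \<Rightarrow> nat \<Rightarrow> nat \<Rightarrow> nat" where
  "entry c i j = nth_code (nth_code c i) j"

lemma drop_code_list_encode: "drop_code i (list_encode xs) = list_encode (drop i xs)"
proof (induction i)
  case (Suc i)
  have "drop (Suc i) xs = tl (drop i xs)" by (simp add: drop_Suc tl_drop)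
  moreover have "snd (prod_decode (list_encode ys - 1)) = list_encode (tl ys)" for ys
  proof (cases ys)
    case Nil
    have "prod_decode 0 = (0, 0)" using prod_encode_inverse[of "(0, 0)"] by (simp add: prod_encode_def)
    then show ?thesis using Nil by simp
  qed simp
  ultimately show ?case using Suc by (simp add: drop_code_def)
qed (simp add: drop_code_def)

lemma drop_code_vanishes: "drop_code (length (list_decode c)) c = 0"
  using drop_code_list_encode[of "length (list_decode c)" "list_decode c"] by simp

lemma len_code_list_encode: "len_code (list_encode xs) = length xs"
  unfolding len_code_def
proof (rule Least_equality)
  fix i assume "drop_code i (list_encode xs) = 0"
  then have "drop i xs = []" using list_encode_eq[of "drop i xs" "[]"] by (simp add: drop_code_list_encode)
  then show "length xs \<le> i" by simp
qed (simp add: drop_code_list_encode)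

lemma nth_code_list_encode: "i < length xs \<Longrightarrow> nth_code (list_encode xs) i = xs ! i"
  by (simp add: nth_code_def drop_code_list_encode flip: Cons_nth_drop_Suc)

lemma rec2_drop_code: "rec2 drop_code"
proof -
  have 1: "rec1 (\<lambda>y. y)" unfolding rec1_def by (intro rec_vars) simp
  have 2: "rec3 (\<lambda>k r y. snd (prod_decode (r - 1)))"
    unfolding rec3_def by (intro rec1_comp[OF rec1_snd_decode] rec1_comp[OF rec1_pred] rec_vars) simp
  have "drop_code = (\<lambda>x y. rec_nat y (\<lambda>k r. snd (prod_decode (r - 1))) x)"
    by (simp add: drop_code_def fun_eq_iff)
  then show ?thesis using rec2_prim[OF 1 2] by simp
qed

lemma rec1_len_code: "rec1 len_code"
  unfolding rec1_def len_code_def One_nat_def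
proof (rule rec_fun_Least)
  show "rec_rel (Suc (Suc 0)) (\<lambda>ys. drop_code (hd ys) (tl ys ! 0) = 0)"
    by (intro rec_logic rec2_comp[OF rec2_drop_code] rec_vars) simp
qed (use drop_code_vanishes in blast)

lemma rec2_nth_code: "rec2 nth_code"
  unfolding rec2_def nth_code_def
  by (intro rec1_comp[OF rec1_fst_decode] rec1_comp[OF rec1_pred] rec2_comp[OF rec2_drop_code] rec_vars) simp_all

lemma rec3_entry: "rec3 entry"
  unfolding rec3_def entry_def by (intro rec2_comp[OF rec2_nth_code] rec_vars) simp_all

lemmas rec_fun_len = rec1_comp[OF rec1_len_code] and rec_fun_entry = rec3_comp[OF rec3_entry]

definition table :: "(nat \<Rightarrow> nat \<Rightarrow> nat) \<Rightarrow> nat \<Rightarrow> nat" where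
  "table f n = list_encode (map (\<lambda>i. list_encode (map (f i) [0..<n])) [0..<n])"

lemma len_code_table: "len_code (table f n) = n"
  by (simp add: table_def len_code_list_encode)

lemma entry_table: "i < n \<Longrightarrow> j < n \<Longrightarrow> entry (table f n) i j = f i j"
  by (simp add: table_def entry_def nth_code_list_encode)

lemma table_code_eq: "table_code M = table (\<lambda>i j. i \<otimes>\<^bsub>M\<^esub> j) (card (carrier M))"
  by (simp add: table_code_def table_def Let_def)

definition next_pair :: "nat \<Rightarrow> nat \<Rightarrow> nat \<Rightarrow> nat \<Rightarrow> bool" where
  "next_pair S c i j \<longleftrightarrow>
     (\<exists>p<len_code c. \<exists>w<len_code c. \<exists>w'<len_code c. \<exists>t<len_code c.
        i = entry c (entry c p w) t \<and> j = entry c (entry c p w') t \<and> entry S w w' = 1 \<and>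
        (\<exists>z<len_code c. entry c (entry c p w) z = p) \<and> (\<exists>z<len_code c. entry c (entry c p w') z = p) \<and>
        (\<exists>z<len_code c. entry c z (entry c w t) = t) \<and> (\<exists>z<len_code c. entry c z (entry c w' t) = t))"

text \<open>Any code with the right entries below \<open>len_code c\<close> serves, so a search
  replaces an explicit construction of lists; \<open>table_exists\<close> makes the search
  succeed.\<close>

definition next_table :: "nat \<Rightarrow> nat \<Rightarrow> nat" where
  "next_table S c = (LEAST T. \<forall>i<len_code c. \<forall>j<len_code c. entry T i j = 1 \<longleftrightarrow> next_pair S c i j)"

definition full_table :: "nat \<Rightarrow> nat" where
  "full_table c = (LEAST T. \<forall>i<len_code c. \<forall>j<len_code c. entry T i j = 1)"

text \<open>The level is an argument of the recursion, which makes the procedure uniform in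
  \<open>m\<close>.\<close>

definition pair_table :: "nat \<Rightarrow> nat \<Rightarrow> nat" where
  "pair_table n c = rec_nat (full_table c) (\<lambda>k r. next_table r c) n"

definition join_code :: "nat \<Rightarrow> nat \<Rightarrow> bool" where
  "join_code m c \<longleftrightarrow>
     (\<forall>e<len_code c. \<forall>a<len_code c. \<forall>x<len_code c. \<forall>b<len_code c.
        entry c e e = e \<longrightarrow> entry c (entry c a x) b = e \<longrightarrow> entry c (entry c e x) e = e) \<and>
     (\<forall>i<len_code c. \<forall>j<len_code c. entry (pair_table (m - 1) c) i j = 1 \<longrightarrow> i = j)"

lemma table_exists: "\<exists>T. \<forall>i<n. \<forall>j<n. entry T i j = 1 \<longleftrightarrow> Q i j"
  by (intro exI[of _ "table (\<lambda>i j. if Q i j then 1 else 0) n"]) (simp add: entry_table)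

lemma entry_next_table:
  "i < len_code c \<Longrightarrow> j < len_code c \<Longrightarrow> entry (next_table S c) i j = 1 \<longleftrightarrow> next_pair S c i j"
  using LeastI_ex[OF table_exists[of "len_code c" "next_pair S c"]] unfolding next_table_def by blast

lemma entry_full_table: "i < len_code c \<Longrightarrow> j < len_code c \<Longrightarrow> entry (full_table c) i j = 1"
  using LeastI_ex[OF table_exists[of "len_code c" "\<lambda>_ _. True"]] unfolding full_table_def by simp

lemma rec2_next_table: "rec2 next_table"
  unfolding rec2_def next_table_def numeral_2_eq_2
proof (rule rec_fun_Least)
  show "rec_rel (Suc (Suc (Suc 0))) (\<lambda>ys. \<forall>i<len_code (tl ys ! 1). \<forall>j<len_code (tl ys ! 1).
      entry (hd ys) i j = 1 \<longleftrightarrow> next_pair (tl ys ! 0) (tl ys ! 1) i j)"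
    unfolding next_pair_def by (intro rec_logic rec_fun_len rec_fun_entry rec_vars) simp_all
qed (rule table_exists)

lemma rec1_full_table: "rec1 full_table"
  unfolding rec1_def full_table_def One_nat_def
proof (rule rec_fun_Least)
  show "rec_rel (Suc (Suc 0)) (\<lambda>ys. \<forall>i<len_code (tl ys ! 0). \<forall>j<len_code (tl ys ! 0). entry (hd ys) i j = Suc 0)"
    by (intro rec_logic rec_fun_len rec_fun_entry rec_vars) simp_all
  show "\<exists>k. \<forall>i<len_code (xs ! 0). \<forall>j<len_code (xs ! 0). entry k i j = Suc 0" for xs
    using table_exists[of "len_code (xs ! 0)" "\<lambda>_ _. True"] by simp
qed

lemma rec2_pair_table: "rec2 pair_table"
proof -
  have "rec3 (\<lambda>k r y. next_table r y)"
    unfolding rec3_def by (intro rec2_comp[OF rec2_next_table] rec_vars) simp_all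
  from rec2_prim[OF rec1_full_table this]
  have "rec2 (\<lambda>x y. rec_nat (full_table y) (\<lambda>k r. next_table r y) x)" .
  moreover have "pair_table = (\<lambda>x y. rec_nat (full_table y) (\<lambda>k r. next_table r y) x)"
    by (simp add: pair_table_def fun_eq_iff)
  ultimately show ?thesis by (simp only:)
qed

lemma rec_rel_join_code: "rec_rel 2 (\<lambda>xs. join_code (xs ! 0) (xs ! 1))"
  unfolding join_code_def numeral_2_eq_2
  by (intro rec_logic rec_fun_len rec_fun_entry rec2_comp[OF rec2_pair_table] rec1_comp[OF rec1_pred] rec_vars)
    simp_all

section \<open>Correctness of the test on a table\<close>

context
  fixes M :: "nat monoid" and c :: nat
  assumes M: "M \<in> finite_monoids" and carrier: "carrier M = {..<card (carrier M)}" and c: "c = table_code M"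
begin

lemma len_code_eq: "len_code c = card (carrier M)"
  by (simp add: c table_code_eq len_code_table)

lemma mem_carrier_iff: "x \<in> carrier M \<longleftrightarrow> x < len_code c"
  using carrier len_code_eq by auto

lemma entry_eq: "x < len_code c \<Longrightarrow> y < len_code c \<Longrightarrow> entry c x y = x \<otimes>\<^bsub>M\<^esub> y"
  unfolding len_code_eq by (simp add: c table_code_eq entry_table)

lemma mult_less: "x < len_code c \<Longrightarrow> y < len_code c \<Longrightarrow> x \<otimes>\<^bsub>M\<^esub> y < len_code c"
  using M monoid.m_closed[of M x y] by (simp add: finite_monoids_def flip: mem_carrier_iff)

lemma pair_table_iff:
  "(i, j) \<in> stable_pairs M n \<longleftrightarrow> i < len_code c \<and> j < len_code c \<and> entry (pair_table n c) i j = 1"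
proof (induction n arbitrary: i j)
  case 0
  then show ?case using entry_full_table by (auto simp: pair_table_def mem_carrier_iff)
next
  case (Suc n)
  have mM: "monoid M" using M by (simp add: finite_monoids_def)
  have "(i, j) \<in> stable_pairs M (Suc n) \<longleftrightarrow> next_pair (pair_table n c) c i j"
  proof
    assume "(i, j) \<in> stable_pairs M (Suc n)"
    then obtain p w w' t where *: "i = p \<otimes>\<^bsub>M\<^esub> w \<otimes>\<^bsub>M\<^esub> t" "j = p \<otimes>\<^bsub>M\<^esub> w' \<otimes>\<^bsub>M\<^esub> t"
      "p < len_code c" "t < len_code c" "(w, w') \<in> stable_pairs M n"
      "rstab M p w" "rstab M p w'" "lstab M w t" "lstab M w' t"
      by (auto simp: mem_carrier_iff)
    have w: "w < len_code c" "w' < len_code c" "entry (pair_table n c) w w' = 1" using *(5) Suc by auto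
    show "next_pair (pair_table n c) c i j"
      unfolding next_pair_def
      by (rule exI[of _ p], rule conjI[OF *(3)], rule exI[of _ w], rule conjI[OF w(1)],
          rule exI[of _ w'], rule conjI[OF w(2)], rule exI[of _ t], rule conjI[OF *(4)])
        (use * w in \<open>auto simp: entry_eq mult_less rstab_def lstab_def mem_carrier_iff\<close>)
  next
    assume "next_pair (pair_table n c) c i j"
    then obtain p w w' t where *: "p < len_code c" "w < len_code c" "w' < len_code c" "t < len_code c"
      "i = entry c (entry c p w) t" "j = entry c (entry c p w') t" "entry (pair_table n c) w w' = 1"
      "\<exists>z<len_code c. entry c (entry c p w) z = p" "\<exists>z<len_code c. entry c (entry c p w') z = p"
      "\<exists>z<len_code c. entry c z (entry c w t) = t" "\<exists>z<len_code c. entry c z (entry c w' t) = t"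
      unfolding next_pair_def by blast
    have "(w, w') \<in> stable_pairs M n" using * Suc by simp
    then show "(i, j) \<in> stable_pairs M (Suc n)"
      unfolding stable_pairs.simps mem_Collect_eq using *
      by (intro exI[of _ p] exI[of _ w] exI[of _ w'] exI[of _ t])
        (auto simp: entry_eq mult_less rstab_def lstab_def mem_carrier_iff)
  qed
  moreover have "i < len_code c \<and> j < len_code c" if "(i, j) \<in> stable_pairs M (Suc n)"
    using stable_pairs_closed[OF mM that] by (simp add: mem_carrier_iff)
  moreover have "pair_table (Suc n) c = next_table (pair_table n c) c" by (simp add: pair_table_def)
  ultimately show ?case using entry_next_table by auto
qed

lemma join_code_iff: "join_code m c \<longleftrightarrow> join_cond (m - 1) M"
proof -
  have "stable_pairs M (m - 1) \<subseteq> Id \<longleftrightarrow>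
      (\<forall>i<len_code c. \<forall>j<len_code c. entry (pair_table (m - 1) c) i j = 1 \<longrightarrow> i = j)"
    using pair_table_iff by auto
  moreover have "is_DA M \<longleftrightarrow> (\<forall>e<len_code c. \<forall>a<len_code c. \<forall>x<len_code c. \<forall>b<len_code c.
        entry c e e = e \<longrightarrow> entry c (entry c a x) b = e \<longrightarrow> entry c (entry c e x) e = e)"
    unfolding is_DA_def Ball_def mem_carrier_iff by (auto simp: entry_eq mult_less)
  ultimately show ?thesis by (simp add: join_code_def join_cond_def)
qed

end

theorem corollary2:
  shows "\<exists>f. recursive 2 f \<and>
    (\<forall>m\<ge>2. \<forall>M\<in>finite_monoids. carrier M = {..<card (carrier M)} \<longrightarrow>
       f [m, table_code M] = (if M \<in> variety_join (TW_R m) (TW_L m) then 1 else 0))"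
proof -
  have "rec_fun 2 (\<lambda>xs. if join_code (xs ! 0) (xs ! 1) then 1 else 0)"
    by (intro rec_fun_if rec_rel_join_code rec_fun_const)
  then obtain f where f: "recursive 2 f"
    "\<And>xs. length xs = 2 \<Longrightarrow> (if join_code (xs ! 0) (xs ! 1) then 1 else 0) = f xs"
    unfolding rec_fun_def by blast
  have "f [m, table_code M] = (if M \<in> variety_join (TW_R m) (TW_L m) then 1 else 0)"
    if "m \<ge> 2" "M \<in> finite_monoids" "carrier M = {..<card (carrier M)}" for m M
    using f(2)[of "[m, table_code M]"] join_code_iff[OF that(2,3) refl, of m] variety_join_iff[OF that(1,2)]
    by simp
  then show ?thesis using f(1) by blast
qed

end
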